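(* Let $X$ be an irreducible sofic shift and $\pi: X\to Y$ a finite-to-one factor code. Let $\nu$ be a fully supported ergodic measure on $Y$. Then $$d_\pi=\sum_\mu m_\pi(\mu),$$ where $\mu$ runs over all ergodic lifts of $\nu$, i.e. all ergodic measures $\mu$ on $X$ with $\pi\mu=\nu$, and $m_\pi(\mu)$ is the multiplicity of $\mu$ with respect to $\pi$.
   Context: Shift spaces are two-sided with finite alphabet; "measure" means Borel probability measure, and "ergodic measure" means an ergodic shift-invariant measure. A factor code is a shift-commuting continuous surjection between shift spaces. For a finite-to-one factor code $\pi$ on an irreducible sofic shift, every doubly transitive point of $Y$ has the same finite number of preimages; this number is the degree $d_\pi$. An $n$-fold ($\pi$-)relative joining is a measure $\lambda$ on $X^n$, invariant under the product (diagonal) shift action, such that the set $X^n_\pi=\{(x^{(1)},\dots,x^{(n)})\in X^n:\pi(x^{(1)})=\dots=\pi(x^{(n)})\}$ has full $\lambda$-measure. With $p_i:X^n\to X$ the $i$-th coordinate projection, it is a relative joining over $\nu$ if $\pi p_i\lambda=\nu$ for some (hence every) $i$ (maps applied to measures mean pushforward; $p_i\lambda$ is the $i$-th margin). It is separating if for $\lambda$-a.e. $(x^{(1)},\dots,x^{(n)})$ the points $x^{(1)},\dots,x^{(n)}$ are $n$ distinct points. A degree joining over $\nu$ (with respect to $\pi$) is an ergodic $d_\pi$-fold separating relative joining over $\nu$; one exists and it is unique up to permutation of coordinates. An ergodic lift of a fully supported $\nu$ is fully supported. The multiplicity of a fully supported ergodic measure $\mu$ on $X$ is $m_\pi(\mu):=\#\{i:1\le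 i\le d_\pi,\ p_i\lambda=\mu\}$, where $\lambda$ is a degree joining over $\pi\mu$ (independent of the choice of $\lambda$). *)

theory Defs
  imports "HOL-Probability.Probability"
begin

definition shift :: "(int \<Rightarrow> 'a) \<Rightarrow> int \<Rightarrow> 'a" where
  "shift x = (\<lambda>i. x (i + 1))"

definition full_topology :: "(int \<Rightarrow> 'a) topology" where
  "full_topology = product_topology (\<lambda>_. discrete_topology UNIV) UNIV"

text \<open>The alphabet is a finite subset of the symbol type, which itself may be infinite; the
  topology induced on sequences over a finite alphabet is the usual compact product topology.\<close>

definition shift_space :: "(int \<Rightarrow> 'a) set \<Rightarrow> bool" where
  "shift_space X \<longleftrightarrow>
     (\<exists>A. finite A \<and> (\<forall>x\<in>X. range x \<subseteq> A)) \<and> closedin full_topology X \<and> shift ` X = X"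

abbreviation shift_topology :: "(int \<Rightarrow> 'a) set \<Rightarrow> (int \<Rightarrow> 'a) topology" where
  "shift_topology X \<equiv> subtopology full_topology X"

definition occurs_at :: "'a list \<Rightarrow> (int \<Rightarrow> 'a) \<Rightarrow> int \<Rightarrow> bool" where
  "occurs_at w x i \<longleftrightarrow> (\<forall>k<length w. x (i + int k) = w ! k)"

definition language :: "(int \<Rightarrow> 'a) set \<Rightarrow> 'a list set" where
  "language X = {w. \<exists>x\<in>X. \<exists>i. occurs_at w x i}"

definition irreducible_shift :: "(int \<Rightarrow> 'a) set \<Rightarrow> bool" where
  "irreducible_shift X \<longleftrightarrow>
     (\<forall>u\<in>language X. \<forall>v\<in>language X. \<exists>w. u @ w @ v \<in> language X)"

definition shift_of_finite_type :: "(int \<Rightarrow> 'a) set \<Rightarrow> bool" where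
  "shift_of_finite_type X \<longleftrightarrow>
     (\<exists>A F. finite A \<and> finite F \<and>
        X = {x. range x \<subseteq> A \<and> (\<forall>w\<in>F. \<forall>i. \<not> occurs_at w x i)})"

definition factor_code ::
    "((int \<Rightarrow> 'a) \<Rightarrow> (int \<Rightarrow> 'b)) \<Rightarrow> (int \<Rightarrow> 'a) set \<Rightarrow> (int \<Rightarrow> 'b) set \<Rightarrow> bool" where
  "factor_code \<pi> X Y \<longleftrightarrow> shift_space X \<and> shift_space Y \<and>
     continuous_map (shift_topology X) (shift_topology Y) \<pi> \<and> \<pi> ` X = Y \<and>
     (\<forall>x\<in>X. \<pi> (shift x) = shift (\<pi> x))"

text \<open>Sofic shifts are the factors of shifts of finite type. Since finite alphabets can be
  renamed, it is no loss to take the symbols of the covering shift from \<^typ>\<open>nat\<close>.\<close>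

definition sofic :: "(int \<Rightarrow> 'a) set \<Rightarrow> bool" where
  "sofic X \<longleftrightarrow>
     (\<exists>(Z :: (int \<Rightarrow> nat) set) \<phi>. shift_of_finite_type Z \<and> factor_code \<phi> Z X)"

definition fiber :: "('p \<Rightarrow> 'q) \<Rightarrow> 'p set \<Rightarrow> 'q \<Rightarrow> 'p set" where
  "fiber \<pi> X y = {x \<in> X. \<pi> x = y}"

definition finite_to_one ::
    "((int \<Rightarrow> 'a) \<Rightarrow> (int \<Rightarrow> 'b)) \<Rightarrow> (int \<Rightarrow> 'a) set \<Rightarrow> (int \<Rightarrow> 'b) set \<Rightarrow> bool" where
  "finite_to_one \<pi> X Y \<longleftrightarrow> (\<forall>y\<in>Y. finite (fiber \<pi> X y))"

definition doubly_transitive :: "(int \<Rightarrow> 'b) set \<Rightarrow> (int \<Rightarrow> 'b) \<Rightarrow> bool" where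
  "doubly_transitive Y y \<longleftrightarrow> y \<in> Y \<and>
     (\<forall>w\<in>language Y. \<forall>n. (\<exists>i\<ge>n. occurs_at w y i) \<and> (\<exists>i\<le>n. occurs_at w y i))"

definition degree_code ::
    "((int \<Rightarrow> 'a) \<Rightarrow> (int \<Rightarrow> 'b)) \<Rightarrow> (int \<Rightarrow> 'a) set \<Rightarrow> (int \<Rightarrow> 'b) set \<Rightarrow> nat" where
  "degree_code \<pi> X Y =
     (THE d. \<forall>y. doubly_transitive Y y \<longrightarrow> finite (fiber \<pi> X y) \<and> card (fiber \<pi> X y) = d)"

definition borel_of :: "'p topology \<Rightarrow> 'p measure" where
  "borel_of T = sigma (topspace T) {U. openin T U}"

definition borel_probability :: "'p topology \<Rightarrow> 'p measure \<Rightarrow> bool" where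
  "borel_probability T \<mu> \<longleftrightarrow> sets \<mu> = sets (borel_of T) \<and> prob_space \<mu>"

definition invariant_measure :: "'p topology \<Rightarrow> ('p \<Rightarrow> 'p) \<Rightarrow> 'p measure \<Rightarrow> bool" where
  "invariant_measure T S \<mu> \<longleftrightarrow>
     borel_probability T \<mu> \<and> S \<in> measurable \<mu> \<mu> \<and> distr \<mu> \<mu> S = \<mu>"

definition ergodic_measure :: "'p topology \<Rightarrow> ('p \<Rightarrow> 'p) \<Rightarrow> 'p measure \<Rightarrow> bool" where
  "ergodic_measure T S \<mu> \<longleftrightarrow> invariant_measure T S \<mu> \<and>
     (\<forall>A\<in>sets \<mu>. S -` A \<inter> space \<mu> = A \<longrightarrow> measure \<mu> A = 0 \<or> measure \<mu> A = 1)"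

definition fully_supported :: "'p topology \<Rightarrow> 'p measure \<Rightarrow> bool" where
  "fully_supported T \<mu> \<longleftrightarrow> (\<forall>U. openin T U \<and> U \<noteq> {} \<longrightarrow> emeasure \<mu> U > 0)"

definition ergodic_on :: "(int \<Rightarrow> 'a) set \<Rightarrow> (int \<Rightarrow> 'a) measure \<Rightarrow> bool" where
  "ergodic_on X \<mu> \<longleftrightarrow> ergodic_measure (shift_topology X) shift \<mu>"

definition push :: "('p \<Rightarrow> (int \<Rightarrow> 'b)) \<Rightarrow> (int \<Rightarrow> 'b) set \<Rightarrow> 'p measure \<Rightarrow> (int \<Rightarrow> 'b) measure" where
  "push f Z \<mu> = distr \<mu> (borel_of (shift_topology Z)) f"

definition ergodic_lifts ::
    "((int \<Rightarrow> 'a) \<Rightarrow> (int \<Rightarrow> 'b)) \<Rightarrow> (int \<Rightarrow> 'a) set \<Rightarrow> (int \<Rightarrow> 'b) set \<Rightarrow>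
     (int \<Rightarrow> 'b) measure \<Rightarrow> (int \<Rightarrow> 'a) measure set" where
  "ergodic_lifts \<pi> X Y \<nu> = {\<mu>. ergodic_on X \<mu> \<and> push \<pi> Y \<mu> = \<nu>}"

text \<open>Elements of $X^n$ are represented by extensional functions on \<open>{..<n}\<close>, so coordinates
  are numbered from 0.\<close>

definition power_topology :: "nat \<Rightarrow> (int \<Rightarrow> 'a) set \<Rightarrow> (nat \<Rightarrow> int \<Rightarrow> 'a) topology" where
  "power_topology n X = product_topology (\<lambda>_. shift_topology X) {..<n}"

definition diagonal_shift :: "nat \<Rightarrow> (nat \<Rightarrow> int \<Rightarrow> 'a) \<Rightarrow> nat \<Rightarrow> int \<Rightarrow> 'a" where
  "diagonal_shift n x = (\<lambda>i\<in>{..<n}. shift (x i))"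

definition margin :: "(int \<Rightarrow> 'a) set \<Rightarrow> nat \<Rightarrow> (nat \<Rightarrow> int \<Rightarrow> 'a) measure \<Rightarrow> (int \<Rightarrow> 'a) measure" where
  "margin X i \<Lambda> = push (\<lambda>x. x i) X \<Lambda>"

definition relative_joining ::
    "((int \<Rightarrow> 'a) \<Rightarrow> (int \<Rightarrow> 'b)) \<Rightarrow> (int \<Rightarrow> 'a) set \<Rightarrow> nat \<Rightarrow>
     (nat \<Rightarrow> int \<Rightarrow> 'a) measure \<Rightarrow> bool" where
  "relative_joining \<pi> X n \<Lambda> \<longleftrightarrow>
     invariant_measure (power_topology n X) (diagonal_shift n) \<Lambda> \<and>
     (AE x in \<Lambda>. \<forall>i<n. \<forall>j<n. \<pi> (x i) = \<pi> (x j))"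

definition relative_joining_over ::
    "((int \<Rightarrow> 'a) \<Rightarrow> (int \<Rightarrow> 'b)) \<Rightarrow> (int \<Rightarrow> 'a) set \<Rightarrow> (int \<Rightarrow> 'b) set \<Rightarrow> nat \<Rightarrow>
     (int \<Rightarrow> 'b) measure \<Rightarrow> (nat \<Rightarrow> int \<Rightarrow> 'a) measure \<Rightarrow> bool" where
  "relative_joining_over \<pi> X Y n \<nu> \<Lambda> \<longleftrightarrow>
     relative_joining \<pi> X n \<Lambda> \<and> (\<exists>i<n. push \<pi> Y (margin X i \<Lambda>) = \<nu>)"

definition separating :: "nat \<Rightarrow> (nat \<Rightarrow> int \<Rightarrow> 'a) measure \<Rightarrow> bool" where
  "separating n \<Lambda> \<longleftrightarrow> (AE x in \<Lambda>. inj_on x {..<n})"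

definition degree_joining ::
    "((int \<Rightarrow> 'a) \<Rightarrow> (int \<Rightarrow> 'b)) \<Rightarrow> (int \<Rightarrow> 'a) set \<Rightarrow> (int \<Rightarrow> 'b) set \<Rightarrow>
     (int \<Rightarrow> 'b) measure \<Rightarrow> (nat \<Rightarrow> int \<Rightarrow> 'a) measure \<Rightarrow> bool" where
  "degree_joining \<pi> X Y \<nu> \<Lambda> \<longleftrightarrow>
     (let d = degree_code \<pi> X Y in
        relative_joining_over \<pi> X Y d \<nu> \<Lambda> \<and> separating d \<Lambda> \<and>
        ergodic_measure (power_topology d X) (diagonal_shift d) \<Lambda>)"

text \<open>Degree joinings over a fixed measure are unique up to permuting coordinates, so the number
  below does not depend on which of them is chosen.\<close>

definition multiplicity_measure ::
    "((int \<Rightarrow> 'a) \<Rightarrow> (int \<Rightarrow> 'b)) \<Rightarrow> (int \<Rightarrow> 'a) set \<Rightarrow> (int \<Rightarrow> 'b) set \<Rightarrow>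
     (int \<Rightarrow> 'a) measure \<Rightarrow> nat" where
  "multiplicity_measure \<pi> X Y \<mu> =
     (let \<Lambda> = (SOME \<Lambda>. degree_joining \<pi> X Y (push \<pi> Y \<mu>) \<Lambda>) in
        card {i. i < degree_code \<pi> X Y \<and> margin X i \<Lambda> = \<mu>})"

end

theory Submission
  imports Defs
begin

text \<open>Fix a fully supported ergodic measure \<open>\<nu>\<close> on \<open>Y\<close>. Over \<open>\<nu>\<close>-almost every point \<open>y\<close> the fiber of \<open>\<pi>\<close> has exactly
\<open>d = d\<^sub>\<pi>\<close> points, and a degree joining \<open>\<Lambda>\<close> over \<open>\<nu>\<close> is an ergodic way of listing these points as a
\<open>d\<close>-tuple. All multiplicities are read off from one and the same \<open>\<Lambda>\<close>, because every lift of \<open>\<nu>\<close> projects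
to \<open>\<nu>\<close>. The \<open>d\<close> margins of \<open>\<Lambda>\<close> are ergodic lifts of \<open>\<nu>\<close>; conversely a set that is null for all margins meets
almost no fiber, so it is null for every lift. An ergodic measure dominated by finitely many ergodic
measures is one of them, and hence the lifts of \<open>\<nu>\<close> are exactly the margins of \<open>\<Lambda>\<close>
(\<open>ergodic_lifts_eq_margins\<close>). Sorting the \<open>d\<close> coordinates by their margin gives the formula.

Two facts carry this argument. The first is that the degree exists (\<open>degree_exists\<close>): all doubly
transitive points have equally many preimages. For a one-block code on a finite irreducible graph this
is the theory of magic words: choose a word \<open>w\<close> and a position at which the preimages of \<open>w\<close> pass through as few
states as possible. Because no diamonds exist, preimages of words that begin and end with \<open>w\<close> permute
these minimal states, so a point in which \<open>w\<close> recurs in both directions has one preimage for each of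
them (\<open>degree_of_graph_code\<close>). A sofic shift has finitely many follower sets, and the follower sets of
the words containing a synchronizing word span a deterministic graph presenting \<open>X\<close>, the Fischer cover. Its
label map is injective over doubly transitive points, since their preimages keep meeting the
synchronizing word; therefore the fibers in \<open>X\<close> and in the cover have the same size (\<open>fiber_cover\<close>).
Recurrence shows that \<open>\<nu>\<close>-almost every point is doubly transitive (\<open>AE_doubly_transitive\<close>).

The second fact is that a degree joining exists (\<open>degree_joining_exists\<close>). The tuples that enumerate a
fiber form a finite extension of \<open>Y\<close>. For a Borel set \<open>A\<close> of such tuples, the number of its elements over
\<open>y\<close> is a measurable function of \<open>y\<close> (\<open>fiber_count_measurable\<close>), and it is almost everywhere constant when \<open>A\<close> is
invariant. An invariant \<open>A\<close> whose constant is positive and minimal cannot be split further, so counting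
measure on the fibers of \<open>A\<close>, integrated against \<open>\<nu>\<close> and normalized, is ergodic. This replaces the
ergodic decomposition.\<close>

section \<open>Words and limits of bi-infinite sequences\<close>

definition word :: "(int \<Rightarrow> 'a) \<Rightarrow> int \<Rightarrow> nat \<Rightarrow> 'a list" where
  "word x i n = map (\<lambda>k. x (i + int k)) [0..<n]"

lemma length_word [simp]: "length (word x i n) = n"
  by (simp add: word_def)

lemma nth_word [simp]: "k < n \<Longrightarrow> word x i n ! k = x (i + int k)"
  by (simp add: word_def)

lemma take_drop_word: "a + k \<le> n \<Longrightarrow> take k (drop a (word x i n)) = word x (i + int a) k"
  by (rule nth_equalityI) (auto simp: algebra_simps)

lemma word_append: "word x i (m + n) = word x i m @ word x (i + int m) n"
  by (rule nth_equalityI) (auto simp: nth_append algebra_simps)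

lemma occurs_at_word: "occurs_at w x i \<longleftrightarrow> word x i (length w) = w"
  by (auto simp: occurs_at_def list_eq_iff_nth_eq)

text \<open>Compactness of sequences over a finite alphabet in combinatorial form: nested windows are fixed one
  after the other by the pigeonhole principle.\<close>

lemma cluster_point:
  fixes f :: "nat \<Rightarrow> int \<Rightarrow> 's"
  assumes fin: "finite S" and f: "\<And>m i. f m i \<in> S"
  obtains z where "\<And>n. \<exists>m\<ge>n. \<forall>i. \<bar>i\<bar> \<le> int n \<longrightarrow> f m i = z i"
proof -
  let ?M = "\<lambda>n h. {m. \<forall>i. \<bar>i\<bar> \<le> int n \<longrightarrow> f m i = h i}"
  have "\<exists>h. \<forall>n. infinite (?M n (h n)) \<and> (\<forall>i. \<bar>i\<bar> \<le> int n \<longrightarrow> h (Suc n) i = h n i)"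
  proof (rule dependent_nat_choice)
    have "\<exists>s\<in>S. infinite {m \<in> UNIV. f m 0 = s}"
      by (rule pigeonhole_infinite_rel) (use fin f in auto)
    then obtain s where "infinite {m. f m 0 = s}" by auto
    then show "\<exists>h. infinite (?M 0 h)"
      by (intro exI[of _ "\<lambda>_. s"]) simp
  next
    fix h :: "int \<Rightarrow> 's" and n :: nat
    assume inf: "infinite (?M n h)"
    have "\<exists>st\<in>S \<times> S. infinite {m \<in> ?M n h. (f m (int n + 1), f m (- int n - 1)) = st}"
      by (rule pigeonhole_infinite_rel) (use fin f inf in auto)
    then obtain s t where inf': "infinite {m \<in> ?M n h. f m (int n + 1) = s \<and> f m (- int n - 1) = t}"
      by auto
    let ?h = "h(int n + 1 := s, - int n - 1 := t)"
    have "f m i = ?h i" if m: "m \<in> ?M n h" "f m (int n + 1) = s" "f m (- int n - 1) = t"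
        and i: "\<bar>i\<bar> \<le> int (Suc n)" for m i
    proof -
      consider "i = int n + 1" | "i = - int n - 1" | "\<bar>i\<bar> \<le> int n" using i by fastforce
      then show ?thesis using m by cases auto
    qed
    then have "{m \<in> ?M n h. f m (int n + 1) = s \<and> f m (- int n - 1) = t} \<subseteq> ?M (Suc n) ?h"
      by blast
    then have "infinite (?M (Suc n) ?h)" using inf' infinite_super by blast
    moreover have "\<forall>i. \<bar>i\<bar> \<le> int n \<longrightarrow> ?h i = h i" by auto
    ultimately show "\<exists>h'. infinite (?M (Suc n) h') \<and> (\<forall>i. \<bar>i\<bar> \<le> int n \<longrightarrow> h' i = h i)" by blast
  qed
  then obtain h where h: "\<And>n. infinite (?M n (h n))"
    and step: "\<And>n i. \<bar>i\<bar> \<le> int n \<Longrightarrow> h (Suc n) i = h n i" by blast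
  have mono: "h (n + k) i = h n i" if "\<bar>i\<bar> \<le> int n" for n k i
    using that by (induction k) (auto simp: step)
  have "\<exists>m\<ge>n. \<forall>i. \<bar>i\<bar> \<le> int n \<longrightarrow> f m i = h (nat \<bar>i\<bar>) i" for n
  proof -
    obtain m where m: "m \<ge> n" "m \<in> ?M n (h n)"
      using h[of n] unfolding infinite_nat_iff_unbounded_le by blast
    have "f m i = h (nat \<bar>i\<bar>) i" if "\<bar>i\<bar> \<le> int n" for i
      using m that mono[of i "nat \<bar>i\<bar>" "n - nat \<bar>i\<bar>"] by (auto simp: nat_le_iff)
    then show ?thesis using m by blast
  qed
  then show ?thesis by (rule that)
qed

section \<open>The degree of a one-block code on a finite graph\<close>

lemma successively_join:
  assumes "successively E p" "successively E p'" "p \<noteq> []" "p' \<noteq> []"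
    "successively E (last p # c @ [hd p'])"
  shows "successively E (p @ c @ p')"
  using assms by (cases c) (auto simp: successively_append_iff successively_Cons hd_append)

text \<open>A finite irreducible graph with vertex set \<open>S\<close> and edge relation \<open>E\<close>, whose vertices are labelled by \<open>g\<close>.
  A diamond is a pair of distinct paths with the same ends and the same labels; its absence is the
  combinatorial form of being finite-to-one.\<close>

locale markov_code =
  fixes S :: "'s set" and E :: "'s \<Rightarrow> 's \<Rightarrow> bool" and g :: "'s \<Rightarrow> 'b"
  assumes finite_S: "finite S" and S_ne: "S \<noteq> {}"
    and connected: "s \<in> S \<Longrightarrow> t \<in> S \<Longrightarrow> \<exists>c. set c \<subseteq> S \<and> successively E (s # c @ [t])"
    and no_diamond: "\<lbrakk>successively E p; successively E p'; set p \<subseteq> S; set p' \<subseteq> S; p \<noteq> [];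
      map g p = map g p'; hd p = hd p'; last p = last p'\<rbrakk> \<Longrightarrow> p = p'"
begin

definition paths :: "'b list \<Rightarrow> 's list set" where
  "paths v = {p. successively E p \<and> set p \<subseteq> S \<and> map g p = v}"

definition states :: "'b list \<Rightarrow> nat \<Rightarrow> 's set" where
  "states v i = (\<lambda>p. p ! i) ` paths v"

definition fib :: "(int \<Rightarrow> 'b) \<Rightarrow> (int \<Rightarrow> 's) set" where
  "fib y = {z. (\<forall>i. z i \<in> S \<and> E (z i) (z (i + 1)) \<and> g (z i) = y i)}"

text \<open>Double transitivity with respect to the words that label paths of the graph.\<close>

definition recurrent :: "(int \<Rightarrow> 'b) \<Rightarrow> bool" where
  "recurrent y \<longleftrightarrow> (\<forall>i n. paths (word y i n) \<noteq> {}) \<and>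
     (\<forall>v n. paths v \<noteq> {} \<longrightarrow>
        (\<exists>i\<ge>n. word y i (length v) = v) \<and> (\<exists>i\<le>n. word y i (length v) = v))"

lemma recurrentD:
  assumes "recurrent y" "paths v \<noteq> {}"
  shows "\<exists>i\<ge>n. word y i (length v) = v" "\<exists>i\<le>n. word y i (length v) = v"
  using assms unfolding recurrent_def by blast+

lemma length_paths: "p \<in> paths v \<Longrightarrow> length p = length v"
  unfolding paths_def by auto

lemma finite_paths: "finite (paths v)"
proof (rule finite_subset)
  show "paths v \<subseteq> {p. set p \<subseteq> S \<and> length p = length v}"
    by (auto simp: paths_def)
qed (rule finite_lists_length_eq[OF finite_S])

lemma states_subset: "i < length v \<Longrightarrow> states v i \<subseteq> S"
  unfolding states_def using length_paths by (fastforce simp: paths_def)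

lemma finite_states: "finite (states v i)"
  unfolding states_def by (simp add: finite_paths)

lemma successively_nth:
  "successively E p \<longleftrightarrow> (\<forall>k. Suc k < length p \<longrightarrow> E (p ! k) (p ! Suc k))"
  by (auto simp: successively_conv_nth)

lemma paths_sub:
  assumes "p \<in> paths v" shows "take k (drop a p) \<in> paths (take k (drop a v))"
proof -
  have "set (take k (drop a p)) \<subseteq> S"
    using assms set_take_subset[of k "drop a p"] set_drop_subset[of a p] by (auto simp: paths_def)
  then show ?thesis
    using assms by (auto simp: paths_def successively_nth take_map drop_map)
qed

lemma paths_glue:
  assumes p: "p \<in> paths v" and p': "p' \<in> paths v'" and i: "i < length v" "i' < length v'"
    and eq: "p ! i = p' ! i'"
  shows "take i p @ drop i' p' \<in> paths (take i v @ drop i' v')"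
proof -
  have len: "length p = length v" "length p' = length v'" using p p' length_paths by auto
  have pE: "Suc k < length p \<Longrightarrow> E (p ! k) (p ! Suc k)"
    and pE': "Suc k < length p' \<Longrightarrow> E (p' ! k) (p' ! Suc k)" for k
    using p p' unfolding paths_def successively_nth by blast+
  have "set (take i p @ drop i' p') \<subseteq> S"
    using p p' set_take_subset[of i p] set_drop_subset[of i' p'] by (auto simp: paths_def)
  moreover have "map g (take i p @ drop i' p') = take i v @ drop i' v'"
    using p p' by (auto simp: paths_def take_map drop_map)
  moreover have "successively E (take i p @ drop i' p')"
    unfolding successively_nth
  proof (intro allI impI)
    fix k assume k: "Suc k < length (take i p @ drop i' p')"
    consider "Suc k < i" | "Suc k = i" | "k \<ge> i" by linarith
    then show "E ((take i p @ drop i' p') ! k) ((take i p @ drop i' p') ! Suc k)"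
    proof cases
      case 1
      then have "E (p ! k) (p ! Suc k)" using i len pE by simp
      then show ?thesis using 1 i len by (simp add: nth_append)
    next
      case 2
      then have "E (p ! k) (p ! i)" using i len pE by auto
      then show ?thesis using 2 i len eq by (simp add: nth_append)
    next
      case 3
      have "Suc (i' + (k - i)) < length p'" using k 3 i len by auto
      then have "E (p' ! (i' + (k - i))) (p' ! Suc (i' + (k - i)))" using pE' by blast
      then show ?thesis using 3 i len by (auto simp: nth_append Suc_diff_le)
    qed
  qed
  ultimately show ?thesis by (simp add: paths_def)
qed

text \<open>Otherwise the two segments between \<open>i\<close> and \<open>j\<close> would form a diamond.\<close>

lemma agree_between:
  assumes p: "p \<in> paths v" and p': "p' \<in> paths v" and ij: "i \<le> j" "j < length v"
    and eq: "p ! i = p' ! i" "p ! j = p' ! j" and k: "i \<le> k" "k \<le> j"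
  shows "p ! k = p' ! k"
proof -
  let ?t = "\<lambda>q. take (Suc j - i) (drop i q)"
  have len: "length p = length v" "length p' = length v" using p p' length_paths by auto
  have a: "?t p \<in> paths (?t v)" "?t p' \<in> paths (?t v)" using p p' paths_sub by auto
  have b: "?t p \<noteq> []" using ij len by auto
  have c: "hd (?t p) = hd (?t p')"
    using ij len eq by (simp add: hd_conv_nth)
  have d: "last (?t p) = last (?t p')"
    using ij len eq by (simp add: last_conv_nth)
  have "?t p = ?t p'"
    by (rule no_diamond) (use a b c d in \<open>auto simp: paths_def\<close>)
  then have "?t p ! (k - i) = ?t p' ! (k - i)" by simp
  then show ?thesis using k ij len by simp
qed

lemma paths_connect:
  assumes "paths v \<noteq> {}" "paths v' \<noteq> {}" "v \<noteq> []" "v' \<noteq> []"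
  shows "\<exists>u. paths (v @ u @ v') \<noteq> {}"
proof -
  obtain p p' where p: "p \<in> paths v" "p' \<in> paths v'" using assms by auto
  then have ne: "p \<noteq> []" "p' \<noteq> []" using assms length_paths by fastforce+
  then have "last p \<in> S" "hd p' \<in> S" using p by (auto simp: paths_def)
  then obtain c where c: "set c \<subseteq> S" "successively E (last p # c @ [hd p'])" using connected by blast
  have "successively E (p @ c @ p')"
    using p ne c by (auto intro: successively_join simp: paths_def)
  then have "p @ c @ p' \<in> paths (v @ map g c @ v')"
    using p c by (auto simp: paths_def)
  then show ?thesis by blast
qed

text \<open>A word with a position at which its preimages pass through the least possible number of states;
  this number turns out to be the degree.\<close>

definition magic :: "'b list \<Rightarrow> nat \<Rightarrow> bool" where
  "magic w i \<longleftrightarrow> paths w \<noteq> {} \<and> i < length w \<and>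
     (\<forall>v j. paths v \<noteq> {} \<longrightarrow> j < length v \<longrightarrow> card (states w i) \<le> card (states v j))"

lemma magic_exists: "\<exists>w i. magic w i"
proof -
  let ?P = "\<lambda>(v, j). paths v \<noteq> {} \<and> j < length v"
  obtain s where "s \<in> S" using S_ne by auto
  then have "[s] \<in> paths [g s]" by (simp add: paths_def)
  then have "?P ([g s], 0)" by auto
  then obtain vi where vi: "?P vi"
      "\<And>vj. ?P vj \<Longrightarrow> (case vi of (v, j) \<Rightarrow> card (states v j)) \<le> (case vj of (v, j) \<Rightarrow> card (states v j))"
    using ex_has_least_nat[of ?P "([g s], 0)" "\<lambda>(v, j). card (states v j)"] by blast
  obtain v i where "vi = (v, i)" by (cases vi)
  then have "magic v i" using vi(1) vi(2)[of "(v', j')" for v' j'] by (auto simp: magic_def)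
  then show ?thesis by blast
qed

end

locale magic_word = markov_code S E g for S :: "'s set" and E and g :: "'s \<Rightarrow> 'b" +
  fixes w :: "'b list" and i0 :: nat
  assumes magic: "magic w i0"
begin

abbreviation D where "D \<equiv> states w i0"

text \<open>An occurrence of the magic word in \<open>v\<close> starting at position \<open>a\<close>; the states at position \<open>a + i0\<close> are then
  under control.\<close>

definition marked :: "'b list \<Rightarrow> nat \<Rightarrow> bool" where
  "marked v a \<longleftrightarrow> a + length w \<le> length v \<and> take (length w) (drop a v) = w"

lemma i0: "i0 < length w" and paths_w: "paths w \<noteq> {}"
  using magic by (auto simp: magic_def)

lemma marked_append: "marked v a \<Longrightarrow> marked (u @ v @ u') (length u + a)"
  by (auto simp: marked_def)

text \<open>The longer word \<open>v\<close> admits at most the states that \<open>w\<close> alone admits, and by minimality it cannot admit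
  fewer. In particular every state of \<open>D\<close> has a past and a future along \<open>v\<close>.\<close>

lemma states_marked:
  assumes v: "paths v \<noteq> {}" and a: "marked v a"
  shows "states v (a + i0) = D"
proof (rule card_subset_eq)
  show "finite D" by (rule finite_states)
  show sub: "states v (a + i0) \<subseteq> D"
  proof
    fix s assume "s \<in> states v (a + i0)"
    then obtain p where p: "p \<in> paths v" "s = p ! (a + i0)" by (auto simp: states_def)
    have "take (length w) (drop a p) \<in> paths w"
      using paths_sub[OF p(1), of "length w" a] a by (simp add: marked_def)
    moreover have "s = take (length w) (drop a p) ! i0"
      using p a i0 length_paths[OF p(1)] by (simp add: marked_def)
    ultimately show "s \<in> D" by (auto simp: states_def)
  qed
  have "card D \<le> card (states v (a + i0))"
    using magic v a i0 by (auto simp: magic_def marked_def)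
  then show "card (states v (a + i0)) = card D"
    using card_mono[OF finite_states sub] by simp
qed

definition trans_rel :: "'b list \<Rightarrow> nat \<Rightarrow> nat \<Rightarrow> ('s \<times> 's) set" where
  "trans_rel v a b = (\<lambda>p. (p ! (a + i0), p ! (b + i0))) ` paths v"

lemma trans_rel_le:
  assumes "marked v a" "marked v b"
  shows "trans_rel v a b \<subseteq> S \<times> S"
  using assms i0 states_subset[of "a + i0" v] states_subset[of "b + i0" v]
  by (auto simp: trans_rel_def marked_def states_def)

text \<open>Between two magic positions the present state determines the future one. Segments between magic
  positions are determined by their ends, so their number is bounded. Take a word \<open>v1\<close> with the largest number of
  segments and append \<open>v\<close> to it: every segment of \<open>v1\<close> extends through \<open>v\<close>, so the number does not
  drop, and it would grow if \<open>v\<close> allowed a state of \<open>D\<close> to branch.\<close>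

lemma trans_rel_single_valued:
  assumes v: "marked v a" "marked v b" "a \<le> b"
    and p: "p \<in> paths v" "p' \<in> paths v" and eq: "p ! (a + i0) = p' ! (a + i0)"
  shows "p ! (b + i0) = p' ! (b + i0)"
proof (rule ccontr)
  assume neq: "p ! (b + i0) \<noteq> p' ! (b + i0)"
  let ?P = "\<lambda>(v, a, b). paths v \<noteq> {} \<and> marked v a \<and> marked v b \<and> a \<le> b"
  let ?c = "\<lambda>(v, a, b). card (trans_rel v a b)"
  have bdd: "?c t \<le> card (S \<times> S)" if "?P t" for t
    using that trans_rel_le card_mono[of "S \<times> S"] finite_S by (auto split: prod.splits)
  have "?P (w, 0, 0)" using paths_w by (auto simp: marked_def)
  then obtain t where t: "?P t" and mx: "\<And>t'. ?P t' \<Longrightarrow> ?c t' \<le> ?c t"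
    using ex_has_greatest_nat[of ?P "(w,0,0)" ?c "card (S \<times> S) + 1"] bdd by (auto simp: less_Suc_eq_le)
  obtain v1 a1 b1 where t1: "t = (v1, a1, b1)" by (cases t)
  have v1: "paths v1 \<noteq> {}" "marked v1 a1" "marked v1 b1" "a1 \<le> b1" using t t1 by auto
  have vne: "paths v \<noteq> {}" using p by auto
  obtain u where u: "paths (v1 @ u @ v) \<noteq> {}"
    using paths_connect[of v1 v] v1 vne v i0 by (force simp: marked_def)
  define V where "V = v1 @ u @ v"
  define o2 where "o2 = length v1 + length u"
  have V: "paths V \<noteq> {}" using u V_def by simp
  have mV: "marked V a1" "marked V b1" "marked V (o2 + a)" "marked V (o2 + b)"
    using marked_append[of v1 a1 "[]" "u @ v"] marked_append[of v1 b1 "[]" "u @ v"]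
      marked_append[of v a "v1 @ u" "[]"] marked_append[of v b "v1 @ u" "[]"] v1 v
    by (auto simp: V_def o2_def)
  have lens: "b1 + i0 < length v1" "b + i0 < length v"
    using v1 v i0 by (auto simp: marked_def)
  have lenV: "length V = o2 + length v" by (simp add: V_def o2_def)
  \<comment> \<open>The states at the four magic positions. The first and the last of them determine the whole segment, hence
      all four, so that the quadruples are as few as the pairs of end states.\<close>
  let ?q = "\<lambda>P. (P ! (a1 + i0), P ! (b1 + i0), P ! (o2 + a + i0), P ! (o2 + b + i0))"
  let ?Q = "?q ` paths V"
  let ?fst = "\<lambda>(s1, s2, s3, s4). (s1, s2)"
  have finQ: "finite ?Q" by (simp add: finite_paths)
  have "inj_on (\<lambda>(s1, s2, s3, s4). (s1, s4)) ?Q"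
  proof (rule inj_onI)
    fix x x' assume "x \<in> ?Q" "x' \<in> ?Q"
      and xx: "(\<lambda>(s1, s2, s3, s4). (s1, s4)) x = (\<lambda>(s1, s2, s3, s4). (s1, s4)) x'"
    then obtain P P' where P: "P \<in> paths V" "P' \<in> paths V" and x: "x = ?q P" "x' = ?q P'"
      by blast
    then have e: "P ! (a1 + i0) = P' ! (a1 + i0)" "P ! (o2 + b + i0) = P' ! (o2 + b + i0)"
      using xx by auto
    note ag = agree_between[OF P, of "a1 + i0" "o2 + b + i0", OF _ _ e]
    have le: "a1 + i0 \<le> o2 + b + i0" "o2 + b + i0 < length V" "b1 + i0 \<le> o2 + b + i0"
      "a1 + i0 \<le> o2 + a + i0"
      using lens lenV v1 v by (auto simp: o2_def)
    have "P ! (b1 + i0) = P' ! (b1 + i0)" "P ! (o2 + a + i0) = P' ! (o2 + a + i0)"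
      by (rule ag; use le v1 v in auto)+
    then show "x = x'" using x e by simp
  qed
  then have "card ((\<lambda>(s1, s2, s3, s4). (s1, s4)) ` ?Q) = card ?Q" by (rule card_image)
  moreover have "(\<lambda>(s1, s2, s3, s4). (s1, s4)) ` ?Q = trans_rel V a1 (o2 + b)"
    by (auto simp: trans_rel_def image_image)
  moreover have "card (trans_rel V a1 (o2 + b)) \<le> card (trans_rel v1 a1 b1)"
    using mx[of "(V, a1, o2 + b)"] V mV lens v1(4) t1 by (auto simp: o2_def)
  ultimately have le: "card ?Q \<le> card (trans_rel v1 a1 b1)" by simp
  \<comment> \<open>Every segment of \<open>v1\<close> continues through the rest of \<open>V\<close>.\<close>
  have sub: "trans_rel v1 a1 b1 \<subseteq> ?fst ` ?Q"
  proof
    fix st assume "st \<in> trans_rel v1 a1 b1"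
    then obtain r where r: "r \<in> paths v1" "st = (r ! (a1 + i0), r ! (b1 + i0))"
      by (auto simp: trans_rel_def)
    have "r ! (b1 + i0) \<in> states v1 (b1 + i0)" using r by (auto simp: states_def)
    then have "r ! (b1 + i0) \<in> states V (b1 + i0)"
      using states_marked[OF V mV(2)] states_marked[OF v1(1,3)] by simp
    then obtain P where P: "P \<in> paths V" "r ! (b1 + i0) = P ! (b1 + i0)" by (auto simp: states_def)
    let ?r = "take (b1 + i0) r @ drop (b1 + i0) P"
    have "?r \<in> paths (take (b1 + i0) v1 @ drop (b1 + i0) V)"
      by (rule paths_glue) (use r P lens lenV in \<open>auto simp: o2_def\<close>)
    moreover have "take (b1 + i0) v1 @ drop (b1 + i0) V = V"
      using lens by (simp add: V_def)
    ultimately have rV: "?r \<in> paths V" by simp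
    have lr: "length r = length v1" using r length_paths by auto
    have "?r ! (a1 + i0) = r ! (a1 + i0)" "?r ! (b1 + i0) = r ! (b1 + i0)"
      using v1(4) lens lr P length_paths[OF P(1)] lenV
      by (cases "a1 = b1"; auto simp: nth_append o2_def)+
    then have "st = ?fst (?q ?r)" using r by simp
    then show "st \<in> ?fst ` ?Q" using rV by blast
  qed
  have "card (trans_rel v1 a1 b1) \<le> card (?fst ` ?Q)"
    by (rule card_mono[OF _ sub]) (simp add: finQ)
  then have "card (?fst ` ?Q) = card ?Q"
    using le card_image_le[OF finQ, of ?fst] by linarith
  then have inj: "inj_on ?fst ?Q" using finQ by (rule eq_card_imp_inj_on[rotated])
  \<comment> \<open>A path reaching the branching state continues along \<open>p\<close> as well as along \<open>p'\<close>: two quadruples with the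
      same first two entries.\<close>
  have "p ! (a + i0) \<in> states v (a + i0)" using p by (auto simp: states_def)
  then have "p ! (a + i0) \<in> states V (o2 + a + i0)"
    using states_marked[OF V mV(3)] states_marked[OF vne v(1)] by simp
  then obtain P where P: "P \<in> paths V" "P ! (o2 + a + i0) = p ! (a + i0)" by (auto simp: states_def)
  let ?g = "\<lambda>p. take (o2 + a + i0) P @ drop (a + i0) p"
  have lP: "length P = o2 + length v" using length_paths[OF P(1)] lenV by simp
  have g: "?g r \<in> paths V \<and> ?q (?g r) = (P ! (a1 + i0), P ! (b1 + i0), P ! (o2 + a + i0), r ! (b + i0))"
    if r: "r \<in> paths v" "r ! (a + i0) = p ! (a + i0)" for r
  proof -
    have "?g r \<in> paths (take (o2 + a + i0) V @ drop (a + i0) v)"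
      by (rule paths_glue) (use r P lens lenV v in auto)
    moreover have "take (o2 + a + i0) V @ drop (a + i0) v = V"
      by (simp add: V_def o2_def)
    ultimately have 1: "?g r \<in> paths V" by simp
    have lr: "length r = length v" using r length_paths by auto
    have ba: "a + i0 + (b - a) = b + i0" using v by simp
    have "?g r ! (o2 + b + i0) = r ! (b + i0)"
      using lens lP v lr ba by (auto simp: nth_append min_def ac_simps)
    moreover have "?g r ! (o2 + a + i0) = P ! (o2 + a + i0)"
      using lens lP v lr r P by (auto simp: nth_append min_def)
    moreover have "?g r ! (a1 + i0) = P ! (a1 + i0)" "?g r ! (b1 + i0) = P ! (b1 + i0)"
      using lens lP v v1 by (auto simp: nth_append min_def o2_def)
    ultimately show ?thesis using 1 by simp
  qed
  have "?q (?g p) = ?q (?g p')"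
  proof (rule inj_onD[OF inj])
    show "?fst (?q (?g p)) = ?fst (?q (?g p'))" using g[OF p(1)] g[OF p(2)] eq by simp
    show "?q (?g p) \<in> ?Q" using g[OF p(1)] by (intro imageI) simp
    show "?q (?g p') \<in> ?Q" using g[OF p(2)] eq by (intro imageI) simp
  qed
  then show False using g[OF p(1)] g[OF p(2)] eq neq by auto
qed

text \<open>The relation between the states at two magic positions is a map from the finite set \<open>D\<close> onto itself.\<close>

lemma trans_rel_injective:
  assumes v: "marked v a" "marked v b" "a \<le> b"
    and p: "p \<in> paths v" "p' \<in> paths v" and eq: "p ! (b + i0) = p' ! (b + i0)"
  shows "p ! (a + i0) = p' ! (a + i0)"
proof -
  let ?R = "trans_rel v a b"
  have ne: "paths v \<noteq> {}" using p by auto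
  have "inj_on fst ?R"
    unfolding trans_rel_def
  proof (rule inj_onI)
    fix x x' assume "x \<in> (\<lambda>p. (p ! (a + i0), p ! (b + i0))) ` paths v"
      "x' \<in> (\<lambda>p. (p ! (a + i0), p ! (b + i0))) ` paths v" and eq: "fst x = fst x'"
    then obtain r r' where r: "r \<in> paths v" "r' \<in> paths v"
      and x: "x = (r ! (a + i0), r ! (b + i0))" "x' = (r' ! (a + i0), r' ! (b + i0))" by blast
    then show "x = x'" using trans_rel_single_valued[OF v r] eq by simp
  qed
  then have "card ?R = card (fst ` ?R)" by (simp add: card_image)
  also have "fst ` ?R = states v (a + i0)" by (auto simp: trans_rel_def states_def image_image)
  also have "\<dots> = states v (b + i0)" using states_marked ne v by simp
  also have "\<dots> = snd ` ?R" by (auto simp: trans_rel_def states_def image_image)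
  finally have "inj_on snd ?R"
    by (intro eq_card_imp_inj_on) (auto simp: trans_rel_def finite_paths)
  then have "(p ! (a + i0), p ! (b + i0)) = (p' ! (a + i0), p' ! (b + i0))"
    by (rule inj_onD) (use p eq in \<open>auto simp: trans_rel_def\<close>)
  then show ?thesis by simp
qed

lemma fib_word: "z \<in> fib y \<Longrightarrow> word z i n \<in> paths (word y i n)"
proof -
  assume z: "z \<in> fib y"
  have "E (z (i + int k)) (z (i + int (Suc k)))" for k
    using z unfolding fib_def by (auto simp: algebra_simps dest!: spec[of _ "i + int k"])
  then show ?thesis
    using z by (auto simp: paths_def fib_def successively_nth word_def)
qed

text \<open>The magic word occurs arbitrarily far to both sides, and between its occurrences agreement at one
  magic position propagates.\<close>

lemma fib_eq:
  assumes y: "recurrent y" and a: "word y a (length w) = w"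
    and z: "z \<in> fib y" "z' \<in> fib y" and eq: "z (a + int i0) = z' (a + int i0)"
  shows "z = z'"
proof
  fix j
  obtain a1 where a1: "a1 \<le> min a (j - int i0)" "word y a1 (length w) = w"
    using recurrentD(2)[OF y paths_w] by blast
  obtain b1 where b1: "b1 \<ge> max a (j - int i0)" "word y b1 (length w) = w"
    using recurrentD(1)[OF y paths_w] by blast
  define N where "N = nat (b1 - a1) + length w"
  let ?v = "word y a1 N"
  have mk: "marked ?v (nat (c - a1))" if "a1 \<le> c" "c \<le> b1" "word y c (length w) = w" for c
    using that by (auto simp: marked_def N_def take_drop_word nat_le_eq_zle)
  have m: "marked ?v 0" "marked ?v (nat (a - a1))" "marked ?v (nat (b1 - a1))"
    using mk[of a1] mk[of a] mk[of b1] a1 b1 a by auto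
  have p: "word z a1 N \<in> paths ?v" "word z' a1 N \<in> paths ?v" using z fib_word by auto
  have nth: "word x a1 N ! (nat (c - a1) + i0) = x (c + int i0)"
    if "a1 \<le> c" "c \<le> b1" for c and x :: "int \<Rightarrow> 's"
    using that i0 by (auto simp: N_def algebra_simps)
  have e: "word z a1 N ! (nat (a - a1) + i0) = word z' a1 N ! (nat (a - a1) + i0)"
    using eq a1 b1 by (simp add: nth)
  have e1: "word z a1 N ! (0 + i0) = word z' a1 N ! (0 + i0)"
    by (rule trans_rel_injective[OF m(1,2) _ p e]) simp
  have e2: "word z a1 N ! (nat (b1 - a1) + i0) = word z' a1 N ! (nat (b1 - a1) + i0)"
    by (rule trans_rel_single_valued[OF m(2,3) _ p e]) (use a1 b1 in auto)
  have "word z a1 N ! nat (j - a1) = word z' a1 N ! nat (j - a1)"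
    by (rule agree_between[OF p _ _ e1 e2]) (use a1 b1 i0 in \<open>auto simp: N_def\<close>)
  moreover have "nat (j - a1) < N" using a1 b1 i0 by (auto simp: N_def)
  ultimately show "z j = z' j" using a1 by simp
qed

text \<open>Each finite window of \<open>y\<close> around the occurrence has a preimage through \<open>s\<close>; pass to a limit.\<close>

lemma fib_exists:
  assumes y: "recurrent y" and a: "word y a (length w) = w" and s: "s \<in> D"
  shows "\<exists>z\<in>fib y. z (a + int i0) = s"
proof -
  define A where "A = nat \<bar>a\<bar> + length w"
  have ex: "\<exists>z. (\<forall>i. z i \<in> S) \<and> (\<forall>i. \<bar>i\<bar> \<le> int n \<longrightarrow> E (z i) (z (i + 1)) \<and> g (z i) = y i) \<and>
    z (a + int i0) = s" for n :: nat
  proof -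
    define M where "M = n + A"
    define N where "N = 2 * M + 2"
    let ?v = "word y (- int M) N"
    have "marked ?v (nat (a + int M))"
      using a by (auto simp: marked_def take_drop_word A_def N_def M_def)
    then have "states ?v (nat (a + int M) + i0) = D"
      using states_marked y by (auto simp: recurrent_def)
    then have "s \<in> states ?v (nat (a + int M) + i0)" using s by simp
    then obtain p where p: "p \<in> paths ?v" "p ! (nat (a + int M) + i0) = s"
      by (auto simp: states_def)
    then have lp: "length p = N" using length_paths by fastforce
    obtain s0 where s0: "s0 \<in> S" using S_ne by auto
    \<comment> \<open>Outside the window the path is continued by an arbitrary constant.\<close>
    define z where "z = (\<lambda>i. if - int M \<le> i \<and> i < - int M + int N then p ! nat (i + int M) else s0)"
    have "p ! k \<in> S" if "k < N" for k using p(1) lp that nth_mem[of k p] by (auto simp: paths_def)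
    then have "\<forall>i. z i \<in> S" using s0 by (auto simp: z_def)
    moreover have "E (z i) (z (i + 1)) \<and> g (z i) = y i" if "\<bar>i\<bar> \<le> int n" for i
    proof -
      define k where "k = nat (i + int M)"
      have k: "Suc k < N" "i = int k - int M" using that by (auto simp: k_def M_def N_def)
      have zz: "z i = p ! k" "z (i + 1) = p ! Suc k"
        using k by (auto simp: z_def nat_add_distrib)
      have "g (p ! k) = map g p ! k" using k lp by simp
      also have "\<dots> = ?v ! k" using p by (simp add: paths_def)
      finally have "g (p ! k) = ?v ! k" .
      moreover have "?v ! k = y i" using k by simp
      moreover have "E (p ! k) (p ! Suc k)" using p k lp by (simp add: paths_def successively_nth)
      ultimately show ?thesis using zz by simp
    qed
    moreover have "z (a + int i0) = s"
    proof -
      have "nat (a + int i0 + int M) = nat (a + int M) + i0"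
        by (auto simp: A_def M_def)
      then show ?thesis using p i0 by (auto simp: z_def A_def M_def N_def)
    qed
    ultimately show ?thesis by blast
  qed
  then obtain f where f: "\<And>n i. f n i \<in> S"
    "\<And>n i. \<bar>i\<bar> \<le> int n \<Longrightarrow> E (f n i) (f n (i + 1)) \<and> g (f n i) = y i" "\<And>n. f n (a + int i0) = s"
    by metis
  obtain z where z: "\<And>n. \<exists>m\<ge>n. \<forall>i. \<bar>i\<bar> \<le> int n \<longrightarrow> f m i = z i"
    using cluster_point[OF finite_S, of f] f(1) by blast
  have "z i \<in> S \<and> E (z i) (z (i + 1)) \<and> g (z i) = y i" for i
  proof -
    obtain m where m: "m \<ge> nat \<bar>i\<bar> + 1" "\<forall>j. \<bar>j\<bar> \<le> int (nat \<bar>i\<bar> + 1) \<longrightarrow> f m j = z j"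
      using z by blast
    then have "f m i = z i" "f m (i + 1) = z (i + 1)" by auto
    then show ?thesis using f(1)[of m i] f(2)[of i m] m by auto
  qed
  moreover obtain m where "f m (a + int i0) = z (a + int i0)"
    using z[of "nat \<bar>a + int i0\<bar>"] by auto
  ultimately show ?thesis using f(3)[of m] by (auto simp: fib_def)
qed

text \<open>A preimage is determined by its state at one magic position, and every state of \<open>D\<close> is attained there.\<close>

lemma card_fib:
  assumes y: "recurrent y"
  shows "finite (fib y) \<and> card (fib y) = card D"
proof -
  obtain a where a: "word y a (length w) = w" using recurrentD(1)[OF y paths_w] by blast
  let ?h = "\<lambda>z. z (a + int i0)"
  have "inj_on ?h (fib y)" by (intro inj_onI) (rule fib_eq[OF y a])
  moreover have "?h ` fib y = D"
  proof
    show "?h ` fib y \<subseteq> D"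
    proof clarify
      fix z assume "z \<in> fib y"
      then have "word z a (length w) \<in> paths w" using fib_word[of z y a "length w"] a by simp
      then show "z (a + int i0) \<in> D" using i0 by (force simp: states_def)
    qed
    show "D \<subseteq> ?h ` fib y"
      using fib_exists[OF y a] by (metis (no_types, lifting) image_eqI subsetI)
  qed
  ultimately have b: "bij_betw ?h (fib y) D" by (simp add: bij_betw_def)
  then show ?thesis using bij_betw_finite[OF b] bij_betw_same_card[OF b] finite_states by simp
qed

text \<open>The states in \<open>C\<close> are treated one at a time. The unique path starting from the next state \<open>s\<close> is prolonged so that
  it meets \<open>q\<close> before another occurrence of \<open>w\<close>; prolonging does not undo what was achieved for
  the earlier states, as their paths over \<open>v\<close> are prefixes of the new ones.\<close>

lemma visiting_word:
  assumes q: "q \<in> S" and C: "finite C" "C \<subseteq> D"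
  shows "\<exists>v. paths v \<noteq> {} \<and> marked v 0 \<and> (\<forall>p\<in>paths v. p ! i0 \<in> C \<longrightarrow> q \<in> set p)"
  using C
proof (induction C rule: finite_induct)
  case empty
  then show ?case using paths_w by (auto simp: marked_def intro!: exI[of _ w])
next
  case (insert s C)
  then obtain v where v: "paths v \<noteq> {}" "marked v 0" "\<And>p. p \<in> paths v \<Longrightarrow> p ! i0 \<in> C \<Longrightarrow> q \<in> set p"
    by auto
  have "s \<in> states v (0 + i0)" using states_marked[OF v(1,2)] insert by auto
  then obtain p where p: "p \<in> paths v" "p ! i0 = s" by (auto simp: states_def)
  obtain pw where pw: "pw \<in> paths w" using paths_w by auto
  have lv: "length w \<le> length v" using v by (simp add: marked_def)
  have lp: "length p = length v" "length pw = length w" using p pw length_paths by auto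
  have ne: "p \<noteq> []" "pw \<noteq> []" using lp lv i0 by auto
  have "last p \<in> S" "hd pw \<in> S" using p pw ne by (auto simp: paths_def)
  then obtain c c' where c: "set c \<subseteq> S" "successively E (last p # c @ [q])"
    and c': "set c' \<subseteq> S" "successively E (q # c' @ [hd pw])" using connected q by metis
  define P where "P = p @ c @ q # c' @ pw"
  define V where "V = map g P"
  have "successively E P"
    using successively_join[of E p "q # c' @ pw" c] successively_join[of E "[q]" pw c'] p pw c c' ne
    by (simp add: P_def paths_def)
  then have P: "P \<in> paths V" using p pw c c' q by (auto simp: P_def V_def paths_def)
  have Veq: "V = v @ map g (c @ q # c') @ w"
    using p pw by (simp add: V_def P_def paths_def)
  define b where "b = length v + length (c @ q # c')"
  have mV: "marked V 0" "marked V b"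
    using marked_append[OF v(2), of "[]" "map g (c @ q # c') @ w"] marked_append[of w 0 "v @ map g (c @ q # c')" "[]"]
    by (auto simp: Veq b_def marked_def)
  have lV: "length V = b + length w" by (simp add: Veq b_def)
  have "q \<in> set p'" if p': "p' \<in> paths V" "p' ! i0 \<in> insert s C" for p'
  proof (cases "p' ! i0 = s")
    case True
    have Pi: "P ! i0 = s" using p lp lv i0 by (simp add: P_def nth_append)
    have e1: "p' ! (0 + i0) = P ! (0 + i0)" using True Pi by simp
    have e2: "p' ! (b + i0) = P ! (b + i0)"
      by (rule trans_rel_single_valued[OF mV _ p'(1) P e1]) simp
    let ?k = "length p + length c"
    have "p' ! ?k = P ! ?k"
      by (rule agree_between[OF p'(1) P _ _ e1 e2]) (use lp lv i0 lV in \<open>auto simp: b_def\<close>)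
    moreover have "P ! ?k = q" by (simp add: P_def nth_append)
    moreover have "?k < length p'" using length_paths[OF p'(1)] lV lp by (auto simp: b_def)
    ultimately show ?thesis by (metis nth_mem)
  next
    case False
    have "take (length v) (drop 0 p') \<in> paths (take (length v) (drop 0 V))"
      using p' paths_sub by blast
    then have "take (length v) p' \<in> paths v" by (simp add: Veq)
    moreover have "take (length v) p' ! i0 \<in> C" using False p' lv i0 by auto
    ultimately have "q \<in> set (take (length v) p')" using v by blast
    then show ?thesis using set_take_subset by fast
  qed
  then show ?case using P mV by blast
qed

text \<open>Preimages of doubly transitive points are transitive: a word forcing a visit to \<open>q\<close> from every state of
  \<open>D\<close> occurs in \<open>y\<close> arbitrarily far to the left.\<close>

lemma fib_visits:
  assumes y: "recurrent y" and z: "z \<in> fib y" and q: "q \<in> S"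
  shows "\<exists>i\<le>n. z i = q"
proof -
  obtain v where v: "paths v \<noteq> {}" "marked v 0" "\<And>p. p \<in> paths v \<Longrightarrow> p ! i0 \<in> D \<Longrightarrow> q \<in> set p"
    using visiting_word[OF q finite_states subset_refl] by blast
  obtain i where i: "i \<le> n - int (length v)" "word y i (length v) = v"
    using recurrentD(2)[OF y v(1)] by blast
  have p: "word z i (length v) \<in> paths v" using fib_word[OF z, of i "length v"] i by simp
  then have "word z i (length v) ! i0 \<in> D"
    using states_marked[OF v(1,2)] by (auto simp: states_def)
  then have "q \<in> set (word z i (length v))" using v p by blast
  then obtain k where "k < length v" "z (i + int k) = q" by (auto simp: in_set_conv_nth)
  then show ?thesis using i by (intro exI[of _ "i + int k"]) auto
qed

end

theorem (in markov_code) degree_of_graph_code: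
  "\<exists>d. \<forall>y. recurrent y \<longrightarrow> finite (fib y) \<and> card (fib y) = d \<and>
     (\<forall>z\<in>fib y. \<forall>q\<in>S. \<forall>n. \<exists>i\<le>n. z i = q)"
proof -
  obtain w i0 where "magic w i0" using magic_exists by blast
  then interpret magic_word S E g w i0 by unfold_locales
  show ?thesis using card_fib fib_visits by blast
qed

section \<open>Topology and translations of shift spaces\<close>

lemma topspace_full_topology [simp]: "topspace full_topology = UNIV"
  by (simp add: full_topology_def)

lemma openin_coordinate: "openin full_topology {x. x i = a}"
proof -
  have "continuous_map full_topology (discrete_topology UNIV) (\<lambda>x. x i)"
    unfolding full_topology_def by (rule continuous_map_product_projection) simp
  then have "openin full_topology {x \<in> topspace full_topology. x i \<in> {a}}"
    by (rule openin_continuous_map_preimage) simp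
  then show ?thesis by simp
qed

lemma openin_word: "openin full_topology {x. word x i (length w) = w}"
proof (cases "w = []")
  case True
  then show ?thesis using openin_topspace[of full_topology] by (simp add: word_def)
next
  case False
  have "{x. word x i (length w) = w} = (\<Inter>k\<in>{..<length w}. {x. x (i + int k) = w ! k})"
    by (auto simp: list_eq_iff_nth_eq)
  then show ?thesis
    using False by (auto intro!: openin_INT openin_coordinate)
qed

lemma open_window:
  assumes "openin full_topology U" "x \<in> U"
  obtains n :: nat where "\<And>y. (\<And>i. \<bar>i\<bar> \<le> int n \<Longrightarrow> y i = x i) \<Longrightarrow> y \<in> U"
proof -
  obtain V where V: "finite {i. V i \<noteq> UNIV}" "x \<in> Pi\<^sub>E UNIV V" "Pi\<^sub>E UNIV V \<subseteq> U"
    using assms unfolding full_topology_def openin_product_topology_alt by fastforce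
  have "finite ((\<lambda>i. nat \<bar>i\<bar>) ` {i. V i \<noteq> UNIV})" using V by simp
  then obtain n where n: "\<And>i. V i \<noteq> UNIV \<Longrightarrow> nat \<bar>i\<bar> \<le> n"
    unfolding finite_nat_set_iff_bounded_le by auto
  show ?thesis
  proof (rule that[of n])
    fix y assume y: "\<And>i. \<bar>i\<bar> \<le> int n \<Longrightarrow> y i = x i"
    have "y i \<in> V i" for i
    proof (cases "V i = UNIV")
      case False
      then have "y i = x i" using n[of i] y[of i] by linarith
      then show ?thesis using V(2) by (auto simp: PiE_iff)
    qed auto
    then show "y \<in> U" using V(3) by (auto simp: PiE_iff)
  qed
qed

lemma closed_window:
  assumes "closedin full_topology X" "\<And>n::nat. \<exists>x'\<in>X. \<forall>i. \<bar>i\<bar> \<le> int n \<longrightarrow> x' i = x i"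
  shows "x \<in> X"
proof (rule ccontr)
  assume "x \<notin> X"
  moreover have "openin full_topology (UNIV - X)" using assms(1) by (simp add: closedin_def)
  ultimately obtain n :: nat where "\<And>y. (\<And>i. \<bar>i\<bar> \<le> int n \<Longrightarrow> y i = x i) \<Longrightarrow> y \<in> UNIV - X"
    by (metis DiffI UNIV_I open_window)
  then show False using assms(2)[of n] by blast
qed

text \<open>The iterates of the shift and of its inverse, indexed by the integers.\<close>

definition translate :: "int \<Rightarrow> (int \<Rightarrow> 'a) \<Rightarrow> int \<Rightarrow> 'a" where
  "translate k x = (\<lambda>i. x (i + k))"

lemma translate_apply [simp]: "translate k x i = x (i + k)"
  by (simp add: translate_def)

lemma translate_translate [simp]: "translate k (translate l x) = translate (k + l) x"
  by (simp add: translate_def algebra_simps)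

lemma translate_0 [simp]: "translate 0 x = x"
  by (simp add: translate_def)

lemma shift_eq_translate: "shift = translate 1"
  by (simp add: shift_def translate_def fun_eq_iff)

lemma word_translate: "word (translate k x) i n = word x (i + k) n"
  by (simp add: word_def algebra_simps)

lemma shift_space_translate:
  assumes X: "shift_space X" and x: "x \<in> X" shows "translate k x \<in> X"
proof -
  have fw: "translate 1 x \<in> X" and bw: "translate (-1) x \<in> X" if "x \<in> X" for x
  proof -
    have im: "translate 1 ` X = X" using X by (simp add: shift_space_def shift_eq_translate)
    then show "translate 1 x \<in> X" using that by blast
    obtain x' where "x' \<in> X" "x = translate 1 x'" using im \<open>x \<in> X\<close> by blast
    then show "translate (-1) x \<in> X" by simp
  qed
  have "translate (int n) x \<in> X" "translate (- int n) x \<in> X" for n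
  proof (induction n)
    case (Suc n)
    have "translate (int (Suc n)) x = translate 1 (translate (int n) x)"
      "translate (- int (Suc n)) x = translate (-1) (translate (- int n) x)"
      by simp_all
    then show "translate (int (Suc n)) x \<in> X" "translate (- int (Suc n)) x \<in> X"
      using Suc fw bw by metis+
  qed (use x in auto)
  then show ?thesis by (cases k rule: int_cases2) auto
qed

lemma factor_code_translate:
  assumes fc: "factor_code \<pi> X Y" and x: "x \<in> X"
  shows "\<pi> (translate k x) = translate k (\<pi> x)"
proof -
  have X: "shift_space X" and fw: "\<And>x. x \<in> X \<Longrightarrow> \<pi> (translate 1 x) = translate 1 (\<pi> x)"
    using fc by (auto simp: factor_code_def shift_eq_translate)
  have nat: "\<pi> (translate (int n) x) = translate (int n) (\<pi> x)" if "x \<in> X" for n x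
  proof (induction n)
    case (Suc n)
    have "\<pi> (translate 1 (translate (int n) x)) = translate 1 (\<pi> (translate (int n) x))"
      by (rule fw[OF shift_space_translate[OF X that]])
    also have "\<dots> = translate 1 (translate (int n) (\<pi> x))"
      by (rule arg_cong[OF Suc])
    finally show ?case by (simp only: translate_translate of_nat_Suc)
  qed simp
  have "\<pi> (translate (- int n) x) = translate (- int n) (\<pi> x)" for n
  proof -
    have "translate (int n) (\<pi> (translate (- int n) x)) = \<pi> x"
      using nat[of "translate (- int n) x" n] shift_space_translate[OF X x] by simp
    then have "translate (- int n) (translate (int n) (\<pi> (translate (- int n) x))) = translate (- int n) (\<pi> x)"
      by simp
    then show ?thesis by simp
  qed
  then show ?thesis using nat[OF x] by (cases k rule: int_cases2) auto
qed

lemma language_iff: "w \<in> language X \<longleftrightarrow> (\<exists>x\<in>X. \<exists>i. word x i (length w) = w)"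
  by (simp add: language_def occurs_at_word)

lemma language_at:
  assumes "shift_space X" "w \<in> language X"
  shows "\<exists>x\<in>X. word x i (length w) = w"
proof -
  obtain x j where "x \<in> X" "word x j (length w) = w" using assms by (auto simp: language_iff)
  then show ?thesis
    using shift_space_translate[OF assms(1), of x "j - i"] by (force simp: word_translate)
qed

lemma word_in_language: "x \<in> X \<Longrightarrow> word x i n \<in> language X"
  by (auto simp: language_iff intro!: bexI[of _ x] exI[of _ i])

lemma language_append:
  assumes "u @ v \<in> language X" shows "u \<in> language X" "v \<in> language X"
proof -
  obtain x i where x: "x \<in> X" "word x i (length u + length v) = u @ v"
    using assms by (auto simp: language_iff)
  then have "word x i (length u) = u" "word x (i + int (length u)) (length v) = v"
    by (simp_all add: word_append)
  then show "u \<in> language X" "v \<in> language X" using x by (auto simp: language_iff)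
qed

lemma language_extend:
  assumes "u \<in> language X" shows "\<exists>v. length v = n \<and> u @ v \<in> language X"
proof -
  obtain x i where x: "x \<in> X" "word x i (length u) = u" using assms by (auto simp: language_iff)
  then have "u @ word x (i + int (length u)) n \<in> language X"
    using word_in_language[OF x(1), of i "length u + n"] by (simp add: word_append)
  then show ?thesis by (intro exI[of _ "word x (i + int (length u)) n"]) simp
qed

lemma word_eq_iff: "word x i n = word y j n \<longleftrightarrow> (\<forall>k<n. x (i + int k) = y (j + int k))"
  by (auto simp: list_eq_iff_nth_eq)

lemma word_eqD:
  assumes "word x i n = word y j n" "i \<le> k" "k < i + int n"
  shows "x k = y (k - i + j)"
proof -
  have "x (i + int (nat (k - i))) = y (j + int (nat (k - i)))"
    using assms(1)[unfolded word_eq_iff, rule_format, of "nat (k - i)"] assms by simp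
  then show ?thesis using assms(2) by (simp add: add.commute)
qed

lemma mem_shift_space:
  assumes "shift_space X" "\<And>i n. word x i n \<in> language X"
  shows "x \<in> X"
proof (rule closed_window)
  show "closedin full_topology X" using assms by (simp add: shift_space_def)
  fix n :: nat
  obtain x' where x': "x' \<in> X" "word x' (- int n) (2 * n + 1) = word x (- int n) (2 * n + 1)"
    using language_at[OF assms(1) assms(2)[of "- int n" "2 * n + 1"]] by auto
  have "x' i = x i" if "\<bar>i\<bar> \<le> int n" for i
    using word_eqD[OF x'(2), of i] that by simp
  then show "\<exists>x'\<in>X. \<forall>i. \<bar>i\<bar> \<le> int n \<longrightarrow> x' i = x i" using x'(1) by blast
qed

text \<open>The theorem of Curtis, Hedlund and Lyndon. If no window determined the symbol at \<open>0\<close>, pairs of points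
  agreeing on larger and larger windows with different images would have a common cluster point,
  where continuity fails.\<close>

lemma sliding_block_code:
  assumes fc: "factor_code \<pi> X Y"
  obtains r :: nat where "\<And>x x' i j. x \<in> X \<Longrightarrow> x' \<in> X \<Longrightarrow>
    word x (i - int r) (2 * r + 1) = word x' (j - int r) (2 * r + 1) \<Longrightarrow> \<pi> x i = \<pi> x' j"
proof -
  have X: "shift_space X" and cont: "continuous_map (shift_topology X) (shift_topology Y) \<pi>"
    using fc by (auto simp: factor_code_def)
  obtain A where A: "finite A" "\<And>x i. x \<in> X \<Longrightarrow> x i \<in> A" using X by (force simp: shift_space_def)
  have clX: "closedin full_topology X" using X by (simp add: shift_space_def)
  have "\<exists>n::nat. \<forall>x\<in>X. \<forall>x'\<in>X. (\<forall>i. \<bar>i\<bar> \<le> int n \<longrightarrow> x i = x' i) \<longrightarrow> \<pi> x 0 = \<pi> x' 0"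
  proof (rule ccontr)
    assume "\<not> ?thesis"
    then obtain f f' where f: "\<And>n. f n \<in> X" "\<And>n. f' n \<in> X"
      "\<And>n i. \<bar>i\<bar> \<le> int n \<Longrightarrow> f n i = f' n i" "\<And>n. \<pi> (f n) 0 \<noteq> \<pi> (f' n) 0"
      by metis
    obtain z where z: "\<And>n. \<exists>m\<ge>n. \<forall>i. \<bar>i\<bar> \<le> int n \<longrightarrow> f m i = z i"
      using cluster_point[OF A(1), of f] A(2) f(1) by blast
    have "\<exists>x'\<in>X. \<forall>i. \<bar>i\<bar> \<le> int n \<longrightarrow> x' i = z i" for n using z[of n] f(1) by blast
    then have zX: "z \<in> X" using closed_window[OF clX] by blast
    have "openin (shift_topology Y) {y \<in> Y. y 0 = \<pi> z 0}"
      using openin_coordinate[of 0 "\<pi> z 0"] by (auto simp: openin_subtopology intro!: exI)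
    from openin_continuous_map_preimage[OF cont this]
    have "openin (shift_topology X) {x \<in> X. \<pi> x \<in> {y \<in> Y. y 0 = \<pi> z 0}}" by simp
    then obtain U where U: "openin full_topology U"
      "{x \<in> X. \<pi> x \<in> {y \<in> Y. y 0 = \<pi> z 0}} = U \<inter> X" by (auto simp: openin_subtopology)
    have "\<pi> z \<in> Y" using fc zX by (auto simp: factor_code_def)
    then have "z \<in> U" using U zX by auto
    then obtain n :: nat where n: "\<And>y. (\<And>i. \<bar>i\<bar> \<le> int n \<Longrightarrow> y i = z i) \<Longrightarrow> y \<in> U"
      using open_window[OF U(1)] by metis
    obtain m where m: "m \<ge> n" "\<And>i. \<bar>i\<bar> \<le> int n \<Longrightarrow> f m i = z i" using z[of n] by blast
    have "f m \<in> U" "f' m \<in> U" using m f(3)[of _ m] by (auto intro!: n)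
    then have "f m \<in> U \<inter> X" "f' m \<in> U \<inter> X" using f(1,2) by auto
    then have "\<pi> (f m) 0 = \<pi> z 0" "\<pi> (f' m) 0 = \<pi> z 0" unfolding U(2)[symmetric] by auto
    then show False using f(4)[of m] by simp
  qed
  then obtain r :: nat where r: "\<And>x x'. x \<in> X \<Longrightarrow> x' \<in> X \<Longrightarrow>
    (\<And>i. \<bar>i\<bar> \<le> int r \<Longrightarrow> x i = x' i) \<Longrightarrow> \<pi> x 0 = \<pi> x' 0" by metis
  show ?thesis
  proof (rule that[of r])
    fix x x' i j assume x: "x \<in> X" "x' \<in> X"
      and eq: "word x (i - int r) (2 * r + 1) = word x' (j - int r) (2 * r + 1)"
    have "\<pi> (translate i x) 0 = \<pi> (translate j x') 0"
    proof (rule r)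
      fix k assume "\<bar>k\<bar> \<le> int r"
      then show "translate i x k = translate j x' k"
        using word_eqD[OF eq, of "k + i"] by (simp add: algebra_simps)
    qed (use x shift_space_translate[OF X] in auto)
    then show "\<pi> x i = \<pi> x' j" using factor_code_translate[OF fc] x by simp
  qed
qed

section \<open>Follower sets and synchronizing words of sofic shifts\<close>

text \<open>A forbidden word is too short to see more than the common part of \<open>z\<close> and \<open>z'\<close> on either side of the
  seam.\<close>

lemma sft_glue:
  assumes "shift_of_finite_type Z"
  obtains M :: nat where "\<And>z z' a. z \<in> Z \<Longrightarrow> z' \<in> Z \<Longrightarrow> (\<And>i. a \<le> i \<Longrightarrow> i < a + int M \<Longrightarrow> z i = z' i) \<Longrightarrow>
    (\<lambda>i. if i < a then z i else z' i) \<in> Z"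
proof -
  obtain A Fw where Z: "finite Fw" "Z = {x. range x \<subseteq> A \<and> (\<forall>w\<in>Fw. \<forall>i. \<not> occurs_at w x i)}"
    using assms by (auto simp: shift_of_finite_type_def)
  obtain M where M: "\<And>w. w \<in> Fw \<Longrightarrow> length w \<le> M"
    using finite_imageI[OF Z(1), of length] unfolding finite_nat_set_iff_bounded_le by auto
  show ?thesis
  proof (rule that[of M])
    fix z z' a assume z: "z \<in> Z" "z' \<in> Z" and eq: "\<And>i. a \<le> i \<Longrightarrow> i < a + int M \<Longrightarrow> z i = z' i"
    let ?g = "\<lambda>i. if i < a then z i else z' i"
    have "\<not> occurs_at w ?g i" if w: "w \<in> Fw" for w i
    proof (cases "i < a")
      case True
      have "?g (i + int k) = z (i + int k)" if "k < length w" for k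
        using that M[OF w] True eq[of "i + int k"] by auto
      then have "occurs_at w ?g i \<longleftrightarrow> occurs_at w z i" by (simp add: occurs_at_def)
      then show ?thesis using z w Z(2) by blast
    next
      case False
      then have "occurs_at w ?g i \<longleftrightarrow> occurs_at w z' i" by (simp add: occurs_at_def)
      then show ?thesis using z w Z(2) by blast
    qed
    moreover have "range ?g \<subseteq> A" using z Z(2) by auto
    ultimately show "?g \<in> Z" using Z(2) by blast
  qed
qed

definition follow :: "(int \<Rightarrow> 'a) set \<Rightarrow> 'a list \<Rightarrow> 'a list set" where
  "follow X u = {v. u @ v \<in> language X}"

lemma follow_append: "follow X (u @ v) = {w. v @ w \<in> follow X u}"
  by (simp add: follow_def)

text \<open>What may follow \<open>u\<close> depends only on the central blocks of the points of the covering shift of finite type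
  that lie over \<open>u\<close>, since such a point can be glued to any other point with the same central block.\<close>

lemma sofic_finite_follow:
  assumes "sofic X" shows "finite (range (follow X))"
proof -
  obtain Z :: "(int \<Rightarrow> nat) set" and \<phi> where Z: "shift_of_finite_type Z" and fc: "factor_code \<phi> Z X"
    using assms by (auto simp: sofic_def)
  have ssZ: "shift_space Z" and onto: "\<phi> ` Z = X" and ssX: "shift_space X"
    using fc by (auto simp: factor_code_def)
  obtain r :: nat where r: "\<And>x x' i j. x \<in> Z \<Longrightarrow> x' \<in> Z \<Longrightarrow>
    word x (i - int r) (2 * r + 1) = word x' (j - int r) (2 * r + 1) \<Longrightarrow> \<phi> x i = \<phi> x' j"
    using sliding_block_code[OF fc] by blast
  obtain M :: nat where M: "\<And>z z' a. z \<in> Z \<Longrightarrow> z' \<in> Z \<Longrightarrow> (\<And>i. a \<le> i \<Longrightarrow> i < a + int M \<Longrightarrow> z i = z' i) \<Longrightarrow>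
    (\<lambda>i. if i < a then z i else z' i) \<in> Z"
    using sft_glue[OF Z] by blast
  obtain A where A: "finite A" "\<And>x i. x \<in> Z \<Longrightarrow> x i \<in> A" using ssZ by (force simp: shift_space_def)
  define R where "R = M + r"
  \<comment> \<open>\<open>T u\<close> collects these central blocks, and \<open>\<Phi>\<close> recovers the follower set from them. The radius \<open>R\<close> covers
      both the gluing length and the coding window.\<close>
  define T where "T u = {word z (- int R) (2 * R) | z. z \<in> Z \<and> word (\<phi> z) (- int (length u)) (length u) = u}" for u
  define \<Phi> where "\<Phi> t = {v. \<exists>z'\<in>Z. word (\<phi> z') 0 (length v) = v \<and> word z' (- int R) (2 * R) \<in> t}" for t
  have "follow X u = \<Phi> (T u)" for u
  proof (intro subset_antisym subsetI)
    fix v assume "v \<in> follow X u"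
    then obtain x where x: "x \<in> X" "word x (- int (length u)) (length (u @ v)) = u @ v"
      using language_at[OF ssX, of "u @ v" "- int (length u)"] by (auto simp: follow_def)
    then obtain z where z: "z \<in> Z" "x = \<phi> z" using onto by auto
    have "word (\<phi> z) (- int (length u)) (length u) = u" "word (\<phi> z) 0 (length v) = v"
      using x z by (auto simp: word_append)
    then show "v \<in> \<Phi> (T u)" using z by (auto simp: \<Phi>_def T_def)
  next
    fix v assume "v \<in> \<Phi> (T u)"
    then obtain z z' where z: "z \<in> Z" "z' \<in> Z" "word (\<phi> z) (- int (length u)) (length u) = u"
      "word (\<phi> z') 0 (length v) = v" and eq: "word z' (- int R) (2 * R) = word z (- int R) (2 * R)"
      by (auto simp: \<Phi>_def T_def)
    have e: "z' i = z i" if "- int R \<le> i" "i < int R" for i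
      using word_eqD[OF eq, of i] that by simp
    define y where "y = (\<lambda>i. if i < - int R then z i else z' i)"
    have y: "y \<in> Z" unfolding y_def by (rule M) (use z e in \<open>auto simp: R_def\<close>)
    have "\<phi> y i = \<phi> z i" if "i < 0" for i
      by (rule r) (use y z e that in \<open>auto simp: word_eq_iff y_def R_def\<close>)
    then have w: "word (\<phi> y) (- int (length u)) (length u) = word (\<phi> z) (- int (length u)) (length u)"
      by (simp add: word_eq_iff)
    have "word (\<phi> y) (- int (length u)) (length u) = u"
      using z(3) w by simp
    moreover have "\<phi> y i = \<phi> z' i" if "i \<ge> 0" for i
      by (rule r) (use y z e that in \<open>auto simp: word_eq_iff y_def R_def\<close>)
    then have "word (\<phi> y) 0 (length v) = v" using z(4) by (simp add: word_def)
    ultimately have "word (\<phi> y) (- int (length u)) (length (u @ v)) = u @ v"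
      by (simp add: word_append)
    moreover have "\<phi> y \<in> X" using y onto by auto
    ultimately show "v \<in> follow X u" by (auto simp: follow_def language_iff)
  qed
  moreover have "T u \<in> Pow {l. set l \<subseteq> A \<and> length l = 2 * R}" for u
    using A(2) by (auto simp: T_def word_def)
  ultimately have "range (follow X) \<subseteq> \<Phi> ` Pow {l. set l \<subseteq> A \<and> length l = 2 * R}" by blast
  then show ?thesis
    by (rule finite_subset) (simp add: finite_lists_length_eq[OF A(1)])
qed

text \<open>After a synchronizing word the past is forgotten.\<close>

definition synchronizing :: "(int \<Rightarrow> 'a) set \<Rightarrow> 'a list \<Rightarrow> bool" where
  "synchronizing X m \<longleftrightarrow> m \<in> language X \<and>
     (\<forall>u. u @ m \<in> language X \<longrightarrow> follow X (u @ m) = follow X m)"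

text \<open>Minimize the number of follower sets \<open>follow X (u @ m)\<close>. If two of them differed by a word \<open>v\<close>, then
  appending \<open>v\<close> to \<open>m\<close> would kill one of them and make the number smaller.\<close>

lemma synchronizing_exists:
  assumes fin: "finite (range (follow X))" and ne: "X \<noteq> {}"
  shows "\<exists>m. synchronizing X m"
proof -
  define C where "C w = follow X ` {u @ w | u. u @ w \<in> language X}" for w
  have finC: "finite (C w)" for w by (rule finite_subset[OF _ fin]) (auto simp: C_def)
  have "\<exists>w. w \<in> language X" using ne by (auto simp: language_iff intro!: exI[of _ "[]"] simp: word_def)
  then obtain m where m: "m \<in> language X" "\<And>w. w \<in> language X \<Longrightarrow> card (C m) \<le> card (C w)"
    using ex_has_least_nat[of "\<lambda>w. w \<in> language X" _ "\<lambda>w. card (C w)"] by blast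
  have "follow X (u @ m) = follow X (u' @ m)"
    if u: "u @ m \<in> language X" "u' @ m \<in> language X" for u u'
  proof (rule ccontr)
    assume "follow X (u @ m) \<noteq> follow X (u' @ m)"
    then obtain v a b where v: "v \<in> follow X (a @ m)" "v \<notin> follow X (b @ m)"
      and ab: "a @ m \<in> language X" "b @ m \<in> language X" using u by blast
    let ?\<delta> = "\<lambda>F. {w. v @ w \<in> F}"
    have mv: "m @ v \<in> language X" using v(1) language_append(2)[of a "m @ v"] by (simp add: follow_def)
    have "C (m @ v) \<subseteq> ?\<delta> ` (C m - {follow X (b @ m)})"
    proof
      fix F assume "F \<in> C (m @ v)"
      then obtain c where c: "c @ m @ v \<in> language X" "F = follow X (c @ m @ v)" by (auto simp: C_def)
      then have "F = ?\<delta> (follow X (c @ m))" by (simp add: follow_def)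
      moreover have "follow X (c @ m) \<noteq> follow X (b @ m)" using c v(2) by (auto simp: follow_def)
      moreover have "c @ m \<in> language X" using c language_append(1)[of "c @ m" v X] by simp
      ultimately show "F \<in> ?\<delta> ` (C m - {follow X (b @ m)})" by (auto simp: C_def)
    qed
    then have "card (C (m @ v)) \<le> card (C m - {follow X (b @ m)})"
      using finC by (intro surj_card_le) auto
    also have "\<dots> < card (C m)" using ab finC by (intro card_Diff1_less) (auto simp: C_def)
    finally show False using m(2)[OF mv] by simp
  qed
  then have "synchronizing X m" using m(1) by (metis append_Nil synchronizing_def)
  then show ?thesis by blast
qed

section \<open>The Fischer cover\<close>

text \<open>Concatenation of the blocks \<open>B k\<close>, placed on the intervals \<open>[k N, (k + 1) N)\<close>.\<close>

lemma bi_infinite_path: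
  fixes B :: "int \<Rightarrow> 's list" and E :: "'s \<Rightarrow> 's \<Rightarrow> bool"
  assumes path: "\<And>k. successively E (B k)" "\<And>k. set (B k) \<subseteq> S" "\<And>k. length (B k) = N" "N > 0"
    and join: "\<And>k. E (last (B k)) (hd (B (k + 1)))"
  defines "z \<equiv> \<lambda>i. B (i div int N) ! nat (i mod int N)"
  shows "z i \<in> S \<and> E (z i) (z (i + 1))"
    and "word z (k * int N) N = B k"
proof -
  have N: "int N > 0" using path by simp
  define k j where "k = i div int N" and "j = nat (i mod int N)"
  have i: "i = k * int N + int j" and j: "j < N"
    using N by (auto simp: k_def j_def nat_less_iff)
  have zz: "z (k' * int N + int j') = B k' ! j'" if "j' < N" for k' j'
  proof -
    have "(k' * int N + int j') div int N = k'" "(k' * int N + int j') mod int N = int j'"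
      using that N by (simp_all add: div_add1_eq)
    then show ?thesis by (simp add: z_def)
  qed
  have zi: "z i = B k ! j" using zz[OF j, of k] i by simp
  have "E (z i) (z (i + 1))"
  proof (cases "Suc j < N")
    case True
    then have "z (i + 1) = B k ! Suc j" using zz[OF True, of k] i by (simp add: algebra_simps)
    then show ?thesis using path(1,3)[of k] True zi by (simp add: successively_conv_nth)
  next
    case False
    then have "Suc j = N" using j by simp
    then have j': "i + 1 = (k + 1) * int N + int 0" "j = N - 1" using i by (auto simp: algebra_simps)
    then have "z (i + 1) = B (k + 1) ! 0" using zz[of 0 "k + 1"] path by simp
    moreover have "B (k + 1) \<noteq> []" "B k \<noteq> []" using path(3,4) by fastforce+
    ultimately show ?thesis using join[of k] zi j' path(3) by (simp add: hd_conv_nth last_conv_nth)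
  qed
  moreover have "z i \<in> S" using zi path(2,3)[of k] j nth_mem[of j "B k"] by auto
  ultimately show "z i \<in> S \<and> E (z i) (z (i + 1))" by simp
next
  have N: "int N > 0" using path by simp
  show "word z (k * int N) N = B k"
  proof (rule nth_equalityI)
    fix j assume "j < length (word z (k * int N) N)"
    then have "j < N" by simp
    then have "(k * int N + int j) div int N = k" "(k * int N + int j) mod int N = int j"
      using N by (simp_all add: div_add1_eq)
    then show "word z (k * int N) N ! j = B k ! j" using \<open>j < N\<close> by (simp add: z_def)
  qed (use path in simp)
qed

locale synchronized_code =
  fixes X :: "(int \<Rightarrow> 'a) set" and Y :: "(int \<Rightarrow> 'b) set" and \<pi> and m :: "'a list" and r :: nat
  assumes code: "factor_code \<pi> X Y" and irr: "irreducible_shift X"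
    and f2o: "finite_to_one \<pi> X Y" and fin: "finite (range (follow X))"
    and sync: "synchronizing X m"
    and block: "\<lbrakk>x \<in> X; x' \<in> X; word x (i - int r) (2 * r + 1) = word x' (j - int r) (2 * r + 1)\<rbrakk>
      \<Longrightarrow> \<pi> x i = \<pi> x' j"
begin

text \<open>Blocks of length \<open>K\<close> contain a full coding window and leave room for the synchronizing word.\<close>

definition K :: nat where "K = 2 * r + 1 + length m"

text \<open>States of the Fischer cover together with the next \<open>K\<close> symbols to be read. Recording these symbols turns
  the cover into a graph on which the code depends on one vertex only.\<close>

definition vertices :: "('a list set \<times> 'a list) set" where
  "vertices = {(follow X (m @ u), l) | u l. m @ u @ l \<in> language X \<and> length l = K}"

definition edge :: "'a list set \<times> 'a list \<Rightarrow> 'a list set \<times> 'a list \<Rightarrow> bool" where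
  "edge s t \<longleftrightarrow> fst t = {w. hd (snd s) # w \<in> fst s} \<and> tl (snd s) = butlast (snd t)"

text \<open>The block of a vertex occupies the coordinates \<open>0\<close> to \<open>K - 1\<close>, so it determines the image at \<open>r\<close>.\<close>

definition image_symbol :: "'a list set \<times> 'a list \<Rightarrow> 'b" where
  "image_symbol s = \<pi> (SOME x. x \<in> X \<and> word x 0 K = snd s) (int r)"

definition bipath :: "(int \<Rightarrow> 'a list set \<times> 'a list) \<Rightarrow> bool" where
  "bipath z \<longleftrightarrow> (\<forall>i. z i \<in> vertices \<and> edge (z i) (z (i + 1)))"

definition label :: "(int \<Rightarrow> 'a list set \<times> 'a list) \<Rightarrow> int \<Rightarrow> 'a" where
  "label z = (\<lambda>i. hd (snd (z i)))"

lemma X: "shift_space X" and Y: "shift_space Y" and onto: "\<pi> ` X = Y"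
  using code by (auto simp: factor_code_def)

lemma m: "m \<in> language X" using sync by (simp add: synchronizing_def)

lemma K: "K > 0" "length m \<le> K" by (simp_all add: K_def)

lemma follow_m: "u @ m @ v \<in> language X \<Longrightarrow> follow X (u @ m @ v) = follow X (m @ v)"
  using sync language_append(1)[of "u @ m" v X]
  by (metis append_assoc follow_append synchronizing_def)

lemma image_symbol:
  assumes x: "x \<in> X" and s: "snd s = word x i K" shows "image_symbol s = \<pi> x (i + int r)"
proof -
  let ?P = "\<lambda>x'. x' \<in> X \<and> word x' 0 K = snd s"
  have "?P (translate i x)" using shift_space_translate[OF X x] s by (simp add: word_translate)
  then have P: "?P (SOME x'. ?P x')" by (rule someI[of ?P])
  let ?y = "SOME x'. ?P x'"
  have eq: "word ?y 0 K = word x i K" using P s by simp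
  have "\<pi> ?y (int r) = \<pi> x (i + int r)"
  proof (rule block)
    have "?y (int k) = x (i + int k)" if "k < K" for k using eq that by (simp add: word_eq_iff)
    then show "word ?y (int r - int r) (2 * r + 1) = word x (i + int r - int r) (2 * r + 1)"
      by (simp add: word_eq_iff K_def)
  qed (use P x in auto)
  then show ?thesis by (simp add: image_symbol_def)
qed

text \<open>The vertex reached after reading \<open>j\<close> symbols of \<open>f\<close> from the state \<open>follow X (m @ u)\<close>.\<close>

definition run :: "'a list \<Rightarrow> 'a list \<Rightarrow> nat \<Rightarrow> 'a list set \<times> 'a list" where
  "run u f j = (follow X (m @ u @ take j f), take K (drop j f))"

lemma run_vertex:
  assumes "m @ u @ f \<in> language X" "j + K \<le> length f"
  shows "run u f j \<in> vertices"
proof -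
  have "f = take j f @ take K (drop j f) @ drop K (drop j f)" by (metis append_take_drop_id)
  then have "(m @ (u @ take j f) @ take K (drop j f)) @ drop K (drop j f) \<in> language X"
    using assms(1) by (metis append_assoc)
  then have "m @ (u @ take j f) @ take K (drop j f) \<in> language X" by (rule language_append)
  then show ?thesis using assms(2) by (auto simp: run_def vertices_def)
qed

lemma run_edge:
  assumes "Suc j + K \<le> length f" shows "edge (run u f j) (run u f (Suc j))"
proof -
  have j: "j < length f" using assms K by simp
  have "hd (take K (drop j f)) = f ! j" using j K by (simp add: hd_drop_conv_nth)
  moreover have "take (Suc j) f = take j f @ [f ! j]" using j by (rule take_Suc_conv_app_nth)
  moreover have "tl (take K (drop j f)) = butlast (take K (drop (Suc j) f))"
    using assms by (intro nth_equalityI) (auto simp: nth_tl nth_butlast)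
  ultimately show ?thesis by (simp add: edge_def run_def follow_def)
qed

lemma finite_vertices: "finite vertices"
proof -
  obtain A where A: "finite A" "\<And>x i. x \<in> X \<Longrightarrow> x i \<in> A" using X by (force simp: shift_space_def)
  have "set l \<subseteq> A" if l: "l \<in> language X" for l
  proof -
    obtain x i where "x \<in> X" "word x i (length l) = l"
      using l unfolding language_iff by blast
    moreover have "set (word x i n) \<subseteq> A" for n using A \<open>x \<in> X\<close> by (auto simp: word_def)
    ultimately show ?thesis by metis
  qed
  moreover have "l \<in> language X" if "m @ u @ l \<in> language X" for u l
    using language_append(2)[of "m @ u" l X] that by simp
  ultimately have "vertices \<subseteq> range (follow X) \<times> {l. set l \<subseteq> A \<and> length l = K}"
    unfolding vertices_def by blast
  then show ?thesis
    by (rule finite_subset) (simp add: fin finite_lists_length_eq[OF A(1)])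
qed

lemma vertex_synchronizing: "\<exists>q\<in>vertices. take (length m) (snd q) = m"
proof -
  obtain w where w: "m @ w @ m \<in> language X" using irr m by (auto simp: irreducible_shift_def)
  obtain e where "length e = K - length m" "(m @ w @ m) @ e \<in> language X"
    using language_extend[OF w] by blast
  then have "(follow X (m @ w), m @ e) \<in> vertices" using K by (auto simp: vertices_def)
  then show ?thesis by (auto intro!: bexI)
qed

text \<open>Between two vertices irreducibility supplies a connecting word, and the synchronizing word in front of
  \<open>u'\<close> makes the path arrive in the prescribed state.\<close>

lemma vertices_connected:
  assumes "s \<in> vertices" "t \<in> vertices"
  shows "\<exists>c. set c \<subseteq> vertices \<and> successively edge (s # c @ [t])"
proof -
  obtain u l u' l' where s: "s = (follow X (m @ u), l)" "m @ u @ l \<in> language X" "length l = K"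
    and t: "t = (follow X (m @ u'), l')" "m @ u' @ l' \<in> language X" "length l' = K"
    using assms by (auto simp: vertices_def)
  obtain w where w: "(m @ u @ l) @ w @ (m @ u' @ l') \<in> language X"
    using irr s(2) t(2) unfolding irreducible_shift_def by blast
  define f where "f = l @ w @ m @ u' @ l'"
  define N where "N = length f - K"
  have f: "m @ u @ f \<in> language X" using w by (simp add: f_def)
  have lf: "length f = N + K" and N: "N > 0" using s t K by (auto simp: f_def N_def)
  have "run u f 0 = s" using s by (simp add: run_def f_def)
  moreover have "run u f N = t"
  proof -
    have "N = length (l @ w @ m @ u')" using t by (simp add: N_def f_def)
    then have "take N f = l @ w @ m @ u'" "take K (drop N f) = l'" using t by (simp_all add: f_def)
    moreover have "(m @ u @ l @ w) @ m @ u' \<in> language X"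
      using w language_append(1)[of "(m @ u @ l @ w) @ m @ u'" l' X] by simp
    then have "follow X (m @ u @ l @ w @ m @ u') = follow X (m @ u')"
      using follow_m[of "m @ u @ l @ w" u'] by simp
    ultimately show ?thesis using t by (simp add: run_def)
  qed
  moreover define c where "c = map (run u f) [1..<N]"
  moreover have "map (run u f) [0..<N + 1] = run u f 0 # c @ [run u f N]"
    using N by (simp add: c_def upt_conv_Cons)
  moreover have "successively edge (map (run u f) [0..<N + 1])"
    using run_edge lf by (auto simp: successively_conv_nth simp del: upt_Suc)
  moreover have "set c \<subseteq> vertices" using run_vertex[OF f] lf by (auto simp: c_def)
  ultimately show ?thesis by metis
qed

lemma bipath_word:
  assumes z: "bipath z" shows "snd (z i) = word (label z) i K"
proof -
  have len: "length (snd (z i)) = K" for i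
    using z by (auto simp: bipath_def vertices_def dest!: spec[of _ i])
  have e: "tl (snd (z i)) = butlast (snd (z (i + 1)))" for i
    using z by (auto simp: bipath_def edge_def)
  have "k < K \<Longrightarrow> snd (z i) ! k = label z (i + int k)" for k i
  proof (induction k arbitrary: i)
    case 0
    then have "snd (z i) \<noteq> []" using len[of i] by auto
    then show ?case by (simp add: label_def hd_conv_nth)
  next
    case (Suc k)
    have "snd (z i) ! Suc k = tl (snd (z i)) ! k" using Suc len[of i] by (simp add: nth_tl)
    also have "\<dots> = snd (z (i + 1)) ! k" using Suc len[of "i + 1"] e[of i] by (simp add: nth_butlast)
    also have "\<dots> = label z (i + 1 + int k)" using Suc by simp
    finally show ?case by (simp add: algebra_simps)
  qed
  then show ?thesis using len by (intro nth_equalityI) auto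
qed

lemma bipath_state:
  assumes z: "bipath z" shows "fst (z (i + int n)) = {w. word (label z) i n @ w \<in> fst (z i)}"
proof (induction n)
  case 0 then show ?case by (simp add: word_def)
next
  case (Suc n)
  have "edge (z (i + int n)) (z (i + int n + 1))" using z by (simp add: bipath_def)
  then have "fst (z (i + int n + 1)) = {w. label z (i + int n) # w \<in> fst (z (i + int n))}"
    by (simp add: edge_def label_def)
  also have "\<dots> = {w. word (label z) i (Suc n) @ w \<in> fst (z i)}" using Suc by (simp add: word_def)
  finally show ?case by (simp add: algebra_simps)
qed

text \<open>The cover is deterministic: the state and the symbols read determine all later states.\<close>

lemma bipath_deterministic:
  assumes z: "bipath z" "bipath z'" "label z = label z'" and eq: "fst (z i) = fst (z' i)" and ij: "i \<le> j"
  shows "z j = z' j"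
proof -
  have "j = i + int (nat (j - i))" using ij by simp
  then have "fst (z j) = fst (z' j)"
    using bipath_state[OF z(1), of i "nat (j - i)"] bipath_state[OF z(2), of i "nat (j - i)"] z(3) eq
    by simp
  moreover have "snd (z j) = snd (z' j)" using bipath_word z by metis
  ultimately show ?thesis by (simp add: prod_eq_iff)
qed

text \<open>A word read from the state \<open>follow X (m @ u)\<close> leads to a state with nonempty follower set, so it belongs
  to the language.\<close>

lemma label_in_X:
  assumes z: "bipath z" shows "label z \<in> X"
proof (rule mem_shift_space[OF X])
  fix i n
  obtain u l where "z i = (follow X (m @ u), l)"
    using z by (auto simp: bipath_def vertices_def dest!: spec[of _ i])
  then have fi: "fst (z i) = follow X (m @ u)" by simp
  obtain u' l' where "z (i + int n) = (follow X (m @ u'), l')" "m @ u' @ l' \<in> language X"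
    using z by (auto simp: bipath_def vertices_def dest!: spec[of _ "i + int n"])
  then have "l' \<in> fst (z (i + int n))" by (simp add: follow_def)
  then have "word (label z) i n @ l' \<in> follow X (m @ u)"
    using bipath_state[OF z, of i n] fi by simp
  then have "(m @ u) @ word (label z) i n @ l' \<in> language X" by (simp add: follow_def)
  then show "word (label z) i n \<in> language X" using language_append by blast
qed

text \<open>Every word of \<open>x\<close> can be read from some state of the cover; pass to a limit of longer and longer
  readings.\<close>

lemma label_onto:
  assumes x: "x \<in> X" shows "\<exists>z. bipath z \<and> label z = x"
proof -
  obtain s0 where s0: "s0 \<in> vertices" using vertex_synchronizing by auto
  have "\<exists>z. (\<forall>i. z i \<in> vertices) \<and> (\<forall>i. \<bar>i\<bar> \<le> int n \<longrightarrow> snd (z i) = word x i K) \<and>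
    (\<forall>i. \<bar>i\<bar> \<le> int n \<longrightarrow> \<bar>i + 1\<bar> \<le> int n \<longrightarrow> edge (z i) (z (i + 1)))" for n :: nat
  proof -
    define f where "f = word x (- int n) (2 * n + 1 + K)"
    have "f \<in> language X" using word_in_language[OF x] by (simp add: f_def)
    then obtain u where u: "m @ u @ f \<in> language X" using irr m by (auto simp: irreducible_shift_def)
    define z where "z i = (if \<bar>i\<bar> \<le> int n then run u f (nat (i + int n)) else s0)" for i
    have "snd (z i) = word x i K" if "\<bar>i\<bar> \<le> int n" for i
      using that by (auto simp: z_def run_def f_def take_drop_word)
    moreover have "z i \<in> vertices" for i
      using run_vertex[OF u] s0 by (auto simp: z_def f_def)
    moreover have "edge (z i) (z (i + 1))" if "\<bar>i\<bar> \<le> int n" "\<bar>i + 1\<bar> \<le> int n" for i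
    proof -
      have "nat (i + 1 + int n) = Suc (nat (i + int n))" using that by linarith
      then show ?thesis using run_edge[of "nat (i + int n)" f u] that by (auto simp: z_def f_def)
    qed
    ultimately show ?thesis by blast
  qed
  then obtain F where F: "\<And>n i. F n i \<in> vertices" "\<And>n i. \<bar>i\<bar> \<le> int n \<Longrightarrow> snd (F n i) = word x i K"
    "\<And>n i. \<bar>i\<bar> \<le> int n \<Longrightarrow> \<bar>i + 1\<bar> \<le> int n \<Longrightarrow> edge (F n i) (F n (i + 1))" by metis
  obtain z where z: "\<And>n. \<exists>k\<ge>n. \<forall>i. \<bar>i\<bar> \<le> int n \<longrightarrow> F k i = z i"
    using cluster_point[OF finite_vertices, of F] F(1) by blast
  have "z i \<in> vertices \<and> edge (z i) (z (i + 1)) \<and> label z i = x i" for i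
  proof -
    obtain k where k: "k \<ge> nat \<bar>i\<bar> + 1" "\<And>j. \<bar>j\<bar> \<le> int (nat \<bar>i\<bar> + 1) \<Longrightarrow> F k j = z j"
      using z[of "nat \<bar>i\<bar> + 1"] by blast
    have e: "F k i = z i" "F k (i + 1) = z (i + 1)" using k(2) by auto
    have "hd (word x i K) = x i" using K by (simp add: hd_conv_nth word_def upt_rec)
    then have "label z i = x i" using F(2)[of i k] e k(1) by (simp add: label_def)
    then show ?thesis using F(1)[of k i] F(3)[of i k] e k(1) by auto
  qed
  then show ?thesis unfolding bipath_def by blast
qed

lemma image_label:
  assumes z: "bipath z" shows "image_symbol (z i) = \<pi> (label z) (i + int r)"
  using image_symbol[OF label_in_X[OF z]] bipath_word[OF z] by blast

lemma blocks_bipath: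
  fixes B :: "int \<Rightarrow> ('a list set \<times> 'a list) list"
  assumes "\<And>k. successively edge (B k)" "\<And>k. set (B k) \<subseteq> vertices" "\<And>k. length (B k) = N" "N > 0"
    "\<And>k. edge (last (B k)) (hd (B (k + 1)))"
  shows "\<exists>z. bipath z \<and> (\<forall>k. word z (k * int N) N = B k)"
  unfolding bipath_def
  using bi_infinite_path[of edge B vertices N, OF assms] by (intro exI[of _ "\<lambda>i. B (i div int N) ! nat (i mod int N)"]) blast

text \<open>The return path \<open>c\<close> depends on the ends of \<open>p\<close> only.\<close>

lemma closed_path:
  assumes p: "successively edge p" "set p \<subseteq> vertices" "p \<noteq> []"
  shows "\<exists>c. set c \<subseteq> vertices \<and> (\<forall>p'. p' \<noteq> [] \<longrightarrow> successively edge p' \<longrightarrow> hd p' = hd p \<longrightarrow>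
    last p' = last p \<longrightarrow> successively edge (p' @ c) \<and> edge (last (p' @ c)) (hd p))"
proof -
  have "last p \<in> vertices" "hd p \<in> vertices" using p by auto
  then obtain c where c: "set c \<subseteq> vertices" "successively edge (last p # c @ [hd p])"
    using vertices_connected by blast
  have "successively edge (p' @ c) \<and> edge (last (p' @ c)) (hd p)"
    if p': "p' \<noteq> []" "successively edge p'" "hd p' = hd p" "last p' = last p" for p'
    using p' c(2) by (cases c) (auto simp: successively_append_iff successively_Cons)
  then show ?thesis using c by blast
qed

text \<open>A diamond closes up to two loops that may be traversed in any order without changing the image. Using
  the second loop at time \<open>k\<close> only gives a path for each \<open>k\<close>, and as the cover is deterministic their labels
  are pairwise different: infinitely many preimages of one point.\<close>

lemma vertices_no_diamond:
  assumes p: "successively edge p" "set p \<subseteq> vertices" "p \<noteq> []"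
    and p': "successively edge p'" "set p' \<subseteq> vertices"
    and im: "map image_symbol p = map image_symbol p'" and ends: "hd p = hd p'" "last p = last p'"
  shows "p = p'"
proof (rule ccontr)
  assume neq: "p \<noteq> p'"
  have len: "length p' = length p" using im by (metis length_map)
  then have ne': "p' \<noteq> []" using p by auto
  obtain c where c: "set c \<subseteq> vertices"
    and loop: "\<And>p'. p' \<noteq> [] \<Longrightarrow> successively edge p' \<Longrightarrow> hd p' = hd p \<Longrightarrow> last p' = last p \<Longrightarrow>
      successively edge (p' @ c) \<and> edge (last (p' @ c)) (hd p)"
    using closed_path[OF p] by blast
  define N where "N = length (p @ c)"
  define B where "B k j = (if j = k then p' @ c else p @ c)" for k j :: int
  have hdB: "hd (B k j) = hd p" for k j using p ne' ends by (simp add: B_def)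
  have lenB: "length (B k j) = N" for k j using len by (simp add: B_def N_def)
  have N: "N > 0" using p by (simp add: N_def)
  have "\<exists>z. bipath z \<and> (\<forall>j. word z (j * int N) N = B k j)" for k
  proof (rule blocks_bipath)
    fix j
    have l: "successively edge (B k j) \<and> edge (last (B k j)) (hd p)" for j
      using loop[of p] loop[of p'] p p' ne' ends by (simp add: B_def)
    show "successively edge (B k j)" "edge (last (B k j)) (hd (B k (j + 1)))"
      using l[of j] by (auto simp: hdB)
    show "set (B k j) \<subseteq> vertices" using p p' c by (auto simp: B_def)
  qed (use lenB N in auto)
  then obtain z where z: "\<And>k. bipath (z k)" "\<And>k j. word (z k) (j * int N) N = B k j" by metis
  have same: "image_symbol (z k i) = image_symbol (z 0 i)" for k i
  proof -
    define j n where "j = i div int N" and "n = nat (i mod int N)"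
    have n: "n < N" "i = j * int N + int n" using N by (auto simp: j_def n_def nat_less_iff)
    have "map image_symbol (B k j) = map image_symbol (B 0 j)" using im by (simp add: B_def)
    then have "map image_symbol (word (z k) (j * int N) N) ! n = map image_symbol (word (z 0) (j * int N) N) ! n"
      using z(2) by simp
    then show ?thesis using n by simp
  qed
  have "\<pi> (label (z k)) = \<pi> (label (z 0))" for k
  proof
    fix i
    show "\<pi> (label (z k)) i = \<pi> (label (z 0)) i"
      using same[of k "i - int r"] image_label[OF z(1), of _ "i - int r"] by simp
  qed
  then have "range (\<lambda>k. label (z k)) \<subseteq> fiber \<pi> X (\<pi> (label (z 0)))"
    using label_in_X z(1) by (auto simp: fiber_def)
  moreover have "finite (fiber \<pi> X (\<pi> (label (z 0))))"
    using f2o label_in_X[OF z(1)] onto by (auto simp: finite_to_one_def)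
  ultimately have "\<not> inj (\<lambda>k. label (z k))"
    using finite_subset finite_imageD infinite_UNIV_int by blast
  then obtain k k' where k: "k \<noteq> k'" "label (z k) = label (z k')" by (auto simp: inj_def)
  have first: "z l (k * int N) = hd p" for l
  proof -
    have "word (z l) (k * int N) N ! 0 = z l (k * int N)" using N by simp
    moreover have "B l k ! 0 = hd p" using hdB[of l k] lenB[of l k] N by (metis hd_conv_nth length_greater_0_conv)
    ultimately show ?thesis using z(2) by simp
  qed
  have "z k i = z k' i" if "i \<ge> k * int N" for i
    by (rule bipath_deterministic[OF z(1) z(1) k(2) _ that]) (simp add: first)
  then have "word (z k) (k * int N) N = word (z k') (k * int N) N" by (simp add: word_eq_iff)
  then have "B k k = B k' k" using z(2) by simp
  then show False using k(1) neq by (simp add: B_def)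
qed

sublocale cover: markov_code vertices edge image_symbol
proof
  show "vertices \<noteq> {}" using vertex_synchronizing by auto
qed (use finite_vertices vertices_connected vertices_no_diamond in auto)

lemma fib_cover: "cover.fib y = {z. bipath z \<and> (\<forall>i. image_symbol (z i) = y i)}"
  by (auto simp: cover.fib_def bipath_def)

text \<open>Close the path up to a loop; the periodic path has its image in \<open>Y\<close>.\<close>

lemma paths_language:
  assumes "cover.paths v \<noteq> {}" shows "v \<in> language Y"
proof (cases "v = []")
  case True
  then show ?thesis using m onto by (auto simp: language_iff word_def)
next
  case False
  obtain p where p: "successively edge p" "set p \<subseteq> vertices" "map image_symbol p = v"
    using assms by (auto simp: cover.paths_def)
  then have ne: "p \<noteq> []" using False by auto
  obtain c where c: "set c \<subseteq> vertices" "successively edge (p @ c)" "edge (last (p @ c)) (hd p)"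
    using closed_path[OF p(1,2) ne] p(1) ne by blast
  have "\<exists>z. bipath z \<and> (\<forall>k. word z (k * int (length (p @ c))) (length (p @ c)) = p @ c)"
    by (rule blocks_bipath) (use p c ne in auto)
  then obtain z where z: "bipath z" "word z 0 (length (p @ c)) = p @ c"
    by (metis mult_zero_left)
  have "word z 0 (length p) @ word z (0 + int (length p)) (length c) = p @ c"
    using z(2) word_append[of z 0 "length p" "length c"] by simp
  then have "word z 0 (length p) = p" by simp
  then have "word (\<pi> (label z)) (int r) (length v) = v"
    using p(3) by (auto simp: list_eq_iff_nth_eq add.commute image_label[OF z(1), symmetric])
  moreover have "\<pi> (label z) \<in> Y" using onto label_in_X[OF z(1)] by blast
  ultimately show ?thesis by (auto simp: language_iff)
qed

lemma doubly_transitive_recurrent: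
  assumes y: "doubly_transitive Y y" shows "cover.recurrent (translate (int r) y)"
  unfolding cover.recurrent_def
proof (intro conjI allI impI)
  fix i n
  obtain x where x: "x \<in> X" "y = \<pi> x" using y onto by (auto simp: doubly_transitive_def)
  then obtain z where z: "bipath z" "label z = x" using label_onto by blast
  have "z \<in> cover.fib (translate (int r) y)" using z image_label[OF z(1)] x by (simp add: fib_cover)
  then have fw: "successively edge (word z i n) \<and> set (word z i n) \<subseteq> vertices \<and>
      map image_symbol (word z i n) = word (translate (int r) y) i n"
    by (auto simp: fib_cover bipath_def successively_conv_nth word_def algebra_simps)
  then show "cover.paths (word (translate (int r) y) i n) \<noteq> {}" by (auto simp: cover.paths_def)
next
  fix v n assume "cover.paths v \<noteq> {}"
  then have v: "v \<in> language Y" by (rule paths_language)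
  obtain i where "i \<ge> n + int r" "word y i (length v) = v"
    using y v unfolding doubly_transitive_def occurs_at_word by blast
  then show "\<exists>i\<ge>n. word (translate (int r) y) i (length v) = v"
    by (intro exI[of _ "i - int r"]) (simp add: word_translate)
  obtain i where "i \<le> n + int r" "word y i (length v) = v"
    using y v unfolding doubly_transitive_def occurs_at_word by blast
  then show "\<exists>i\<le>n. word (translate (int r) y) i (length v) = v"
    by (intro exI[of _ "i - int r"]) (simp add: word_translate)
qed

text \<open>The label map loses nothing over \<open>y\<close>: two paths with the same label are both in the state \<open>follow X m\<close>
  after each occurrence of \<open>m\<close>, and such occurrences exist arbitrarily far to the left.\<close>

lemma fiber_cover:
  assumes visits: "\<And>z q n. z \<in> cover.fib (translate (int r) y) \<Longrightarrow> q \<in> vertices \<Longrightarrow> \<exists>i\<le>n. z i = q"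
  shows "bij_betw label (cover.fib (translate (int r) y)) (fiber \<pi> X y)"
  unfolding bij_betw_def
proof
  let ?F = "cover.fib (translate (int r) y)"
  show "label ` ?F = fiber \<pi> X y"
  proof
    show "label ` ?F \<subseteq> fiber \<pi> X y"
    proof clarify
      fix z assume z: "z \<in> ?F"
      then have "\<pi> (label z) (i + int r) = y (i + int r)" for i
        using image_label[of z i] by (simp add: fib_cover)
      then have "\<pi> (label z) i = y i" for i by (metis diff_add_cancel)
      then show "label z \<in> fiber \<pi> X y" using z label_in_X by (auto simp: fiber_def fib_cover)
    qed
    show "fiber \<pi> X y \<subseteq> label ` ?F"
    proof
      fix x assume "x \<in> fiber \<pi> X y"
      then have x: "x \<in> X" "\<pi> x = y" by (auto simp: fiber_def)
      then obtain z where "bipath z" "label z = x" using label_onto by blast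
      then show "x \<in> label ` ?F" using x image_label by (auto simp: fib_cover intro!: image_eqI[of _ _ z])
    qed
  qed
  show "inj_on label ?F"
  proof (rule inj_onI)
    fix z z' assume zz: "z \<in> ?F" "z' \<in> ?F" and eq: "label z = label z'"
    then have z: "bipath z" "bipath z'" by (auto simp: fib_cover)
    obtain q where q: "q \<in> vertices" "take (length m) (snd q) = m" using vertex_synchronizing by blast
    show "z = z'"
    proof
      fix j
      obtain i where i: "i \<le> j - int (length m)" "z i = q" using visits[OF zz(1) q(1)] by blast
      have "take (length m) (snd (z i)) = word (label z) i (length m)"
        using bipath_word[OF z(1), of i] take_drop_word[of 0 "length m" K "label z" i] K by simp
      then have wm: "word (label z) i (length m) = m" using i q by simp
      have reset: "fst (b (i + int (length m))) = follow X m" if b: "bipath b" "label b = label z" for b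
      proof -
        obtain u l where ul: "b i = (follow X (m @ u), l)" "m @ u @ l \<in> language X" "length l = K"
          using b by (auto simp: bipath_def vertices_def dest!: spec[of _ i])
        have "l = word (label z) i (length m + (K - length m))"
          using bipath_word[OF b(1), of i] b ul K by simp
        then have "l = m @ word (label z) (i + int (length m)) (K - length m)"
          using wm by (simp only: word_append)
        then have "m @ u @ m \<in> language X"
          using ul(2) language_append(1)[of "m @ u @ m"] by (metis append_assoc)
        then have "follow X (m @ u @ m) = follow X m" using follow_m[of "m @ u" "[]"] by simp
        moreover have "fst (b (i + int (length m))) = {w. m @ w \<in> follow X (m @ u)}"
          using bipath_state[OF b(1), of i "length m"] b wm ul by simp
        ultimately show ?thesis by (simp add: follow_def)
      qed
      show "z j = z' j"
        by (rule bipath_deterministic[OF z eq, of "i + int (length m)"]) (use reset z eq i in auto)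
    qed
  qed
qed

end

text \<open>Over a doubly transitive point the fiber of the code and that of its lift to the Fischer cover are in
  bijection, and the latter has the size given by the magic word.\<close>

theorem degree_exists:
  assumes "sofic X" "irreducible_shift X" "factor_code \<pi> X Y" "finite_to_one \<pi> X Y" "X \<noteq> {}"
  shows "\<exists>d. \<forall>y. doubly_transitive Y y \<longrightarrow> finite (fiber \<pi> X y) \<and> card (fiber \<pi> X y) = d"
proof -
  obtain m where m: "synchronizing X m"
    using synchronizing_exists[OF sofic_finite_follow] assms by blast
  obtain r :: nat where r: "\<And>x x' i j. x \<in> X \<Longrightarrow> x' \<in> X \<Longrightarrow>
    word x (i - int r) (2 * r + 1) = word x' (j - int r) (2 * r + 1) \<Longrightarrow> \<pi> x i = \<pi> x' j"
    using sliding_block_code[OF assms(3)] by blast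
  interpret synchronized_code X Y \<pi> m r
    using assms sofic_finite_follow m r by unfold_locales
  obtain d where d: "\<And>y. cover.recurrent y \<Longrightarrow> finite (cover.fib y) \<and> card (cover.fib y) = d \<and>
     (\<forall>z\<in>cover.fib y. \<forall>q\<in>vertices. \<forall>n. \<exists>i\<le>n. z i = q)"
    using cover.degree_of_graph_code by blast
  have "finite (fiber \<pi> X y) \<and> card (fiber \<pi> X y) = d" if "doubly_transitive Y y" for y
  proof -
    let ?y = "translate (int r) y"
    note d' = d[OF doubly_transitive_recurrent[OF that]]
    then have b: "bij_betw label (cover.fib ?y) (fiber \<pi> X y)" by (intro fiber_cover) blast
    show ?thesis using bij_betw_finite[OF b] bij_betw_same_card[OF b] d' by simp
  qed
  then show ?thesis by blast
qed

section \<open>Borel sets and the number of points in a fiber\<close>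

lemma space_borel_of [simp]: "space (borel_of T) = topspace T"
  by (simp add: borel_of_def space_measure_of_conv)

lemma open_sets_Pow: "{U. openin T U} \<subseteq> Pow (topspace T)"
  using openin_subset by auto

lemma sets_borel_of: "sets (borel_of T) = sigma_sets (topspace T) {U. openin T U}"
  unfolding borel_of_def by (rule sets_measure_of[OF open_sets_Pow])

lemma openin_borel: "openin T U \<Longrightarrow> U \<in> sets (borel_of T)"
  by (simp add: sets_borel_of sigma_sets.Basic)

lemma closedin_borel:
  assumes "closedin T C" shows "C \<in> sets (borel_of T)"
proof -
  have "topspace T - (topspace T - C) \<in> sets (borel_of T)"
    using assms openin_borel[of T "topspace T - C"] sets.compl_sets[of "topspace T - C" "borel_of T"]
    by (simp add: closedin_def)
  moreover have "topspace T - (topspace T - C) = C" using assms closedin_subset by fastforce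
  ultimately show ?thesis by simp
qed

lemma sets_borel_of_closed: "sets (borel_of T) = sigma_sets (topspace T) {C. closedin T C}"
proof -
  have Pow: "{C. closedin T C} \<subseteq> Pow (topspace T)" using closedin_subset by auto
  interpret S: sigma_algebra "topspace T" "sigma_sets (topspace T) {C. closedin T C}"
    by (rule sigma_algebra_sigma_sets[OF Pow])
  have "U \<in> sigma_sets (topspace T) {C. closedin T C}" if "openin T U" for U
  proof -
    have "topspace T - (topspace T - U) \<in> sigma_sets (topspace T) {C. closedin T C}"
      using that by (intro S.compl_sets sigma_sets.Basic) (simp add: openin_closedin_eq)
    moreover have "topspace T - (topspace T - U) = U" using openin_subset[OF that] by blast
    ultimately show ?thesis by simp
  qed
  then have "sigma_sets (topspace T) {U. openin T U} \<subseteq> sigma_sets (topspace T) {C. closedin T C}"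
    by (intro S.sigma_sets_subset) auto
  moreover have "sigma_sets (topspace T) {C. closedin T C} \<subseteq> sets (borel_of T)"
    using closedin_borel sets.sigma_sets_subset[of "{C. closedin T C}" "borel_of T"] by auto
  ultimately show ?thesis by (auto simp: sets_borel_of)
qed

lemma continuous_map_borel:
  assumes "continuous_map T U f" shows "f \<in> borel_of T \<rightarrow>\<^sub>M borel_of U"
proof -
  have "f \<in> borel_of T \<rightarrow>\<^sub>M sigma (topspace U) {V. openin U V}"
  proof (rule measurable_sigma_sets[OF _ open_sets_Pow])
    show "f \<in> space (borel_of T) \<rightarrow> topspace U"
      using assms by (auto simp: continuous_map_def)
    fix V assume "V \<in> {V. openin U V}"
    then have "openin T {x \<in> topspace T. f x \<in> V}" using assms openin_continuous_map_preimage by auto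
    moreover have "f -` V \<inter> space (borel_of T) = {x \<in> topspace T. f x \<in> V}" by auto
    ultimately show "f -` V \<inter> space (borel_of T) \<in> sets (borel_of T)" by (simp add: openin_borel)
  qed (simp add: sets_borel_of sets_measure_of[OF open_sets_Pow])
  then show ?thesis by (simp add: borel_of_def)
qed

definition fiber_count :: "('p \<Rightarrow> 'q) \<Rightarrow> 'p set \<Rightarrow> 'p set \<Rightarrow> 'q \<Rightarrow> ennreal" where
  "fiber_count P K A y = (\<Sum>x\<in>fiber P K y. indicator A x)"

lemma fiber_count_card: "finite (fiber P K y) \<Longrightarrow> fiber_count P K A y = of_nat (card (fiber P K y \<inter> A))"
  by (simp add: fiber_count_def indicator_def sum.If_cases Int_def)

lemma fiber_count_diff:
  assumes "finite (fiber P K y)" "fiber P K y \<subseteq> S"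
  shows "fiber_count P K (S - A) y = fiber_count P K S y - fiber_count P K A y"
proof -
  have "fiber P K y \<inter> S = (fiber P K y \<inter> A) \<union> (fiber P K y \<inter> (S - A))" using assms(2) by auto
  moreover have "card ((fiber P K y \<inter> A) \<union> (fiber P K y \<inter> (S - A))) =
      card (fiber P K y \<inter> A) + card (fiber P K y \<inter> (S - A))"
    using assms(1) by (intro card_Un_disjoint) auto
  ultimately have "fiber_count P K S y = fiber_count P K A y + fiber_count P K (S - A) y"
    using assms(1) by (simp add: fiber_count_card)
  then show ?thesis using assms(1) by (simp add: fiber_count_card)
qed

lemma fiber_count_Union:
  assumes "disjoint_family A"
  shows "fiber_count P K (\<Union>i. A i) y = (\<Sum>i. fiber_count P K (A i) y)"
proof -
  have "fiber_count P K (\<Union>i. A i) y = (\<Sum>x\<in>fiber P K y. \<Sum>i. indicator (A i) x)"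
    unfolding fiber_count_def using suminf_indicator[OF assms] by simp
  also have "\<dots> = (\<Sum>i. fiber_count P K (A i) y)"
    unfolding fiber_count_def by (rule suminf_sum[symmetric]) simp
  finally show ?thesis .
qed

text \<open>A sequence of clopen sets separating points; its finite stages give finer and finer finite partitions.\<close>

definition clopen_separation :: "'p topology \<Rightarrow> (nat \<Rightarrow> 'p set) \<Rightarrow> bool" where
  "clopen_separation T C \<longleftrightarrow> (\<forall>i. openin T (C i) \<and> closedin T (C i)) \<and>
     (\<forall>x\<in>topspace T. \<forall>y\<in>topspace T. x \<noteq> y \<longrightarrow> (\<exists>i. (x \<in> C i) \<noteq> (y \<in> C i)))"

lemma clopen_separationI:
  assumes "countable \<C>" "\<And>C. C \<in> \<C> \<Longrightarrow> openin T C \<and> closedin T C"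
    "\<And>x y. x \<in> topspace T \<Longrightarrow> y \<in> topspace T \<Longrightarrow> x \<noteq> y \<Longrightarrow> \<exists>C\<in>\<C>. (x \<in> C) \<noteq> (y \<in> C)"
  shows "\<exists>C. clopen_separation T C"
proof -
  let ?C = "insert {} \<C>"
  have r: "range (from_nat_into ?C) = ?C" using assms(1) by (intro range_from_nat_into) auto
  have "openin T (from_nat_into ?C i) \<and> closedin T (from_nat_into ?C i)" for i
    using from_nat_into[of ?C i] assms(2) by auto
  moreover have "\<exists>i. (x \<in> from_nat_into ?C i) \<noteq> (y \<in> from_nat_into ?C i)"
    if xy: "x \<in> topspace T" "y \<in> topspace T" "x \<noteq> y" for x y
  proof -
    obtain C where "C \<in> ?C" "(x \<in> C) \<noteq> (y \<in> C)" using assms(3)[OF xy] by blast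
    then show ?thesis using r by (metis rangeE)
  qed
  ultimately show ?thesis unfolding clopen_separation_def by blast
qed

context
  fixes T :: "'p topology" and U :: "'q topology" and P :: "'p \<Rightarrow> 'q" and K :: "'p set" and Y0 :: "'q set"
    and C :: "nat \<Rightarrow> 'p set"
  assumes T: "compact_space T" and C: "clopen_separation T C" and U: "Hausdorff_space U"
    and K: "closedin T K" and P: "continuous_map (subtopology T K) U P"
    and Y0: "Y0 \<in> sets (borel_of U)" and fin: "\<And>y. y \<in> Y0 \<Longrightarrow> finite (fiber P K y)"
begin

lemma closed_image:
  assumes F: "closedin T F" shows "closedin U (P ` (F \<inter> K))"
proof (rule compactin_imp_closedin[OF U])
  have "closedin T (F \<inter> K)" using F K by auto
  then have "compactin T (F \<inter> K)" using T closedin_compact_space by blast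
  then have "compactin (subtopology T K) (F \<inter> K)" by (simp add: compactin_subtopology)
  then show "compactin U (P ` (F \<inter> K))" by (rule image_compactin[OF _ P])
qed

text \<open>At stage \<open>n\<close>, count the pieces of the \<open>n\<close>-th clopen partition that contain a point of \<open>F\<close> over \<open>y\<close>. Each
  piece contributes the indicator of a compact image, and once the partition separates the finite fiber
  the count is exact.\<close>

lemma fiber_count_closed:
  assumes F: "closedin T F"
  shows "(\<lambda>y. indicator Y0 y * fiber_count P K F y) \<in> borel_measurable (borel_of U)"
proof -
  define D where "D n I = {x \<in> topspace T. \<forall>i<n. x \<in> C i \<longleftrightarrow> i \<in> I}" for n :: nat and I
  define f where "f n y = (\<Sum>I\<in>Pow {..<n}. indicator (P ` (F \<inter> D n I \<inter> K)) y :: ennreal)" for n y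
  have KT: "K \<subseteq> topspace T" using K by (rule closedin_subset)
  have clD: "closedin T (D n I)" for n I
  proof -
    let ?D = "\<Inter>i\<in>insert n {..<n}. if i = n then topspace T else if i \<in> I then C i else topspace T - C i"
    have "closedin T ?D"
      using C by (intro closedin_INT) (auto simp: clopen_separation_def)
    also have "?D = D n I"
      by (auto simp: D_def split: if_splits)
    finally show ?thesis .
  qed
  have "closedin U (P ` (F \<inter> D n I \<inter> K))" for n I
    by (rule closed_image) (use F clD in auto)
  then have meas: "f n \<in> borel_measurable (borel_of U)" for n
    unfolding f_def by (intro borel_measurable_sum borel_measurable_indicator closedin_borel)
  have lim: "(\<lambda>n. indicator Y0 y * f n y) \<longlonglongrightarrow> indicator Y0 y * fiber_count P K F y" for y
  proof (cases "y \<in> Y0")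
    case True
    let ?\<Phi> = "fiber P K y \<inter> F"
    have fin\<Phi>: "finite ?\<Phi>" using fin[OF True] by simp
    define s where "s x x' = (SOME i. (x \<in> C i) \<noteq> (x' \<in> C i))" for x x'
    have s: "(x \<in> C (s x x')) \<noteq> (x' \<in> C (s x x'))" if "x \<in> ?\<Phi>" "x' \<in> ?\<Phi>" "x \<noteq> x'" for x x'
    proof -
      have "\<exists>i. (x \<in> C i) \<noteq> (x' \<in> C i)"
        using C that KT unfolding clopen_separation_def fiber_def by blast
      then show ?thesis unfolding s_def by (rule someI_ex)
    qed
    have "finite ((\<lambda>(x, x'). s x x') ` (?\<Phi> \<times> ?\<Phi>))" using fin\<Phi> by simp
    then obtain N where N: "\<And>x x'. x \<in> ?\<Phi> \<Longrightarrow> x' \<in> ?\<Phi> \<Longrightarrow> s x x' < N"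
      unfolding finite_nat_set_iff_bounded by auto
    have "f n y = fiber_count P K F y" if n: "n \<ge> N" for n
    proof -
      define I where "I x = {i. i < n \<and> x \<in> C i}" for x
      have "inj_on I ?\<Phi>"
      proof (rule inj_onI, rule ccontr)
        fix x x' assume x: "x \<in> ?\<Phi>" "x' \<in> ?\<Phi>" "I x = I x'" "x \<noteq> x'"
        then have "s x x' < n" using N[of x x'] n by simp
        then show False using s[OF x(1,2,4)] x(3) by (auto simp: I_def set_eq_iff)
      qed
      have "y \<in> P ` (F \<inter> D n J \<inter> K) \<longleftrightarrow> J \<in> I ` ?\<Phi>" if "J \<subseteq> {..<n}" for J
      proof
        assume "y \<in> P ` (F \<inter> D n J \<inter> K)"
        then obtain x where x: "x \<in> F" "x \<in> D n J" "x \<in> K" "P x = y" by blast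
        then have "I x = J" using that by (auto simp: D_def I_def)
        then show "J \<in> I ` ?\<Phi>" using x by (auto simp: fiber_def)
      next
        assume "J \<in> I ` ?\<Phi>"
        then obtain x where x: "x \<in> F" "x \<in> K" "P x = y" "J = I x" by (auto simp: fiber_def)
        then have "x \<in> D n J" using KT by (auto simp: D_def I_def)
        then show "y \<in> P ` (F \<inter> D n J \<inter> K)" using x by blast
      qed
      then have "f n y = (\<Sum>J\<in>Pow {..<n}. if J \<in> I ` ?\<Phi> then 1 else 0)"
        unfolding f_def by (intro sum.cong) (auto simp: indicator_def)
      also have "\<dots> = of_nat (card (Pow {..<n} \<inter> I ` ?\<Phi>))"
        by (simp add: sum.If_cases Int_def)
      also have "Pow {..<n} \<inter> I ` ?\<Phi> = I ` ?\<Phi>" by (auto simp: I_def)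
      also have "card (I ` ?\<Phi>) = card ?\<Phi>" using \<open>inj_on I ?\<Phi>\<close> by (rule card_image)
      finally show ?thesis using fin[OF True] by (simp add: fiber_count_card)
    qed
    then have "eventually (\<lambda>n. indicator Y0 y * f n y = indicator Y0 y * fiber_count P K F y) sequentially"
      by (intro eventually_sequentiallyI[of N]) simp
    then show ?thesis by (rule tendsto_eventually)
  qed simp
  show ?thesis
    by (rule borel_measurable_LIMSEQ_order[OF lim])
      (intro borel_measurable_times_ennreal borel_measurable_indicator Y0 meas)
qed

text \<open>From closed sets to Borel sets by Dynkin's theorem: counting is additive on disjoint unions, and
  fibers are finite, so complements are handled by subtraction.\<close>

lemma fiber_count_measurable:
  assumes A: "A \<in> sets (borel_of T)"
  shows "(\<lambda>y. indicator Y0 y * fiber_count P K A y) \<in> borel_measurable (borel_of U)"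
proof -
  have KT: "K \<subseteq> topspace T" using K by (rule closedin_subset)
  have Pow: "{C. closedin T C} \<subseteq> Pow (topspace T)" using closedin_subset by auto
  have Int: "Int_stable {C. closedin T C}" by (auto simp: Int_stable_def)
  have "A \<in> sigma_sets (topspace T) {C. closedin T C}" using A by (simp add: sets_borel_of_closed)
  with Int Pow show ?thesis
  proof (induction rule: sigma_sets_induct_disjoint)
    case (basic F) then show ?case using fiber_count_closed by simp
  next
    case empty show ?case by (simp add: fiber_count_def)
  next
    case (compl A)
    have "indicator Y0 y * fiber_count P K (topspace T - A) y =
      indicator Y0 y * fiber_count P K (topspace T) y - indicator Y0 y * fiber_count P K A y" for y
    proof (cases "y \<in> Y0")
      case True
      have "fiber P K y \<subseteq> topspace T" using KT by (auto simp: fiber_def)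
      then show ?thesis using True fiber_count_diff[OF fin[OF True]] by simp
    qed simp
    then show ?case
      using borel_measurable_minus_ennreal[OF fiber_count_closed[OF closedin_topspace] compl(2)] by simp
  next
    case (union A)
    have eq: "indicator Y0 y * fiber_count P K (\<Union>i. A i) y = (\<Sum>i. indicator Y0 y * fiber_count P K (A i) y)" for y
      using fiber_count_Union[OF union(1), of P K y] by (simp add: ennreal_suminf_cmult)
    show ?case unfolding eq by (intro borel_measurable_suminf_order union(3))
  qed
qed

end

section \<open>Recurrence and ergodicity\<close>

text \<open>The points whose orbit enters \<open>B\<close> infinitely often. Unlike the set of points whose orbit enters \<open>B\<close> at least
  once, this set equals its own preimage, as the definition of ergodicity demands.\<close>

definition returning :: "'p measure \<Rightarrow> ('p \<Rightarrow> 'p) \<Rightarrow> 'p set \<Rightarrow> 'p set" where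
  "returning M S B = {x \<in> space M. \<forall>n. \<exists>k\<ge>n. (S ^^ k) x \<in> B}"

lemma returning_sets [measurable]:
  assumes [measurable]: "S \<in> M \<rightarrow>\<^sub>M M" "B \<in> sets M" shows "returning M S B \<in> sets M"
proof -
  have [measurable]: "S ^^ k \<in> M \<rightarrow>\<^sub>M M" for k by (rule measurable_compose_n) simp
  have "returning M S B = {x \<in> space M. \<forall>n. \<exists>k. k \<ge> n \<and> (S ^^ k) x \<in> B}"
    by (auto simp: returning_def)
  then show ?thesis by simp
qed

lemma returning_invariant:
  assumes "S \<in> M \<rightarrow>\<^sub>M M" shows "S -` returning M S B \<inter> space M = returning M S B"
proof -
  have "(\<forall>n. \<exists>k\<ge>n. (S ^^ Suc k) x \<in> B) \<longleftrightarrow> (\<forall>n. \<exists>k\<ge>n. (S ^^ k) x \<in> B)" for x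
  proof
    assume l: "\<forall>n. \<exists>k\<ge>n. (S ^^ Suc k) x \<in> B"
    show "\<forall>n. \<exists>k\<ge>n. (S ^^ k) x \<in> B" using l le_Suc_eq by blast
  next
    assume r: "\<forall>n. \<exists>k\<ge>n. (S ^^ k) x \<in> B"
    show "\<forall>n. \<exists>k\<ge>n. (S ^^ Suc k) x \<in> B" using r by (metis Suc_le_D Suc_le_mono)
  qed
  then show ?thesis
    using measurable_space[OF assms] by (auto simp: returning_def funpow_swap1)
qed

text \<open>Poincare recurrence: the sets of points entering \<open>B\<close> at or after time \<open>n\<close> decrease with \<open>n\<close> and are
  preimages of each other, so all have the probability of the first, which contains \<open>B\<close>.\<close>

lemma (in prob_space) prob_returning:
  assumes S: "S \<in> M \<rightarrow>\<^sub>M M" and pres: "distr M M S = M" and B: "B \<in> sets M"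
  shows "prob B \<le> prob (returning M S B)"
proof -
  note [measurable] = S B
  have [measurable]: "S ^^ k \<in> M \<rightarrow>\<^sub>M M" for k by (rule measurable_compose_n) simp
  define U where "U n = {x \<in> space M. \<exists>k. k \<ge> n \<and> (S ^^ k) x \<in> B}" for n :: nat
  have U [measurable]: "U n \<in> sets M" for n unfolding U_def by simp
  have "U (Suc n) = S -` U n \<inter> space M" for n
  proof -
    have "(\<exists>k\<ge>Suc n. (S ^^ k) x \<in> B) \<longleftrightarrow> (\<exists>k\<ge>n. (S ^^ Suc k) x \<in> B)" for x
      by (metis Suc_le_D Suc_le_mono)
    then show ?thesis
      unfolding U_def using measurable_space[OF S] by (auto simp: funpow_Suc_right simp del: funpow.simps)
  qed
  then have "prob (U (Suc n)) = prob (U n)" for n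
    using measure_distr[OF S U, of n] pres by simp
  then have pU: "prob (U n) = prob (U 0)" for n by (induction n) auto
  have "(\<lambda>n. prob (U n)) \<longlonglongrightarrow> prob (\<Inter>n. U n)"
    by (rule finite_Lim_measure_decseq) (auto simp: U_def decseq_def intro: order_trans)
  then have "prob (\<Inter>n. U n) = prob (U 0)"
    using pU LIMSEQ_unique tendsto_const by (metis (no_types, lifting) ext)
  moreover have "(\<Inter>n. U n) = returning M S B" by (auto simp: U_def returning_def)
  moreover have "prob B \<le> prob (U 0)"
    by (rule finite_measure_mono)
      (use sets.sets_into_space[OF B] in \<open>auto simp: U_def intro!: exI[of _ 0]\<close>)
  ultimately show ?thesis by simp
qed

lemma AE_iterate:
  assumes S: "S \<in> M \<rightarrow>\<^sub>M M" and pres: "distr M M S = M" and ae: "AE x in M. S x \<in> E \<longleftrightarrow> x \<in> E"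
  shows "AE x in M. \<forall>k. (S ^^ k) x \<in> E \<longleftrightarrow> x \<in> E"
proof -
  have "AE x in M. (S ^^ k) x \<in> E \<longleftrightarrow> x \<in> E" for k
  proof (induction k)
    case (Suc k)
    then have "AE x in distr M M S. (S ^^ k) x \<in> E \<longleftrightarrow> x \<in> E" unfolding pres .
    then have "AE x in M. (S ^^ k) (S x) \<in> E \<longleftrightarrow> S x \<in> E" by (rule AE_distrD[OF S])
    with ae show ?case by eventually_elim (simp add: funpow_swap1)
  qed simp
  then show ?thesis by (simp add: AE_all_countable)
qed

lemma ergodic_measureD:
  assumes "ergodic_measure T S \<mu>"
  shows "prob_space \<mu>" "sets \<mu> = sets (borel_of T)" "S \<in> \<mu> \<rightarrow>\<^sub>M \<mu>" "distr \<mu> \<mu> S = \<mu>"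
    "A \<in> sets \<mu> \<Longrightarrow> S -` A \<inter> space \<mu> = A \<Longrightarrow> measure \<mu> A = 0 \<or> measure \<mu> A = 1"
  using assms by (auto simp: ergodic_measure_def invariant_measure_def borel_probability_def)

lemma ergodic_returning:
  assumes erg: "ergodic_measure T S \<mu>" and B: "B \<in> sets \<mu>" "measure \<mu> B > 0"
  shows "measure \<mu> (returning \<mu> S B) = 1"
proof -
  note e = ergodic_measureD[OF erg]
  interpret prob_space \<mu> by (rule e)
  have "prob (returning \<mu> S B) > 0" using prob_returning[OF e(3,4) B(1)] B(2) by linarith
  then show ?thesis
    using e(5)[OF returning_sets[OF e(3) B(1)] returning_invariant[OF e(3)]] by linarith
qed

text \<open>An almost invariant set agrees almost everywhere with the invariant set of points returning to it.\<close>

lemma ergodic_AE_invariant: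
  assumes erg: "ergodic_measure T S \<mu>" and E: "E \<in> sets \<mu>" and ae: "AE x in \<mu>. S x \<in> E \<longleftrightarrow> x \<in> E"
  shows "measure \<mu> E = 0 \<or> measure \<mu> E = 1"
proof -
  note e = ergodic_measureD[OF erg]
  have "AE x in \<mu>. x \<in> returning \<mu> S E \<longleftrightarrow> x \<in> E"
    using AE_iterate[OF e(3,4) ae] AE_space by eventually_elim (auto simp: returning_def)
  then have "measure \<mu> (returning \<mu> S E) = measure \<mu> E"
    by (rule measure_eq_AE) (use E e(3) in auto)
  then show ?thesis
    using e(5)[OF returning_sets[OF e(3) E] returning_invariant[OF e(3)]] by simp
qed

lemma measure_diff_preimage:
  assumes N: "prob_space N" and S: "S \<in> N \<rightarrow>\<^sub>M N" and pres: "distr N N S = N" and E: "E \<in> sets N"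
  shows "emeasure N (E - S -` E) = emeasure N ((S -` E \<inter> space N) - E)"
proof -
  interpret prob_space N by fact
  let ?E = "S -` E \<inter> space N"
  have E': "?E \<in> sets N" using S E by measurable
  have eq: "measure N ?E = measure N E" using measure_distr[OF S E] pres by simp
  have "E - S -` E = E - ?E" using sets.sets_into_space[OF E] by auto
  moreover have "measure N (E - ?E) = measure N E - measure N (E \<inter> ?E)"
    by (rule finite_measure_Diff') (use E E' in auto)
  moreover have "measure N (?E - E) = measure N ?E - measure N (?E \<inter> E)"
    by (rule finite_measure_Diff') (use E E' in auto)
  ultimately show ?thesis using eq by (simp add: emeasure_eq_measure Int_commute)
qed

lemma nn_integral_eq_AE_eq:
  fixes f g :: "'p \<Rightarrow> ennreal"
  assumes [measurable]: "f \<in> borel_measurable M" "g \<in> borel_measurable M"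
    and le: "AE x in M. g x \<le> f x" and int: "(\<integral>\<^sup>+x. f x \<partial>M) \<le> (\<integral>\<^sup>+x. g x \<partial>M)" "(\<integral>\<^sup>+x. g x \<partial>M) < \<infinity>"
  shows "AE x in M. f x \<le> g x"
proof -
  have "(\<integral>\<^sup>+x. f x - g x \<partial>M) = (\<integral>\<^sup>+x. f x \<partial>M) - (\<integral>\<^sup>+x. g x \<partial>M)"
    by (rule nn_integral_diff) (use le int in auto)
  also have "\<dots> = 0" using int by (simp add: diff_eq_0_iff_ennreal)
  finally have "AE x in M. f x - g x = 0" by (subst (asm) nn_integral_0_iff_AE) auto
  then show ?thesis by eventually_elim (auto simp: diff_eq_0_iff_ennreal)
qed

text \<open>Let \<open>f\<close> be the density and \<open>E = {f > 1}\<close>. Both measures give \<open>E - S -` E\<close> and \<open>S -` E - E\<close> equal mass;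
  but \<open>\<rho>\<close> exceeds \<open>\<mu>\<close> on the first set unless it is null, and does not on the second. So \<open>E\<close> is almost
  invariant, hence null or conull. As \<open>f\<close> has integral \<open>1\<close>, it is null, and then \<open>f = 1\<close> almost everywhere.\<close>

theorem ergodic_absolutely_continuous_eq:
  assumes erg: "ergodic_measure T S \<mu>" and inv: "invariant_measure T S \<rho>" and ac: "absolutely_continuous \<mu> \<rho>"
  shows "\<rho> = \<mu>"
proof -
  note e = ergodic_measureD[OF erg]
  interpret mu: prob_space \<mu> by (rule e)
  have r: "prob_space \<rho>" "sets \<rho> = sets \<mu>" "S \<in> \<rho> \<rightarrow>\<^sub>M \<rho>" "distr \<rho> \<rho> S = \<rho>"
    using inv e(2) by (auto simp: invariant_measure_def borel_probability_def)
  interpret rho: prob_space \<rho> by (rule r)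
  have sp: "space \<rho> = space \<mu>" using r(2) by (rule sets_eq_imp_space_eq)
  define f where "f = RN_deriv \<mu> \<rho>"
  have f [measurable]: "f \<in> borel_measurable \<mu>" by (simp add: f_def)
  have dens: "density \<mu> f = \<rho>" unfolding f_def by (rule mu.density_RN_deriv[OF ac r(2)])
  have rho: "emeasure \<rho> A = (\<integral>\<^sup>+x. f x * indicator A x \<partial>\<mu>)" if "A \<in> sets \<mu>" for A
    using emeasure_density[OF f that] dens by simp
  define E where "E = {x \<in> space \<mu>. 1 < f x}"
  have E [measurable]: "E \<in> sets \<mu>" by (simp add: E_def)
  let ?E = "S -` E \<inter> space \<mu>"
  have E' [measurable]: "?E \<in> sets \<mu>" using e(3) E by measurable
  let ?G = "E - ?E" and ?G' = "?E - E"
  have GE: "E - S -` E = ?G" using sets.sets_into_space[OF E] by auto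
  have mu_eq: "emeasure \<mu> ?G = emeasure \<mu> ?G'"
    using measure_diff_preimage[OF e(1,3,4) E] GE by simp
  have "emeasure \<rho> ?G = emeasure \<rho> ?G'"
    using measure_diff_preimage[OF r(1,3,4), of E] E r(2) sp GE by simp
  also have "\<dots> = (\<integral>\<^sup>+x. f x * indicator ?G' x \<partial>\<mu>)" by (rule rho) simp
  also have "\<dots> \<le> (\<integral>\<^sup>+x. indicator ?G' x \<partial>\<mu>)"
    by (rule nn_integral_mono) (auto simp: E_def indicator_def not_less)
  also have "\<dots> = emeasure \<mu> ?G" using mu_eq by simp
  finally have "(\<integral>\<^sup>+x. f x * indicator ?G x \<partial>\<mu>) \<le> (\<integral>\<^sup>+x. indicator ?G x \<partial>\<mu>)"
    using rho[of ?G] by simp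
  then have "AE x in \<mu>. f x * indicator ?G x \<le> indicator ?G x"
  proof (rule nn_integral_eq_AE_eq[rotated 3])
    show "AE x in \<mu>. indicator ?G x \<le> f x * indicator ?G x"
      by (rule AE_I2) (auto simp: E_def indicator_def)
    show "(\<integral>\<^sup>+x. indicator ?G x \<partial>\<mu>) < \<infinity>" by (simp add: mu.emeasure_eq_measure)
  qed measurable
  then have "AE x in \<mu>. x \<notin> ?G"
  proof eventually_elim
    case (elim x)
    show ?case
    proof
      assume x: "x \<in> ?G"
      then have "f x \<le> 1" using elim by simp
      then show False using x by (auto simp: E_def)
    qed
  qed
  then have "emeasure \<mu> ?G = 0" using AE_iff_measurable[of ?G \<mu> "\<lambda>x. x \<notin> ?G"]
    using sets.sets_into_space[OF E] by (auto simp: subset_iff)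
  then have null: "?G \<in> null_sets \<mu>" "?G' \<in> null_sets \<mu>" using mu_eq by (auto intro!: null_setsI)
  from AE_not_in[OF null(1)] AE_not_in[OF null(2)] have "AE x in \<mu>. S x \<in> E \<longleftrightarrow> x \<in> E" using AE_space by eventually_elim auto
  then have E01: "measure \<mu> E = 0 \<or> measure \<mu> E = 1" by (rule ergodic_AE_invariant[OF erg E])
  have one: "(\<integral>\<^sup>+x. f x \<partial>\<mu>) = 1"
  proof -
    have "(\<integral>\<^sup>+x. f x \<partial>\<mu>) = (\<integral>\<^sup>+x. f x * indicator (space \<mu>) x \<partial>\<mu>)"
      by (rule nn_integral_cong) simp
    then show ?thesis using rho[OF sets.top] rho.emeasure_space_1 sp by simp
  qed
  from E01 show ?thesis
  proof
    assume "measure \<mu> E = 0"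
    then have "AE x in \<mu>. x \<notin> E"
      using E by (intro AE_not_in) (auto intro!: null_setsI simp: mu.emeasure_eq_measure)
    then have le: "AE x in \<mu>. f x \<le> 1" using AE_space by eventually_elim (auto simp: E_def)
    have "AE x in \<mu>. 1 \<le> f x"
      by (rule nn_integral_eq_AE_eq) (use le one in \<open>auto simp: mu.emeasure_space_1\<close>)
    with le have "AE x in \<mu>. f x = 1" by eventually_elim auto
    then have "density \<mu> f = density \<mu> (\<lambda>_. 1)" by (intro density_cong) auto
    then show ?thesis using dens by (simp add: density_1)
  next
    assume "measure \<mu> E = 1"
    then have gt: "AE x in \<mu>. 1 < f x" using mu.AE_prob_1[of E] by (auto simp: E_def)
    have "AE x in \<mu>. f x \<le> 1"
      by (rule nn_integral_eq_AE_eq) (use gt one in \<open>auto simp: mu.emeasure_space_1\<close>)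
    with gt have "AE x in \<mu>. False" by eventually_elim auto
    then show ?thesis using mu.AE_False by simp
  qed
qed

text \<open>If \<open>\<mu>\<close> is none of the \<open>\<rho> i\<close>, then for each \<open>i\<close> some \<open>\<mu>\<close>-null set is not null for \<open>\<rho> i\<close>. Points returning to
  it form an invariant set, \<open>\<mu>\<close>-null and of full measure for \<open>\<rho> i\<close>. The complement of the union of these sets
  contradicts the domination.\<close>

theorem ergodic_dominated_by_family:
  assumes erg: "ergodic_measure T S \<mu>" and I: "finite I" and fam: "\<And>i. i \<in> I \<Longrightarrow> ergodic_measure T S (\<rho> i)"
    and dom: "\<And>A. A \<in> sets \<mu> \<Longrightarrow> (\<And>i. i \<in> I \<Longrightarrow> emeasure (\<rho> i) A = 0) \<Longrightarrow> emeasure \<mu> A = 0"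
  shows "\<exists>i\<in>I. \<rho> i = \<mu>"
proof (rule ccontr)
  assume neq: "\<not> ?thesis"
  note e = ergodic_measureD[OF erg]
  interpret mu: prob_space \<mu> by (rule e)
  have sets: "sets (\<rho> i) = sets \<mu>" if "i \<in> I" for i
    using ergodic_measureD(2)[OF fam[OF that]] e(2) by simp
  have "\<exists>R. R \<in> sets \<mu> \<and> emeasure \<mu> R = 0 \<and> measure (\<rho> i) R = 1" if i: "i \<in> I" for i
  proof -
    note ei = ergodic_measureD[OF fam[OF i]]
    interpret rho: prob_space "\<rho> i" by (rule ei)
    have sp: "space (\<rho> i) = space \<mu>" using sets[OF i] by (rule sets_eq_imp_space_eq)
    have "\<not> absolutely_continuous \<mu> (\<rho> i)"
      using ergodic_absolutely_continuous_eq[OF erg, of "\<rho> i"] fam[OF i] neq i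
      by (auto simp: ergodic_measure_def)
    then obtain B where B: "B \<in> null_sets \<mu>" "B \<notin> null_sets (\<rho> i)"
      by (auto simp: absolutely_continuous_def)
    then have Bs: "B \<in> sets \<mu>" "emeasure (\<rho> i) B \<noteq> 0" using sets[OF i] by auto
    then have pos: "measure (\<rho> i) B > 0"
      by (simp add: rho.emeasure_eq_measure zero_less_measure_iff)
    let ?R = "returning \<mu> S B"
    have "AE x in \<mu>. (S ^^ k) x \<notin> B" for k
    proof (induction k)
      case 0 then show ?case using AE_not_in[OF B(1)] by simp
    next
      case (Suc k)
      then have "AE x in distr \<mu> \<mu> S. (S ^^ k) x \<notin> B" unfolding e(4) .
      then have "AE x in \<mu>. (S ^^ k) (S x) \<notin> B" by (rule AE_distrD[OF e(3)])
      then show ?case by (simp add: funpow_swap1)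
    qed
    then have "AE x in \<mu>. \<forall>k. (S ^^ k) x \<notin> B" by (simp add: AE_all_countable)
    then have "AE x in \<mu>. x \<notin> ?R" by eventually_elim (auto simp: returning_def)
    moreover have Rs: "?R \<in> sets \<mu>" by (rule returning_sets[OF e(3) Bs(1)])
    ultimately have "emeasure \<mu> ?R = 0"
      using AE_iff_measurable[of ?R \<mu> "\<lambda>x. x \<notin> ?R"] sets.sets_into_space[OF Rs] by (auto simp: subset_iff)
    moreover have "returning (\<rho> i) S B = ?R" by (simp add: returning_def sp)
    then have "measure (\<rho> i) ?R = 1"
      using ergodic_returning[OF fam[OF i], of B] Bs pos sets[OF i] by simp
    ultimately show ?thesis using Rs by blast
  qed
  then obtain R where R: "\<And>i. i \<in> I \<Longrightarrow> R i \<in> sets \<mu>" "\<And>i. i \<in> I \<Longrightarrow> emeasure \<mu> (R i) = 0"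
    "\<And>i. i \<in> I \<Longrightarrow> measure (\<rho> i) (R i) = 1" by metis
  let ?A = "\<Union>i\<in>I. R i"
  have A: "?A \<in> sets \<mu>" using R I by auto
  have "?A \<in> null_sets \<mu>" using R I by (intro null_sets_UN') (auto intro: countable_finite)
  then have "emeasure \<mu> ?A = 0" by auto
  moreover have "emeasure \<mu> (space \<mu> - ?A) = 0"
  proof (rule dom)
    fix i assume i: "i \<in> I"
    interpret rho: prob_space "\<rho> i" by (rule ergodic_measureD[OF fam[OF i]])
    have sp: "space (\<rho> i) = space \<mu>" using sets[OF i] by (rule sets_eq_imp_space_eq)
    have "measure (\<rho> i) ?A \<ge> measure (\<rho> i) (R i)"
      by (rule rho.finite_measure_mono) (use i A sets[OF i] in auto)
    then have "measure (\<rho> i) ?A = 1" using R(3)[OF i] rho.prob_le_1[of ?A] by linarith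
    then show "emeasure (\<rho> i) (space \<mu> - ?A) = 0"
      using rho.prob_compl[of ?A] A sets[OF i] sp by (simp add: rho.emeasure_eq_measure)
  qed (use A in auto)
  moreover have "emeasure \<mu> (space \<mu>) \<le> emeasure \<mu> ?A + emeasure \<mu> (space \<mu> - ?A)"
  proof -
    have "?A \<union> (space \<mu> - ?A) = space \<mu>" using sets.sets_into_space[OF A] by auto
    then show ?thesis using emeasure_subadditive[of ?A \<mu> "space \<mu> - ?A"] A by simp
  qed
  ultimately show False by (simp add: mu.emeasure_space_1)
qed

section \<open>Topology of powers and doubly transitive points\<close>

lemma Hausdorff_shift_topology: "Hausdorff_space (shift_topology X)"
  unfolding full_topology_def
  by (intro Hausdorff_space_subtopology)
    (simp add: Hausdorff_space_product_topology Hausdorff_space_discrete_topology)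

lemma compact_shift_topology:
  assumes X: "shift_space X" shows "compact_space (shift_topology X)"
proof -
  obtain A where A: "finite A" "\<forall>x\<in>X. range x \<subseteq> A" using X by (auto simp: shift_space_def)
  have "compactin full_topology (Pi\<^sub>E UNIV (\<lambda>_. A))"
    unfolding full_topology_def compactin_PiE
    using A(1) by (simp add: finite_imp_compactin)
  moreover have "X \<subseteq> Pi\<^sub>E UNIV (\<lambda>_. A)" using A(2) by (auto simp: PiE_iff)
  ultimately have "compactin full_topology X"
    using X closed_compactin by (auto simp: shift_space_def)
  then show ?thesis by (rule compact_space_subtopology)
qed

lemma coordinate_clopen:
  "openin (shift_topology X) {x \<in> X. x i = a} \<and> closedin (shift_topology X) {x \<in> X. x i = a}"
proof -
  have cont: "continuous_map (shift_topology X) (discrete_topology UNIV) (\<lambda>x. x i)"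
    unfolding full_topology_def
    by (intro continuous_map_from_subtopology continuous_map_product_projection) simp
  have "openin (shift_topology X) {x \<in> topspace (shift_topology X). x i \<in> {a}}"
    using cont by (rule openin_continuous_map_preimage) simp
  moreover have "closedin (shift_topology X) {x \<in> topspace (shift_topology X). x i \<in> {a}}"
    using cont by (rule closedin_continuous_map_preimage) simp
  ultimately show ?thesis by simp
qed

lemma clopen_separation_shift:
  assumes X: "shift_space X" shows "\<exists>C. clopen_separation (shift_topology X) C"
proof -
  obtain A where A: "finite A" "\<forall>x\<in>X. range x \<subseteq> A" using X by (auto simp: shift_space_def)
  let ?C = "(\<lambda>(i, a). {x \<in> X. x i = a}) ` (UNIV \<times> A)"
  show ?thesis
  proof (rule clopen_separationI[of ?C])
    show "countable ?C" using A(1) by (intro countable_image countable_SIGMA) (auto intro: countable_finite)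
    show "openin (shift_topology X) C \<and> closedin (shift_topology X) C" if "C \<in> ?C" for C
      using that by (auto simp: coordinate_clopen)
    fix x y assume xy: "x \<in> topspace (shift_topology X)" "y \<in> topspace (shift_topology X)" "x \<noteq> y"
    then obtain i where "x i \<noteq> y i" by auto
    moreover have "x i \<in> A" using xy A(2) by auto
    ultimately show "\<exists>C\<in>?C. (x \<in> C) \<noteq> (y \<in> C)"
      using xy by (intro bexI[of _ "{z \<in> X. z i = x i}"]) auto
  qed
qed

lemma continuous_translate:
  assumes X: "shift_space X" shows "continuous_map (shift_topology X) (shift_topology X) (translate k)"
proof -
  have "continuous_map (shift_topology X) (product_topology (\<lambda>_. discrete_topology UNIV) UNIV) (translate k)"
    unfolding continuous_map_componentwise_UNIV
  proof
    fix i
    have "continuous_map (shift_topology X) (discrete_topology UNIV) (\<lambda>x. x (i + k))"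
      unfolding full_topology_def
      by (intro continuous_map_from_subtopology continuous_map_product_projection) simp
    then show "continuous_map (shift_topology X) (discrete_topology UNIV) (\<lambda>x. translate k x i)" by simp
  qed
  then show ?thesis
    using shift_space_translate[OF X] by (auto simp: continuous_map_in_subtopology full_topology_def[symmetric])
qed

lemma continuous_shift:
  "shift_space X \<Longrightarrow> continuous_map (shift_topology X) (shift_topology X) shift"
  using continuous_translate[of X 1] by (simp add: shift_eq_translate)

lemma topspace_power [simp]: "topspace (power_topology n X) = Pi\<^sub>E {..<n} (\<lambda>_. X)"
  by (simp add: power_topology_def)

lemma compact_power: "shift_space X \<Longrightarrow> compact_space (power_topology n X)"
  unfolding power_topology_def by (simp add: compact_space_product_topology compact_shift_topology)

lemma continuous_power_projection:
  "i < n \<Longrightarrow> continuous_map (power_topology n X) (shift_topology X) (\<lambda>x. x i)"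
  unfolding power_topology_def by (rule continuous_map_product_projection) simp

lemma clopen_separation_power:
  assumes X: "shift_space X" shows "\<exists>C. clopen_separation (power_topology n X) C"
proof -
  obtain A where A: "finite A" "\<forall>x\<in>X. range x \<subseteq> A" using X by (auto simp: shift_space_def)
  let ?Z = "Pi\<^sub>E {..<n} (\<lambda>_. X)"
  let ?C = "(\<lambda>(j, i, a). {x \<in> ?Z. x j i = a}) ` ({..<n} \<times> UNIV \<times> A)"
  show ?thesis
  proof (rule clopen_separationI[of ?C])
    show "countable ?C" using A(1) by (intro countable_image countable_SIGMA) (auto intro: countable_finite)
    show "openin (power_topology n X) C \<and> closedin (power_topology n X) C" if "C \<in> ?C" for C
    proof -
      obtain j i a where C: "j < n" "C = {x \<in> ?Z. x j i = a}" using \<open>C \<in> ?C\<close> by auto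
      have eq: "C = {x \<in> topspace (power_topology n X). x j \<in> {z \<in> X. z i = a}}"
        using C by (auto simp: PiE_iff)
      show ?thesis unfolding eq
        by (intro conjI openin_continuous_map_preimage[OF continuous_power_projection[OF C(1)]]
            closedin_continuous_map_preimage[OF continuous_power_projection[OF C(1)]]
            coordinate_clopen[THEN conjunct1] coordinate_clopen[THEN conjunct2])
    qed
    fix x y assume xy: "x \<in> topspace (power_topology n X)" "y \<in> topspace (power_topology n X)" "x \<noteq> y"
    then obtain j where j: "j < n" "x j \<noteq> y j"
      using PiE_ext[of x "{..<n}" "\<lambda>_. X" y] by auto
    then obtain i where "x j i \<noteq> y j i" by auto
    moreover have "x j i \<in> A" using xy j A(2) by (auto simp: PiE_iff)
    ultimately show "\<exists>C\<in>?C. (x \<in> C) \<noteq> (y \<in> C)"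
      using xy j by (intro bexI[of _ "{z \<in> ?Z. z j i = x j i}"])
        (auto intro!: image_eqI[of _ _ "(j, i, x j i)"])
  qed
qed

lemma continuous_diagonal_shift:
  assumes X: "shift_space X"
  shows "continuous_map (power_topology n X) (power_topology n X) (diagonal_shift n)"
  unfolding power_topology_def continuous_map_componentwise
proof (intro conjI ballI)
  show "diagonal_shift n ` topspace (product_topology (\<lambda>_. shift_topology X) {..<n}) \<subseteq> extensional {..<n}"
    by (auto simp: diagonal_shift_def)
  fix j assume j: "j \<in> {..<n}"
  have eq: "shift \<circ> (\<lambda>x. x j) = (\<lambda>x. diagonal_shift n x j)"
    using j by (auto simp: diagonal_shift_def)
  have "continuous_map (power_topology n X) (shift_topology X) (shift \<circ> (\<lambda>x. x j))"
    by (rule continuous_map_compose[OF continuous_power_projection continuous_shift[OF X]]) (use j in simp)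
  then show "continuous_map (product_topology (\<lambda>_. shift_topology X) {..<n}) (shift_topology X)
      (\<lambda>x. diagonal_shift n x j)" unfolding power_topology_def eq .
qed

lemma space_ergodic_on: "ergodic_on X \<mu> \<Longrightarrow> space \<mu> = X"
  using ergodic_measureD(2)[of "shift_topology X" shift \<mu>] sets_eq_imp_space_eq[of \<mu>]
  by (auto simp: ergodic_on_def)

lemma countable_language:
  assumes X: "shift_space X" shows "countable (language X)"
proof -
  obtain A where A: "finite A" "\<And>x i. x \<in> X \<Longrightarrow> x i \<in> A" using X by (force simp: shift_space_def)
  have "language X \<subseteq> lists A"
  proof
    fix w assume "w \<in> language X"
    then obtain x i where "x \<in> X" "word x i (length w) = w" by (auto simp: language_iff)
    moreover have "word x i n \<in> lists A" for n using A(2)[OF \<open>x \<in> X\<close>] by (auto simp: word_def)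
    ultimately show "w \<in> lists A" by metis
  qed
  moreover have "countable (lists A)" using A(1) by (intro countable_lists countable_finite)
  ultimately show ?thesis by (rule countable_subset)
qed

lemma translate_funpow: "(translate k ^^ n) x = translate (int n * k) x"
  by (induction n) (auto simp: algebra_simps)

text \<open>The points starting with a given word form an open set, of positive measure by full support, so almost every orbit
  returns to it infinitely often. Applying this to the inverse shift takes care of occurrences to the left.\<close>

theorem AE_doubly_transitive:
  assumes Y: "shift_space Y" and erg: "ergodic_on Y \<nu>" and supp: "fully_supported (shift_topology Y) \<nu>"
  shows "{y. doubly_transitive Y y} \<in> sets \<nu>" "AE y in \<nu>. doubly_transitive Y y"
proof -
  have erg': "ergodic_measure (shift_topology Y) shift \<nu>" using erg by (simp add: ergodic_on_def)
  note e = ergodic_measureD[OF erg']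
  interpret prob_space \<nu> by (rule e)
  have sp: "space \<nu> = Y" by (rule space_ergodic_on[OF erg])
  have S: "shift \<in> \<nu> \<rightarrow>\<^sub>M \<nu>" by (rule e)
  have tr: "translate k \<in> \<nu> \<rightarrow>\<^sub>M \<nu>" for k
    using continuous_map_borel[OF continuous_translate[OF Y]] e(2) by (simp cong: measurable_cong_sets)
  have inverse_pres: "distr \<nu> \<nu> (translate (-1)) = \<nu>"
  proof -
    have "distr \<nu> \<nu> (translate (-1)) = distr (distr \<nu> \<nu> shift) \<nu> (translate (-1))" using e(4) by simp
    also have "\<dots> = distr \<nu> \<nu> (translate (-1) \<circ> shift)" by (rule distr_distr[OF tr S])
    also have "translate (-1) \<circ> shift = (\<lambda>y. y)" by (auto simp: shift_eq_translate fun_eq_iff)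
    finally show ?thesis by (simp only: distr_id)
  qed
  define U where "U w = {y \<in> Y. word y 0 (length w) = w}" for w
  define Fw where "Fw w = returning \<nu> shift (U w)" for w
  define Bw where "Bw w = returning \<nu> (translate (-1)) (U w)" for w
  have U: "U w \<in> sets \<nu> \<and> measure \<nu> (U w) > 0" if w: "w \<in> language Y" for w
  proof -
    have "openin (shift_topology Y) ({y. word y 0 (length w) = w} \<inter> Y)"
      using openin_word by (rule openin_subtopology_Int)
    then have o: "openin (shift_topology Y) (U w)" by (simp add: U_def Int_def conj_commute)
    have "U w \<noteq> {}" using language_at[OF Y w, of 0] by (auto simp: U_def)
    then have "emeasure \<nu> (U w) > 0" using o supp by (auto simp: fully_supported_def)
    then show ?thesis using openin_borel[OF o] e(2) by (auto simp: emeasure_eq_measure)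
  qed
  have F: "Fw w \<in> sets \<nu> \<and> measure \<nu> (Fw w) = 1" if w: "w \<in> language Y" for w
    unfolding Fw_def using U[OF w] returning_sets[OF S] ergodic_returning[OF erg'] by blast
  have B: "Bw w \<in> sets \<nu> \<and> measure \<nu> (Bw w) = 1" if w: "w \<in> language Y" for w
  proof -
    have Bs: "Bw w \<in> sets \<nu>" unfolding Bw_def using U[OF w] returning_sets[OF tr] by blast
    have inv: "translate (-1) -` Bw w \<inter> Y = Bw w"
      unfolding Bw_def using returning_invariant[OF tr, of "-1" "U w"] sp by simp
    have "shift -` Bw w \<inter> Y = Bw w"
    proof (intro set_eqI iffI)
      fix y assume y: "y \<in> shift -` Bw w \<inter> Y"
      then have "shift y \<in> translate (-1) -` Bw w \<inter> Y" using inv by simp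
      then show "y \<in> Bw w" by (simp add: shift_eq_translate)
    next
      fix y assume y: "y \<in> Bw w"
      then have yY: "y \<in> Y" using inv by blast
      have "shift y \<in> Y" using measurable_space[OF S] yY sp by auto
      then have "shift y \<in> translate (-1) -` Bw w \<inter> Y" using y by (simp add: shift_eq_translate)
      then show "y \<in> shift -` Bw w \<inter> Y" using inv yY by simp
    qed
    then have "measure \<nu> (Bw w) = 0 \<or> measure \<nu> (Bw w) = 1" using e(5)[OF Bs] sp by simp
    moreover have "measure \<nu> (U w) \<le> measure \<nu> (Bw w)"
      unfolding Bw_def by (rule prob_returning[OF tr inverse_pres]) (use U[OF w] in blast)
    ultimately show ?thesis using Bs U[OF w] by auto
  qed
  have dt: "doubly_transitive Y y \<longleftrightarrow> (\<forall>w\<in>language Y. y \<in> Fw w \<and> y \<in> Bw w)" if y: "y \<in> Y" for y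
  proof -
    have "y \<in> Fw w \<longleftrightarrow> (\<forall>n. \<exists>i\<ge>n. word y i (length w) = w)" for w
    proof -
      have "y \<in> Fw w \<longleftrightarrow> (\<forall>n. \<exists>k\<ge>n. word y (int k) (length w) = w)"
        using y shift_space_translate[OF Y y]
        by (simp add: Fw_def returning_def sp U_def shift_eq_translate translate_funpow word_translate)
      also have "\<dots> \<longleftrightarrow> (\<forall>n. \<exists>i\<ge>n. word y i (length w) = w)"
      proof safe
        fix n :: int assume "\<forall>n. \<exists>k\<ge>n. word y (int k) (length w) = w"
        then obtain k where "k \<ge> nat n" "word y (int k) (length w) = w" by blast
        then show "\<exists>i\<ge>n. word y i (length w) = w" by (intro exI[of _ "int k"]) auto
      next
        fix n :: nat assume "\<forall>n. \<exists>i\<ge>n. word y i (length w) = w"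
        then obtain i where "i \<ge> int n" "word y i (length w) = w" by blast
        then show "\<exists>k\<ge>n. word y (int k) (length w) = w" by (intro exI[of _ "nat i"]) auto
      qed
      finally show ?thesis .
    qed
    moreover have "y \<in> Bw w \<longleftrightarrow> (\<forall>n. \<exists>i\<le>n. word y i (length w) = w)" for w
    proof -
      have "y \<in> Bw w \<longleftrightarrow> (\<forall>n. \<exists>k\<ge>n. word y (- int k) (length w) = w)"
        using y shift_space_translate[OF Y y]
        by (simp add: Bw_def returning_def sp U_def translate_funpow word_translate)
      also have "\<dots> \<longleftrightarrow> (\<forall>n. \<exists>i\<le>n. word y i (length w) = w)"
      proof safe
        fix n :: int assume "\<forall>n. \<exists>k\<ge>n. word y (- int k) (length w) = w"
        then obtain k where "k \<ge> nat (- n)" "word y (- int k) (length w) = w" by blast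
        then show "\<exists>i\<le>n. word y i (length w) = w" by (intro exI[of _ "- int k"]) auto
      next
        fix n :: nat assume "\<forall>n. \<exists>i\<le>n. word y i (length w) = w"
        then obtain i where "i \<le> - int n" "word y i (length w) = w" by blast
        then show "\<exists>k\<ge>n. word y (- int k) (length w) = w" by (intro exI[of _ "nat (- i)"]) auto
      qed
      finally show ?thesis .
    qed
    ultimately show ?thesis using y by (simp add: doubly_transitive_def occurs_at_word) blast
  qed
  have "{y. doubly_transitive Y y} = space \<nu> - (\<Union>w\<in>language Y. space \<nu> - Fw w \<inter> Bw w)"
    using dt sp by (auto simp: doubly_transitive_def)
  also have "\<dots> \<in> sets \<nu>"
    using F B by (intro sets.Diff sets.top sets.countable_UN'' countable_language[OF Y] sets.Int) auto
  finally show "{y. doubly_transitive Y y} \<in> sets \<nu>" .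
  have "AE y in \<nu>. y \<in> Fw w \<and> y \<in> Bw w" if w: "w \<in> language Y" for w
    using AE_prob_1[of "Fw w"] AE_prob_1[of "Bw w"] F[OF w] B[OF w] by auto
  then have "AE y in \<nu>. \<forall>w\<in>language Y. y \<in> Fw w \<and> y \<in> Bw w"
    by (simp add: AE_ball_countable[OF countable_language[OF Y]])
  then show "AE y in \<nu>. doubly_transitive Y y" using AE_space by eventually_elim (simp add: dt sp)
qed

section \<open>Existence of a degree joining\<close>

lemma shift_eq_iff: "shift a = shift b \<longleftrightarrow> a = b"
proof
  assume "shift a = shift b"
  then have "translate (-1) (shift a) = translate (-1) (shift b)" by simp
  then show "a = b" by (simp add: shift_eq_translate)
qed simp

text \<open>The setting of the measure-theoretic part: over an invariant set \<open>Y0\<close> of full measure all fibers have \<open>d\<close> points.\<close>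

locale constant_degree =
  fixes X :: "(int \<Rightarrow> 'a) set" and Y :: "(int \<Rightarrow> 'b) set" and \<pi> :: "(int \<Rightarrow> 'a) \<Rightarrow> (int \<Rightarrow> 'b)"
    and \<nu> :: "(int \<Rightarrow> 'b) measure" and d :: nat and Y0 :: "(int \<Rightarrow> 'b) set"
  assumes code: "factor_code \<pi> X Y" and ergodic: "ergodic_on Y \<nu>"
    and Y0_sets: "Y0 \<in> sets \<nu>" and AE_Y0: "AE y in \<nu>. y \<in> Y0"
    and Y0_shift: "y \<in> Y \<Longrightarrow> shift y \<in> Y0 \<longleftrightarrow> y \<in> Y0"
    and fiber_finite: "y \<in> Y0 \<Longrightarrow> finite (fiber \<pi> X y)"
    and fiber_card: "y \<in> Y0 \<Longrightarrow> card (fiber \<pi> X y) = d"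
begin

lemma X: "shift_space X" and Y: "shift_space Y" and onto: "\<pi> ` X = Y"
  and cont: "continuous_map (shift_topology X) (shift_topology Y) \<pi>"
  and equivariant: "x \<in> X \<Longrightarrow> \<pi> (shift x) = shift (\<pi> x)"
  using code by (auto simp: factor_code_def)

lemma nu: "ergodic_measure (shift_topology Y) shift \<nu>"
  using ergodic by (simp add: ergodic_on_def)

lemma sets_nu: "sets \<nu> = sets (borel_of (shift_topology Y))"
  by (rule ergodic_measureD[OF nu])

lemma space_nu: "space \<nu> = Y" by (rule space_ergodic_on[OF ergodic])

lemma borel_measurable_nu: "borel_measurable \<nu> = borel_measurable (borel_of (shift_topology Y))"
  by (rule measurable_cong_sets[OF sets_nu refl])

sublocale nu: prob_space \<nu> by (rule ergodic_measureD[OF nu])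

lemma Y0_subset: "Y0 \<subseteq> Y" using sets.sets_into_space[OF Y0_sets] space_nu by simp

lemma Y0_nonempty: "Y0 \<noteq> {}"
proof
  assume "Y0 = {}"
  then have "AE y in \<nu>. False" using AE_Y0 by simp
  then show False using nu.AE_False by simp
qed

lemma degree_positive: "d > 0"
proof -
  obtain y where y: "y \<in> Y0" using Y0_nonempty by auto
  then have "fiber \<pi> X y \<noteq> {}" using Y0_subset onto by (auto simp: fiber_def)
  then show ?thesis using fiber_card[OF y] fiber_finite[OF y] by (metis card_gt_0_iff)
qed

lemma pi_measurable: "\<pi> \<in> borel_of (shift_topology X) \<rightarrow>\<^sub>M borel_of (shift_topology Y)"
  by (rule continuous_map_borel[OF cont])

abbreviation (input) S where "S \<equiv> diagonal_shift d"
abbreviation (input) XX where "XX \<equiv> power_topology d X"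
abbreviation (input) BB where "BB \<equiv> borel_of XX"
abbreviation (input) BX where "BX \<equiv> borel_of (shift_topology X)"
abbreviation (input) BY where "BY \<equiv> borel_of (shift_topology Y)"

definition base :: "(nat \<Rightarrow> int \<Rightarrow> 'a) \<Rightarrow> int \<Rightarrow> 'b" where
  "base x = \<pi> (x 0)"

text \<open>The set \<open>X\<^sup>d\<^sub>\<pi>\<close> of tuples lying in a common fiber.\<close>

definition relative_power :: "(nat \<Rightarrow> int \<Rightarrow> 'a) set" where
  "relative_power = {x \<in> Pi\<^sub>E {..<d} (\<lambda>_. X). \<forall>i<d. \<forall>j<d. \<pi> (x i) = \<pi> (x j)}"

text \<open>Over \<open>Y0\<close> these tuples are the lists of all points of a fiber without repetition.\<close>

definition enumerations :: "(nat \<Rightarrow> int \<Rightarrow> 'a) set" where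
  "enumerations = {x \<in> relative_power. inj_on x {..<d}}"

lemma enumerationsD:
  assumes "x \<in> enumerations"
  shows "i < d \<Longrightarrow> x i \<in> X" "i < d \<Longrightarrow> j < d \<Longrightarrow> \<pi> (x i) = \<pi> (x j)" "inj_on x {..<d}"
  using assms unfolding enumerations_def relative_power_def by blast+

abbreviation tuples where "tuples \<equiv> fiber base relative_power"

abbreviation count where "count \<equiv> fiber_count base relative_power"

lemma projection: "i < d \<Longrightarrow> (\<lambda>x. x i) \<in> BB \<rightarrow>\<^sub>M BX"
  by (rule continuous_map_borel[OF continuous_power_projection])

lemma S_measurable: "S \<in> BB \<rightarrow>\<^sub>M BB"
  by (rule continuous_map_borel[OF continuous_diagonal_shift[OF X]])

lemma continuous_pi_projection:
  "i < d \<Longrightarrow> continuous_map XX (shift_topology Y) (\<lambda>x. \<pi> (x i))"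
  using continuous_map_compose[OF continuous_power_projection cont] by (simp add: o_def)

lemma closed_relative_power: "closedin XX relative_power"
proof -
  let ?I = "\<Inter>(i, j)\<in>{..<d} \<times> {..<d}. {x \<in> topspace XX. \<pi> (x i) = \<pi> (x j)}"
  have "closedin XX {x \<in> topspace XX. \<pi> (x i) = \<pi> (x j)}" if "i < d" "j < d" for i j
    using closedin_continuous_maps_eq[OF Hausdorff_shift_topology continuous_pi_projection[OF that(1)]
        continuous_pi_projection[OF that(2)]] .
  then have "closedin XX ?I"
    using degree_positive
    by (intro closedin_INT) (auto simp del: topspace_power)
  also have "?I = relative_power"
    using degree_positive by (auto simp: relative_power_def)
  finally show ?thesis .
qed

lemma enumerations_sets: "enumerations \<in> sets BB"
proof -
  let ?U = "\<Union>(i, j)\<in>{(i, j). i < d \<and> j < d \<and> i \<noteq> j}. {x \<in> topspace XX. x i = x j}"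
  have "closedin XX {x \<in> topspace XX. x i = x j}" if "i < d" "j < d" for i j
    using closedin_continuous_maps_eq[OF Hausdorff_shift_topology continuous_power_projection[OF that(1)]
        continuous_power_projection[OF that(2)]] .
  then have "?U \<in> sets BB"
    by (intro sets.countable_UN'') (auto intro: closedin_borel)
  then have "relative_power - ?U \<in> sets BB"
    using closedin_borel[OF closed_relative_power] by auto
  also have "relative_power - ?U = enumerations"
    by (auto simp: enumerations_def relative_power_def inj_on_def)
  finally show ?thesis .
qed

lemma fiber_base_iff:
  "x \<in> tuples y \<longleftrightarrow> x \<in> extensional {..<d} \<and> (\<forall>i<d. x i \<in> X \<and> \<pi> (x i) = y)"
  using degree_positive by (auto simp: fiber_def base_def relative_power_def PiE_iff)

lemma fiber_base_subset: "tuples y \<subseteq> Pi\<^sub>E {..<d} (\<lambda>_. fiber \<pi> X y)"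
  by (intro subsetI) (simp only: fiber_base_iff PiE_iff, simp add: fiber_def)

lemma finite_fiber_base: "y \<in> Y0 \<Longrightarrow> finite (tuples y)"
  by (rule finite_subset[OF fiber_base_subset]) (intro finite_PiE fiber_finite finite_lessThan)

lemma count_measurable:
  assumes "A \<in> sets BB" shows "(\<lambda>y. indicator Y0 y * count A y) \<in> borel_measurable \<nu>"
proof -
  obtain C where C: "clopen_separation XX C" using clopen_separation_power[OF X] by blast
  have "continuous_map XX (shift_topology Y) base"
    unfolding base_def[abs_def] by (rule continuous_pi_projection[OF degree_positive])
  then have "continuous_map (subtopology XX relative_power) (shift_topology Y) base"
    by (rule continuous_map_from_subtopology)
  then show ?thesis
    unfolding borel_measurable_nu
    by (rule fiber_count_measurable[OF compact_power[OF X] C Hausdorff_shift_topology closed_relative_power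
          _ _ finite_fiber_base assms]) (use Y0_sets sets_nu in simp)
qed

lemma S_bij: "bij_betw S (tuples y) (tuples (shift y))"
proof (rule bij_betwI[where g = "\<lambda>x. \<lambda>i\<in>{..<d}. translate (-1) (x i)"])
  show "S \<in> tuples y \<rightarrow> tuples (shift y)"
  proof
    fix x assume x: "x \<in> tuples y"
    have "shift (x i) \<in> X \<and> \<pi> (shift (x i)) = shift y" if "i < d" for i
      using x that equivariant[of "x i"] shift_space_translate[OF X, of "x i" 1]
      by (simp add: fiber_base_iff shift_eq_translate)
    then show "S x \<in> tuples (shift y)"
      by (simp add: fiber_base_iff diagonal_shift_def)
  qed
  show "(\<lambda>x. \<lambda>i\<in>{..<d}. translate (-1) (x i)) \<in> tuples (shift y) \<rightarrow> tuples y"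
  proof
    fix x assume x: "x \<in> tuples (shift y)"
    have "translate (-1) (x i) \<in> X \<and> \<pi> (translate (-1) (x i)) = y" if i: "i < d" for i
    proof -
      have xi: "x i \<in> X" "\<pi> (x i) = translate 1 y" using x i by (simp_all add: fiber_base_iff shift_eq_translate)
      have "\<pi> (translate (-1) (x i)) = translate (-1) (translate 1 y)"
        using factor_code_translate[OF code xi(1), of "-1"] unfolding xi(2) .
      then show ?thesis using shift_space_translate[OF X xi(1)] by simp
    qed
    then show "(\<lambda>i\<in>{..<d}. translate (-1) (x i)) \<in> tuples y"
      by (simp add: fiber_base_iff)
  qed
next
  fix x assume "x \<in> tuples y"
  then have x: "x \<in> extensional {..<d}" by (simp add: fiber_base_iff)
  show "(\<lambda>i\<in>{..<d}. translate (-1) (S x i)) = x"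
  proof (rule extensionalityI[OF restrict_extensional x])
    fix i assume "i \<in> {..<d}"
    then show "(\<lambda>i\<in>{..<d}. translate (-1) (S x i)) i = x i"
      by (simp add: diagonal_shift_def shift_eq_translate)
  qed
next
  fix x assume "x \<in> tuples (shift y)"
  then have x: "x \<in> extensional {..<d}" by (simp add: fiber_base_iff)
  show "S (\<lambda>i\<in>{..<d}. translate (-1) (x i)) = x"
    unfolding diagonal_shift_def
  proof (rule extensionalityI[OF restrict_extensional x])
    fix i assume "i \<in> {..<d}"
    then show "(\<lambda>i\<in>{..<d}. shift ((\<lambda>i\<in>{..<d}. translate (-1) (x i)) i)) i = x i"
      by (simp add: shift_eq_translate)
  qed
qed

text \<open>The diagonal shift maps the tuples over \<open>y\<close> bijectively to those over \<open>shift y\<close>.\<close>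

lemma count_shift: "count (S -` A \<inter> topspace XX) y = count A (shift y)"
proof -
  have "count A (shift y) = (\<Sum>x\<in>tuples y. indicator A (S x))"
    unfolding fiber_count_def by (rule sum.reindex_bij_betw[OF S_bij, symmetric])
  also have "\<dots> = count (S -` A \<inter> topspace XX) y"
    unfolding fiber_count_def
    by (rule sum.cong) (auto simp: fiber_def relative_power_def indicator_def)
  finally show ?thesis by simp
qed

lemma count_enumerations: "y \<in> Y0 \<Longrightarrow> count enumerations y \<ge> 1"
proof -
  assume y: "y \<in> Y0"
  obtain f where f: "bij_betw f {..<d} (fiber \<pi> X y)"
    using ex_bij_betw_nat_finite[OF fiber_finite[OF y]] fiber_card[OF y] by (auto simp: atLeast0LessThan)
  let ?x = "restrict f {..<d}"
  have "f i \<in> fiber \<pi> X y" if "i < d" for i using f that by (auto simp: bij_betw_def)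
  moreover have "inj_on f {..<d}" using f by (auto simp: bij_betw_def)
  ultimately have "?x \<in> tuples y \<inter> enumerations"
    using degree_positive
    by (auto simp: fiber_def base_def relative_power_def enumerations_def inj_on_def)
  then have "card (tuples y \<inter> enumerations) \<ge> 1"
    using finite_fiber_base[OF y] by (metis One_nat_def Suc_leI card_gt_0_iff empty_iff finite_Int)
  then show ?thesis
    by (simp add: fiber_count_card[OF finite_fiber_base[OF y]])
qed

text \<open>The count is an invariant function on \<open>Y\<close> with values in the natural numbers.\<close>

lemma count_constant:
  assumes A: "A \<in> sets BB" and inv: "S -` A \<inter> topspace XX = A"
  shows "\<exists>c::nat. AE y in \<nu>. count A y = of_nat c"
proof -
  let ?g = "\<lambda>y. indicator Y0 y * count A y"
  let ?L = "\<lambda>c::nat. {y \<in> space \<nu>. ?g y = of_nat c}"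
  have L: "?L c \<in> sets \<nu>" for c
  proof -
    have "?g -` {of_nat c} \<inter> space \<nu> \<in> sets \<nu>"
      by (rule measurable_sets[OF count_measurable[OF A]]) simp
    then show ?thesis by (simp add: vimage_def Int_def conj_commute)
  qed
  have "count A (shift y) = count A y" for y using count_shift[of A y] inv by simp
  then have gs: "?g (shift y) = ?g y" if "y \<in> Y" for y
    using Y0_shift[OF that] by (simp add: indicator_def)
  have "shift -` ?L c \<inter> space \<nu> = ?L c" for c
    using gs measurable_space[OF ergodic_measureD(3)[OF nu]] by (auto simp: space_nu)
  then have zo: "measure \<nu> (?L c) = 0 \<or> measure \<nu> (?L c) = 1" for c
    using ergodic_measureD(5)[OF nu L] by blast
  have "\<exists>c. measure \<nu> (?L c) = 1"
  proof (rule ccontr)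
    assume "\<not> ?thesis"
    then have "measure \<nu> (?L c) = 0" for c using zo by blast
    then have "AE y in \<nu>. y \<notin> ?L c" for c
      using L by (intro AE_not_in) (auto intro!: null_setsI simp: nu.emeasure_eq_measure)
    then have "AE y in \<nu>. \<forall>c. y \<notin> ?L c" by (simp add: AE_all_countable)
    with AE_Y0 AE_space have "AE y in \<nu>. False"
    proof eventually_elim
      case (elim y)
      have "?g y = of_nat (card (tuples y \<inter> A))"
        using elim fiber_count_card[OF finite_fiber_base[OF elim(1)]] by simp
      then show False using elim by blast
    qed
    then show False using nu.AE_False by simp
  qed
  then obtain c where "measure \<nu> (?L c) = 1" by blast
  then have "AE y in \<nu>. y \<in> ?L c" using nu.AE_prob_1 L by blast
  with AE_Y0 have "AE y in \<nu>. count A y = of_nat c" by eventually_elim auto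
  then show ?thesis by blast
qed

text \<open>The total mass is one if \<open>A\<close> has \<open>c\<close> points in almost every fiber.\<close>

definition counting_measure :: "(nat \<Rightarrow> int \<Rightarrow> 'a) set \<Rightarrow> nat \<Rightarrow> (nat \<Rightarrow> int \<Rightarrow> 'a) measure" where
  "counting_measure A c = measure_of (topspace XX) (sets BB)
     (\<lambda>B. \<integral>\<^sup>+y. indicator Y0 y * count (A \<inter> B) y * inverse (of_nat c) \<partial>\<nu>)"

lemma sets_counting: "sets (counting_measure A c) = sets BB"
  unfolding counting_measure_def
  using sets.space_closed[of BB] sets.sigma_sets_eq[of BB] by (simp add: sets_measure_of)

lemma space_counting: "space (counting_measure A c) = topspace XX"
  using sets_eq_imp_space_eq[OF sets_counting] by simp

lemma emeasure_counting:
  assumes A: "A \<in> sets BB" and B: "B \<in> sets BB"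
  shows "emeasure (counting_measure A c) B =
    (\<integral>\<^sup>+y. indicator Y0 y * count (A \<inter> B) y * inverse (of_nat c) \<partial>\<nu>)"
proof (rule emeasure_measure_of[OF counting_measure_def])
  let ?m = "\<lambda>B. \<integral>\<^sup>+y. indicator Y0 y * count (A \<inter> B) y * inverse (of_nat c) \<partial>\<nu>"
  show "sets BB \<subseteq> Pow (topspace XX)" using sets.space_closed[of BB] by simp
  show "B \<in> sets (counting_measure A c)" using B sets_counting by simp
  show "positive (sets (counting_measure A c)) ?m"
    by (simp add: positive_def fiber_count_def)
  show "countably_additive (sets (counting_measure A c)) ?m"
  proof (rule countably_additiveI)
    fix F :: "nat \<Rightarrow> (nat \<Rightarrow> int \<Rightarrow> 'a) set"
    assume F: "range F \<subseteq> sets (counting_measure A c)" "disjoint_family F"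
    then have Fs: "A \<inter> F i \<in> sets BB" for i using A sets_counting by auto
    have "disjoint_family (\<lambda>i. A \<inter> F i)" using F(2) by (auto simp: disjoint_family_on_def)
    then have eq: "count (A \<inter> (\<Union>i. F i)) y = (\<Sum>i. count (A \<inter> F i) y)" for y
      unfolding Int_UN_distrib by (rule fiber_count_Union)
    have "(\<Sum>i. \<integral>\<^sup>+y. indicator Y0 y * count (A \<inter> F i) y * inverse (of_nat c) \<partial>\<nu>) =
      (\<integral>\<^sup>+y. (\<Sum>i. indicator Y0 y * count (A \<inter> F i) y * inverse (of_nat c)) \<partial>\<nu>)"
      by (rule nn_integral_suminf[symmetric])
        (intro borel_measurable_times_ennreal count_measurable Fs borel_measurable_const)
    also have "\<dots> = (\<integral>\<^sup>+y. indicator Y0 y * count (A \<inter> (\<Union>i. F i)) y * inverse (of_nat c) \<partial>\<nu>)"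
      by (rule nn_integral_cong) (simp add: eq ennreal_suminf_cmult ennreal_suminf_multc)
    finally show "(\<Sum>i. ?m (F i)) = ?m (\<Union>i. F i)" .
  qed
qed

lemma enumerations_invariant: "S -` enumerations \<inter> topspace XX = enumerations"
proof -
  have iff: "S x \<in> enumerations \<longleftrightarrow> x \<in> enumerations" if x: "x \<in> Pi\<^sub>E {..<d} (\<lambda>_. X)" for x
  proof -
    have Sx: "S x i = shift (x i)" if "i < d" for i using that by (simp add: diagonal_shift_def)
    have xX: "x i \<in> X" if "i < d" for i using x that by auto
    have "S x \<in> Pi\<^sub>E {..<d} (\<lambda>_. X)"
      using xX shift_space_translate[OF X, of _ 1] by (simp add: diagonal_shift_def shift_eq_translate)
    moreover have "\<pi> (S x i) = \<pi> (S x j) \<longleftrightarrow> \<pi> (x i) = \<pi> (x j)" if "i < d" "j < d" for i j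
      using that by (simp add: Sx xX equivariant shift_eq_iff)
    moreover have "inj_on (S x) {..<d} \<longleftrightarrow> inj_on (\<lambda>i. shift (x i)) {..<d}"
      by (rule inj_on_cong) (simp add: Sx)
    moreover have "\<dots> \<longleftrightarrow> inj_on x {..<d}" by (simp add: inj_on_def shift_eq_iff)
    ultimately show ?thesis using x by (simp add: enumerations_def relative_power_def)
  qed
  show ?thesis
  proof (intro set_eqI iffI)
    fix x assume "x \<in> S -` enumerations \<inter> topspace XX"
    then show "x \<in> enumerations" using iff[of x] by simp
  next
    fix x assume x: "x \<in> enumerations"
    then have "x \<in> Pi\<^sub>E {..<d} (\<lambda>_. X)" by (simp add: enumerations_def relative_power_def)
    then show "x \<in> S -` enumerations \<inter> topspace XX" using iff[of x] x by simp
  qed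
qed

text \<open>An invariant set of enumerations with the least positive number of points in a fiber. Its invariant
  subsets meet almost every fiber in nothing or in everything that it contains there.\<close>

lemma minimal_sheet_exists:
  obtains A and c :: nat where "A \<in> sets BB" "A \<subseteq> enumerations" "S -` A \<inter> topspace XX = A" "c > 0"
    "AE y in \<nu>. count A y = of_nat c"
    "\<forall>B c'. B \<in> sets BB \<longrightarrow> B \<subseteq> A \<longrightarrow> S -` B \<inter> topspace XX = B \<longrightarrow>
        (AE y in \<nu>. count B y = of_nat c') \<longrightarrow> c' = 0 \<or> c' = c"
proof -
  define Q where "Q c \<longleftrightarrow> c > 0 \<and> (\<exists>A. A \<in> sets BB \<and> A \<subseteq> enumerations \<and> S -` A \<inter> topspace XX = A \<and>
     (AE y in \<nu>. count A y = of_nat c))" for c :: nat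
  obtain c0 :: nat where c0: "AE y in \<nu>. count enumerations y = of_nat c0"
    using count_constant[OF enumerations_sets enumerations_invariant] by blast
  have "c0 > 0"
  proof (rule ccontr)
    assume z: "\<not> c0 > 0"
    from c0 AE_Y0 have "AE y in \<nu>. False"
    proof eventually_elim
      case (elim y)
      then show False using count_enumerations[OF elim(2)] z by simp
    qed
    then show False using nu.AE_False by simp
  qed
  then have "Q c0"
    unfolding Q_def using enumerations_sets enumerations_invariant c0 by blast
  define c where "c = (LEAST c. Q c)"
  have Q: "Q c" unfolding c_def using \<open>Q c0\<close> by (rule LeastI)
  obtain A where A: "A \<in> sets BB" "A \<subseteq> enumerations" "S -` A \<inter> topspace XX = A"
    "AE y in \<nu>. count A y = of_nat c" and c: "c > 0"
    using Q unfolding Q_def by (elim conjE exE)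
  have minimal: "c' = 0 \<or> c' = c"
    if B: "B \<in> sets BB" "B \<subseteq> A" "S -` B \<inter> topspace XX = B" "AE y in \<nu>. count B y = of_nat c'" for B c'
  proof (rule ccontr)
    assume n: "\<not> ?thesis"
    then have "c' > 0" by simp
    moreover have "B \<subseteq> enumerations" using B(2) A(2) by (rule subset_trans)
    ultimately have "Q c'" unfolding Q_def using B(1,3,4) by (intro conjI exI[of _ B])
    then have "c \<le> c'" unfolding c_def by (rule Least_le)
    moreover from B(4) A(4) AE_Y0 have "AE y in \<nu>. c' \<le> c"
    proof eventually_elim
      case (elim y)
      have "(of_nat c' :: ennreal) \<le> of_nat c"
        unfolding elim(1)[symmetric] elim(2)[symmetric] fiber_count_def
        using B(2) by (intro sum_mono) (auto simp: indicator_def)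
      then show ?case by simp
    qed
    then have "c' \<le> c" by simp
    ultimately show False using n by simp
  qed
  then show ?thesis by (intro that[OF A(1-3) c A(4)] allI impI)
qed

text \<open>The normalized counting measure on a minimal invariant set of enumerations is a degree joining.\<close>

theorem degree_joining_exists:
  assumes deg: "degree_code \<pi> X Y = d"
  shows "\<exists>\<Lambda>. degree_joining \<pi> X Y \<nu> \<Lambda>"
proof -
  obtain A and c :: nat where A: "A \<in> sets BB" and AW: "A \<subseteq> enumerations"
    and inv: "S -` A \<inter> topspace XX = A" and c: "c > 0" and AE_A: "AE y in \<nu>. count A y = of_nat c"
    and min: "\<forall>B c'. B \<in> sets BB \<longrightarrow> B \<subseteq> A \<longrightarrow> S -` B \<inter> topspace XX = B \<longrightarrow>
        (AE y in \<nu>. count B y = of_nat c') \<longrightarrow> c' = 0 \<or> c' = c"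
    by (rule minimal_sheet_exists) (rule that; assumption)
  define \<Lambda> where "\<Lambda> = counting_measure A c"
  have sets: "sets \<Lambda> = sets BB" and sp: "space \<Lambda> = topspace XX"
    by (simp_all add: \<Lambda>_def sets_counting space_counting)
  note em = emeasure_counting[OF A, of _ c, folded \<Lambda>_def]
  have "of_nat c / of_nat c = (1::ennreal)" using c by (intro ennreal_divide_self) (auto simp: of_nat_less_top ennreal_of_nat_neq_top)
  then have cc: "of_nat c * inverse (of_nat c) = (1::ennreal)" by (simp only: divide_ennreal_def)
  \<comment> \<open>Sets that are unions of fibers within \<open>A\<close> have the measure of their base.\<close>
  have full: "emeasure \<Lambda> B = emeasure \<nu> C"
    if B: "B \<in> sets BB" and C: "C \<in> sets \<nu>" and eq: "\<And>y x. y \<in> Y0 \<Longrightarrow> x \<in> A \<Longrightarrow> base x = y \<Longrightarrow> x \<in> B \<longleftrightarrow> y \<in> C" for B C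
  proof -
    have "emeasure \<Lambda> B = (\<integral>\<^sup>+y. indicator Y0 y * count (A \<inter> B) y * inverse (of_nat c) \<partial>\<nu>)" by (rule em[OF B])
    also have "\<dots> = (\<integral>\<^sup>+y. indicator C y \<partial>\<nu>)"
    proof (rule nn_integral_cong_AE)
      from AE_A AE_Y0 show "AE y in \<nu>. indicator Y0 y * count (A \<inter> B) y * inverse (of_nat c) = indicator C y"
      proof eventually_elim
        case (elim y)
        have "count (A \<inter> B) y = indicator C y * count A y"
          unfolding fiber_count_def sum_distrib_left
          using eq[OF elim(2)] by (intro sum.cong) (auto simp: indicator_def fiber_def)
        then show ?case using elim cc by (simp add: mult.assoc)
      qed
    qed
    also have "\<dots> = emeasure \<nu> C" using C by simp
    finally show ?thesis .
  qed
  \<comment> \<open>Total mass, concentration on enumerations and the projection to \<open>\<nu>\<close> are instances of \<open>full\<close>.\<close>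
  have "emeasure \<Lambda> (topspace XX) = emeasure \<nu> (space \<nu>)"
  proof (rule full)
    show "topspace XX \<in> sets BB" using sets.top[of BB] by simp
    fix y x assume "y \<in> Y0" "x \<in> A"
    then show "x \<in> topspace XX \<longleftrightarrow> y \<in> space \<nu>"
      using sets.sets_into_space[OF A] Y0_subset space_nu by auto
  qed (rule sets.top)
  then have prob: "prob_space \<Lambda>" by (intro prob_spaceI) (simp only: sp nu.emeasure_space_1)
  interpret prob_space \<Lambda> by (rule prob)
  have S: "S \<in> \<Lambda> \<rightarrow>\<^sub>M \<Lambda>" unfolding measurable_cong_sets[OF sets sets] by (rule S_measurable)
  have pres: "distr \<Lambda> \<Lambda> S = \<Lambda>"
  proof (rule measure_eqI)
    fix B assume "B \<in> sets (distr \<Lambda> \<Lambda> S)"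
    then have B: "B \<in> sets BB" using sets by simp
    let ?g = "\<lambda>y. indicator Y0 y * count (A \<inter> B) y * inverse (of_nat c)"
    have g: "?g \<in> borel_measurable \<nu>"
      by (rule borel_measurable_times_ennreal[OF count_measurable[OF sets.Int[OF A B]] borel_measurable_const])
    have SB: "S -` B \<inter> topspace XX \<in> sets BB" using measurable_sets[OF S_measurable B] by simp
    have "emeasure (distr \<Lambda> \<Lambda> S) B = emeasure \<Lambda> (S -` B \<inter> topspace XX)"
      using S B sets sp by (simp add: emeasure_distr)
    also have "\<dots> = (\<integral>\<^sup>+y. indicator Y0 y * count (A \<inter> (S -` B \<inter> topspace XX)) y * inverse (of_nat c) \<partial>\<nu>)"
      by (rule em[OF SB])
    also have "\<dots> = (\<integral>\<^sup>+y. ?g (shift y) \<partial>\<nu>)"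
    proof (rule nn_integral_cong)
      fix y assume "y \<in> space \<nu>"
      then have i: "indicator Y0 (shift y) = (indicator Y0 y :: ennreal)"
        using Y0_shift[of y] by (simp add: indicator_def space_nu)
      have "A \<inter> (S -` B \<inter> topspace XX) = S -` (A \<inter> B) \<inter> topspace XX" using inv by auto
      then show "indicator Y0 y * count (A \<inter> (S -` B \<inter> topspace XX)) y * inverse (of_nat c) = ?g (shift y)"
        using count_shift[of "A \<inter> B" y] i by simp
    qed
    also have "\<dots> = (\<integral>\<^sup>+y. ?g y \<partial>distr \<nu> \<nu> shift)"
      using nn_integral_distr[OF ergodic_measureD(3)[OF nu], of ?g] g by simp
    also have "\<dots> = emeasure \<Lambda> B" using em[OF B] ergodic_measureD(4)[OF nu] by simp
    finally show "emeasure (distr \<Lambda> \<Lambda> S) B = emeasure \<Lambda> B" .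
  qed simp
  have invariant: "invariant_measure XX S \<Lambda>"
    using sets prob S pres by (simp add: invariant_measure_def borel_probability_def)
  have "measure \<Lambda> B = 0 \<or> measure \<Lambda> B = 1"
    if B: "B \<in> sets \<Lambda>" "S -` B \<inter> space \<Lambda> = B" for B
  proof -
    have AB: "A \<inter> B \<in> sets BB" "S -` (A \<inter> B) \<inter> topspace XX = A \<inter> B"
      using A B sets inv sp by auto
    obtain c' :: nat where c': "AE y in \<nu>. count (A \<inter> B) y = of_nat c'"
      using count_constant[OF AB] by blast
    then have "c' = 0 \<or> c' = c" using min[rule_format, OF AB(1) Int_lower1 AB(2)] by blast
    moreover have "emeasure \<Lambda> B = (\<integral>\<^sup>+y. of_nat c' * inverse (of_nat c) \<partial>\<nu>)"
    proof -
      have "AE y in \<nu>. indicator Y0 y * count (A \<inter> B) y * inverse (of_nat c) = of_nat c' * inverse (of_nat c)"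
        using c' AE_Y0 by eventually_elim simp
      then have "(\<integral>\<^sup>+y. indicator Y0 y * count (A \<inter> B) y * inverse (of_nat c) \<partial>\<nu>) =
          (\<integral>\<^sup>+y. of_nat c' * inverse (of_nat c) \<partial>\<nu>)"
        by (rule nn_integral_cong_AE)
      moreover have "B \<in> sets BB" using B(1) sets by simp
      ultimately show ?thesis using em by simp
    qed
    ultimately have "emeasure \<Lambda> B = 0 \<or> emeasure \<Lambda> B = 1"
      using cc by (auto simp: nu.emeasure_space_1)
    then show ?thesis by (auto simp: measure_def)
  qed
  then have erg: "ergodic_measure XX S \<Lambda>" using invariant by (simp add: ergodic_measure_def)
  have "emeasure \<Lambda> (topspace XX - enumerations) = emeasure \<nu> {}"
    by (rule full) (use AW enumerations_sets sets.compl_sets[OF enumerations_sets] in auto)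
  then have AE_W: "AE x in \<Lambda>. x \<in> enumerations"
    using sets.compl_sets[OF enumerations_sets] sets sp by (intro AE_I[of _ _ "topspace XX - enumerations"]) auto
  have m0: "(\<lambda>x. x 0) \<in> \<Lambda> \<rightarrow>\<^sub>M BX"
    unfolding measurable_cong_sets[OF sets refl] by (rule projection[OF degree_positive])
  have "push \<pi> Y (margin X 0 \<Lambda>) = distr \<Lambda> BY base"
    unfolding push_def margin_def base_def[abs_def]
    by (subst distr_distr[OF pi_measurable m0]) (simp add: o_def)
  also have "\<dots> = \<nu>"
  proof (rule measure_eqI)
    show "sets (distr \<Lambda> BY base) = sets \<nu>" by (simp add: sets_nu)
    fix C assume "C \<in> sets (distr \<Lambda> BY base)"
    then have C: "C \<in> sets BY" by simp
    have b: "base \<in> \<Lambda> \<rightarrow>\<^sub>M BY"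
      using measurable_compose[OF m0 pi_measurable] by (simp add: base_def[abs_def])
    have "emeasure (distr \<Lambda> BY base) C = emeasure \<Lambda> (base -` C \<inter> topspace XX)"
      using emeasure_distr[OF b C] sp by simp
    also have "\<dots> = emeasure \<nu> C"
      by (rule full)
        (use measurable_sets[OF b C] sets sp C sets_nu sets.sets_into_space[OF A] in auto)
    finally show "emeasure (distr \<Lambda> BY base) C = emeasure \<nu> C" .
  qed
  finally have push: "push \<pi> Y (margin X 0 \<Lambda>) = \<nu>" .
  have same: "AE x in \<Lambda>. \<forall>i<d. \<forall>j<d. \<pi> (x i) = \<pi> (x j)"
    using AE_W by eventually_elim (use enumerationsD(2) in blast)
  have "AE x in \<Lambda>. inj_on x {..<d}"
    using AE_W by eventually_elim (rule enumerationsD(3))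
  with same have "degree_joining \<pi> X Y \<nu> \<Lambda>"
    unfolding degree_joining_def Let_def deg relative_joining_over_def relative_joining_def separating_def
    using invariant erg push degree_positive by blast
  then show ?thesis by blast
qed

lemma degree_joiningD:
  assumes "degree_joining \<pi> X Y \<nu> \<Lambda>" and "degree_code \<pi> X Y = d"
  shows "ergodic_measure XX S \<Lambda>" "AE x in \<Lambda>. x \<in> enumerations"
    "\<exists>i<d. push \<pi> Y (margin X i \<Lambda>) = \<nu>"
proof -
  show erg: "ergodic_measure XX S \<Lambda>" and "\<exists>i<d. push \<pi> Y (margin X i \<Lambda>) = \<nu>"
    using assms by (simp_all add: degree_joining_def Let_def relative_joining_over_def)
  have sp: "space \<Lambda> = topspace XX"
    using sets_eq_imp_space_eq[OF ergodic_measureD(2)[OF erg]] by simp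
  have "AE x in \<Lambda>. \<forall>i<d. \<forall>j<d. \<pi> (x i) = \<pi> (x j)" "AE x in \<Lambda>. inj_on x {..<d}"
    using assms
    by (simp_all add: degree_joining_def Let_def relative_joining_over_def relative_joining_def separating_def)
  with AE_space[of \<Lambda>] show "AE x in \<Lambda>. x \<in> enumerations"
    by eventually_elim (unfold sp enumerations_def relative_power_def topspace_power, blast)
qed

section \<open>The margins of a degree joining\<close>

context
  fixes \<Lambda> assumes deg: "degree_code \<pi> X Y = d" and \<Lambda>: "degree_joining \<pi> X Y \<nu> \<Lambda>"
begin

lemma sets_joining: "sets \<Lambda> = sets BB"
  by (rule ergodic_measureD(2)[OF degree_joiningD(1)[OF \<Lambda> deg]])

lemma space_joining: "space \<Lambda> = topspace XX"
  using sets_eq_imp_space_eq[OF sets_joining] by simp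

lemma coordinate_measurable: "i < d \<Longrightarrow> (\<lambda>x. x i) \<in> \<Lambda> \<rightarrow>\<^sub>M BX"
  unfolding measurable_cong_sets[OF sets_joining refl] by (rule projection)

lemma push_margin:
  assumes i: "i < d"
  shows "push \<pi> Y (margin X i \<Lambda>) = distr \<Lambda> BY (\<lambda>x. \<pi> (x i))"
  unfolding push_def margin_def by (subst distr_distr[OF pi_measurable coordinate_measurable[OF i]]) (simp add: o_def)

lemma push_margin_nu:
  assumes i: "i < d" shows "push \<pi> Y (margin X i \<Lambda>) = \<nu>"
proof -
  obtain j where j: "j < d" "push \<pi> Y (margin X j \<Lambda>) = \<nu>" using degree_joiningD(3)[OF \<Lambda> deg] by blast
  have m: "(\<lambda>x. \<pi> (x i)) \<in> \<Lambda> \<rightarrow>\<^sub>M BY" if "i < d" for i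
    by (rule measurable_compose[OF coordinate_measurable[OF that] pi_measurable])
  have "AE x in \<Lambda>. \<pi> (x i) = \<pi> (x j)"
    using degree_joiningD(2)[OF \<Lambda> deg] by eventually_elim (use i j enumerationsD(2) in blast)
  then have "distr \<Lambda> BY (\<lambda>x. \<pi> (x i)) = distr \<Lambda> BY (\<lambda>x. \<pi> (x j))"
    by (intro distr_cong_AE m i j) auto
  then show ?thesis using push_margin[OF i] push_margin[OF j(1)] j(2) by simp
qed

lemma margin_lift:
  assumes i: "i < d" shows "margin X i \<Lambda> \<in> ergodic_lifts \<pi> X Y \<nu>"
proof -
  note e = ergodic_measureD[OF degree_joiningD(1)[OF \<Lambda> deg]]
  interpret L: prob_space \<Lambda> by (rule e)
  have M: "margin X i \<Lambda> = distr \<Lambda> BX (\<lambda>x. x i)" by (simp add: margin_def push_def)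
  note m = coordinate_measurable[OF i]
  have sets: "sets (margin X i \<Lambda>) = sets BX" by (simp add: M)
  have sh: "shift \<in> BX \<rightarrow>\<^sub>M BX" by (rule continuous_map_borel[OF continuous_shift[OF X]])
  have Sx: "S x i = shift (x i)" for x :: "nat \<Rightarrow> int \<Rightarrow> 'a" using i by (simp add: diagonal_shift_def)
  have shM: "shift \<in> margin X i \<Lambda> \<rightarrow>\<^sub>M margin X i \<Lambda>"
    unfolding measurable_cong_sets[OF sets sets] by (rule sh)
  have "distr (margin X i \<Lambda>) (margin X i \<Lambda>) shift = distr (margin X i \<Lambda>) BX shift"
    by (rule distr_cong) (simp_all add: sets)
  also have "\<dots> = distr \<Lambda> BX (\<lambda>x. shift (x i))"
    unfolding M by (subst distr_distr[OF sh m]) (simp add: o_def)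
  also have "\<dots> = distr (distr \<Lambda> \<Lambda> S) BX (\<lambda>x. x i)"
    by (subst distr_distr[OF m e(3)]) (simp add: o_def Sx)
  also have "\<dots> = margin X i \<Lambda>" unfolding e(4) M ..
  finally have pres: "distr (margin X i \<Lambda>) (margin X i \<Lambda>) shift = margin X i \<Lambda>" .
  have prob: "prob_space (margin X i \<Lambda>)" unfolding M by (rule L.prob_space_distr[OF m])
  have "measure (margin X i \<Lambda>) A = 0 \<or> measure (margin X i \<Lambda>) A = 1"
    if A: "A \<in> sets (margin X i \<Lambda>)" "shift -` A \<inter> space (margin X i \<Lambda>) = A" for A
  proof -
    let ?A = "(\<lambda>x. x i) -` A \<inter> space \<Lambda>"
    have AB: "A \<in> sets BX" using A(1) sets by simp
    have sA: "shift z \<in> A \<longleftrightarrow> z \<in> A" if "z \<in> X" for z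
      using A(2) that by (auto simp: M)
    have "S -` ?A \<inter> space \<Lambda> = ?A"
    proof (intro set_eqI)
      fix x
      show "x \<in> S -` ?A \<inter> space \<Lambda> \<longleftrightarrow> x \<in> ?A"
      proof (cases "x \<in> space \<Lambda>")
        case True
        then have "x i \<in> X" using i by (auto simp: space_joining)
        then show ?thesis using True sA[of "x i"] measurable_space[OF e(3) True] by (simp add: Sx)
      qed simp
    qed
    then have "measure \<Lambda> ?A = 0 \<or> measure \<Lambda> ?A = 1"
      using e(5) measurable_sets[OF m AB] by blast
    then show ?thesis unfolding M by (simp add: measure_distr[OF m AB])
  qed
  then have "ergodic_on X (margin X i \<Lambda>)"
    using sets prob shM pres
    by (simp add: ergodic_on_def ergodic_measure_def invariant_measure_def borel_probability_def)
  then show ?thesis using push_margin_nu[OF i] by (simp add: ergodic_lifts_def)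
qed

text \<open>If \<open>A\<close> is null for all margins, then almost every tuple avoids \<open>A\<close> in all its coordinates. As its coordinates
  exhaust a fiber, almost every fiber avoids \<open>A\<close>. The set \<open>Z\<close> of exceptional base points is measurable because it
  is described by the number of points of \<open>A\<close> in the fiber.\<close>

lemma margins_dominate:
  assumes \<mu>: "\<mu> \<in> ergodic_lifts \<pi> X Y \<nu>" and A: "A \<in> sets \<mu>"
    and null: "\<And>i. i < d \<Longrightarrow> emeasure (margin X i \<Lambda>) A = 0"
  shows "emeasure \<mu> A = 0"
proof -
  have erg: "ergodic_measure (shift_topology X) shift \<mu>" and push: "push \<pi> Y \<mu> = \<nu>"
    using \<mu> by (auto simp: ergodic_lifts_def ergodic_on_def)
  note e = ergodic_measureD[OF erg]
  have AB: "A \<in> sets BX" using A e(2) by simp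
  have sp: "space \<mu> = X" using sets_eq_imp_space_eq[OF e(2)] by simp
  obtain C where C: "clopen_separation (shift_topology X) C" using clopen_separation_shift[OF X] by blast
  have K: "closedin (shift_topology X) X" using closedin_topspace[of "shift_topology X"] by simp
  have c: "continuous_map (subtopology (shift_topology X) X) (shift_topology Y) \<pi>"
    using cont by (rule continuous_map_from_subtopology)
  let ?g = "\<lambda>y. indicator Y0 y * fiber_count \<pi> X A y"
  have g: "?g \<in> borel_measurable BY"
    by (rule fiber_count_measurable[OF compact_shift_topology[OF X] C Hausdorff_shift_topology K c _ fiber_finite AB])
      (use Y0_sets sets_nu in simp)
  define Z where "Z = {y \<in> space \<nu>. ?g y \<noteq> 0}"
  have Z: "Z \<in> sets \<nu>"
  proof -
    have "?g -` (- {0}) \<inter> space \<nu> \<in> sets \<nu>"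
      by (rule measurable_sets[of _ _ borel]) (use g in \<open>simp_all add: borel_measurable_nu\<close>)
    moreover have "?g -` (- {0}) \<inter> space \<nu> = Z" by (auto simp: Z_def)
    ultimately show ?thesis by simp
  qed
  have mem: "x \<notin> A" if "x \<in> X" "\<pi> x \<in> Y0" "\<pi> x \<notin> Z" for x
  proof
    assume "x \<in> A"
    then have "x \<in> fiber \<pi> X (\<pi> x) \<inter> A" using that by (simp add: fiber_def)
    then have "card (fiber \<pi> X (\<pi> x) \<inter> A) > 0"
      using fiber_finite[OF that(2)] by (auto simp: card_gt_0_iff)
    then have "?g (\<pi> x) \<noteq> 0" using that(2) fiber_count_card[OF fiber_finite[OF that(2)], of A] by simp
    then show False using that onto by (auto simp: Z_def space_nu)
  qed
  have m0: "(\<lambda>x. \<pi> (x 0)) \<in> \<Lambda> \<rightarrow>\<^sub>M BY"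
    by (rule measurable_compose[OF coordinate_measurable[OF degree_positive] pi_measurable])
  have D: "distr \<Lambda> BY (\<lambda>x. \<pi> (x 0)) = \<nu>"
    using push_margin[OF degree_positive] push_margin_nu[OF degree_positive] by simp
  have avoid: "AE x in \<Lambda>. x i \<notin> A" if i: "i < d" for i
  proof -
    have "A \<in> null_sets (distr \<Lambda> BX (\<lambda>x. x i))"
      using null[OF i] AB by (intro null_setsI) (simp_all add: margin_def push_def)
    from AE_distrD[OF coordinate_measurable[OF i] AE_not_in[OF this]] show ?thesis .
  qed
  have "AE x in \<Lambda>. \<forall>i\<in>{..<d}. x i \<notin> A"
    using avoid by (intro AE_finite_allI) auto
  moreover have "AE y in distr \<Lambda> BY (\<lambda>x. \<pi> (x 0)). y \<in> Y0"
    unfolding D by (rule AE_Y0)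
  then have "AE x in \<Lambda>. \<pi> (x 0) \<in> Y0" by (rule AE_distrD[OF m0])
  ultimately have "AE x in \<Lambda>. \<pi> (x 0) \<notin> Z"
    using degree_joiningD(2)[OF \<Lambda> deg]
  proof eventually_elim
    case (elim x)
    let ?F = "fiber \<pi> X (\<pi> (x 0))"
    have "x ` {..<d} = ?F"
    proof (rule card_subset_eq[OF fiber_finite[OF elim(2)]])
      show "x ` {..<d} \<subseteq> ?F"
      proof
        fix z assume "z \<in> x ` {..<d}"
        then obtain i where i: "i < d" "z = x i" by auto
        then show "z \<in> ?F"
          using enumerationsD(1)[OF elim(3) i(1)] enumerationsD(2)[OF elim(3) i(1) degree_positive]
          by (simp add: fiber_def)
      qed
      show "card (x ` {..<d}) = card ?F"
        using card_image[OF enumerationsD(3)[OF elim(3)]] by (simp add: fiber_card[OF elim(2)])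
    qed
    moreover have "x ` {..<d} \<inter> A = {}" using elim(1) by auto
    ultimately have "?F \<inter> A = {}" by simp
    then show ?case using fiber_count_card[OF fiber_finite[OF elim(2)], of A] by (simp add: Z_def)
  qed
  moreover have "{y \<in> space BY. y \<notin> Z} \<in> sets BY"
    using sets.compl_sets[of Z BY] Z sets_nu by (simp add: set_diff_eq)
  ultimately have "AE y in distr \<Lambda> BY (\<lambda>x. \<pi> (x 0)). y \<notin> Z"
    by (simp add: AE_distr_iff[OF m0])
  then have "AE y in \<nu>. y \<notin> Z" unfolding D .
  with AE_Y0 have "AE y in \<nu>. y \<in> Y0 \<and> y \<notin> Z" by eventually_elim simp
  then have "AE y in distr \<mu> BY \<pi>. y \<in> Y0 \<and> y \<notin> Z"
    unfolding push[unfolded push_def] .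
  then have "AE x in \<mu>. \<pi> x \<in> Y0 \<and> \<pi> x \<notin> Z"
    by (rule AE_distrD[rotated]) (use pi_measurable in \<open>simp add: measurable_cong_sets[OF e(2) refl]\<close>)
  with AE_space[of \<mu>] have "AE x in \<mu>. x \<notin> A" by eventually_elim (simp add: sp mem)
  then show ?thesis using AE_iff_measurable[of A \<mu> "\<lambda>x. x \<notin> A"] A sets.sets_into_space[OF A] by (auto simp: subset_iff)
qed

text \<open>An ergodic lift is dominated by the margins, which are ergodic, so it is one of them.\<close>

theorem ergodic_lifts_eq_margins: "ergodic_lifts \<pi> X Y \<nu> = (\<lambda>i. margin X i \<Lambda>) ` {..<d}"
proof
  show "(\<lambda>i. margin X i \<Lambda>) ` {..<d} \<subseteq> ergodic_lifts \<pi> X Y \<nu>" using margin_lift by auto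
  show "ergodic_lifts \<pi> X Y \<nu> \<subseteq> (\<lambda>i. margin X i \<Lambda>) ` {..<d}"
  proof
    fix \<mu> assume \<mu>: "\<mu> \<in> ergodic_lifts \<pi> X Y \<nu>"
    have "\<exists>i\<in>{..<d}. margin X i \<Lambda> = \<mu>"
    proof (rule ergodic_dominated_by_family)
      show "ergodic_measure (shift_topology X) shift \<mu>"
        using \<mu> by (simp add: ergodic_lifts_def ergodic_on_def)
      show "ergodic_measure (shift_topology X) shift (margin X i \<Lambda>)" if "i \<in> {..<d}" for i
        using margin_lift[of i] that by (simp add: ergodic_lifts_def ergodic_on_def)
      show "emeasure \<mu> A = 0" if "A \<in> sets \<mu>" "\<And>i. i \<in> {..<d} \<Longrightarrow> emeasure (margin X i \<Lambda>) A = 0" for A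
        using margins_dominate[OF \<mu> that(1)] that(2) by simp
    qed simp
    then show "\<mu> \<in> (\<lambda>i. margin X i \<Lambda>) ` {..<d}" by blast
  qed
qed

end

text \<open>All lifts \<open>\<mu>\<close> share the joining \<open>\<Lambda>\<close>, since it is chosen depending only on \<open>push \<pi> Y \<mu> = \<nu>\<close>.\<close>

theorem degree_sum:
  assumes deg: "degree_code \<pi> X Y = d"
  shows "finite (ergodic_lifts \<pi> X Y \<nu>) \<and>
    d = (\<Sum>\<mu>\<in>ergodic_lifts \<pi> X Y \<nu>. multiplicity_measure \<pi> X Y \<mu>)"
proof -
  define \<Lambda> where "\<Lambda> = (SOME \<Lambda>. degree_joining \<pi> X Y \<nu> \<Lambda>)"
  have \<Lambda>: "degree_joining \<pi> X Y \<nu> \<Lambda>"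
    unfolding \<Lambda>_def using degree_joining_exists[OF deg] by (rule someI_ex)
  note eq = ergodic_lifts_eq_margins[OF deg \<Lambda>]
  have "multiplicity_measure \<pi> X Y \<mu> = card {i \<in> {..<d}. margin X i \<Lambda> = \<mu>}"
    if "\<mu> \<in> ergodic_lifts \<pi> X Y \<nu>" for \<mu>
    using that by (simp add: multiplicity_measure_def Let_def ergodic_lifts_def deg \<Lambda>_def)
  then have "(\<Sum>\<mu>\<in>ergodic_lifts \<pi> X Y \<nu>. multiplicity_measure \<pi> X Y \<mu>) =
      (\<Sum>\<mu>\<in>ergodic_lifts \<pi> X Y \<nu>. card {i \<in> {..<d}. margin X i \<Lambda> = \<mu>})"
    by (rule sum.cong[OF refl])
  also have "\<dots> = (\<Sum>\<mu>\<in>(\<lambda>i. margin X i \<Lambda>) ` {..<d}. \<Sum>i\<in>{i \<in> {..<d}. margin X i \<Lambda> = \<mu>}. 1)"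
    by (simp add: eq)
  also have "\<dots> = (\<Sum>i\<in>{..<d}. 1)"
    by (rule sum.image_gen[symmetric]) simp
  finally show ?thesis by (simp add: eq)
qed

end

lemma doubly_transitive_shift:
  assumes Y: "shift_space Y" and y: "y \<in> Y"
  shows "doubly_transitive Y (shift y) \<longleftrightarrow> doubly_transitive Y y"
proof -
  have *: "doubly_transitive Y (translate k y)" if y: "doubly_transitive Y y" for k y
    unfolding doubly_transitive_def occurs_at_word word_translate
  proof (intro conjI ballI allI)
    show "translate k y \<in> Y" using y shift_space_translate[OF Y] by (simp add: doubly_transitive_def)
    fix w n assume w: "w \<in> language Y"
    obtain i where i: "i \<ge> n + k" "word y i (length w) = w"
      using y w unfolding doubly_transitive_def occurs_at_word by blast
    then show "\<exists>i\<ge>n. word y (i + k) (length w) = w" by (intro exI[of _ "i - k"]) simp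
    obtain j where j: "j \<le> n + k" "word y j (length w) = w"
      using y w unfolding doubly_transitive_def occurs_at_word by blast
    then show "\<exists>i\<le>n. word y (i + k) (length w) = w" by (intro exI[of _ "j - k"]) simp
  qed
  show ?thesis
  proof
    assume "doubly_transitive Y (shift y)"
    then have "doubly_transitive Y (translate (-1) (shift y))" by (rule *)
    then show "doubly_transitive Y y" by (simp add: shift_eq_translate)
  next
    assume "doubly_transitive Y y"
    then show "doubly_transitive Y (shift y)" unfolding shift_eq_translate by (rule *)
  qed
qed

theorem theorem5p1:
  fixes X :: "(int \<Rightarrow> 'a) set"
    and Y :: "(int \<Rightarrow> 'b) set"
    and \<pi> :: "(int \<Rightarrow> 'a) \<Rightarrow> (int \<Rightarrow> 'b)"
    and \<nu> :: "(int \<Rightarrow> 'b) measure"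
  assumes "sofic X"
    and "irreducible_shift X"
    and "factor_code \<pi> X Y"
    and "finite_to_one \<pi> X Y"
    and "ergodic_on Y \<nu>"
    and "fully_supported (shift_topology Y) \<nu>"
  shows "finite (ergodic_lifts \<pi> X Y \<nu>) \<and>
    degree_code \<pi> X Y = (\<Sum>\<mu>\<in>ergodic_lifts \<pi> X Y \<nu>. multiplicity_measure \<pi> X Y \<mu>)"
proof -
  have Y: "shift_space Y" and onto: "\<pi> ` X = Y" using assms(3) by (auto simp: factor_code_def)
  interpret nu: prob_space \<nu>
    using assms(5) ergodic_measureD(1) unfolding ergodic_on_def by blast
  note dt = AE_doubly_transitive[OF Y assms(5,6)]
  have ex: "\<exists>y. doubly_transitive Y y"
  proof (rule ccontr)
    assume "\<not> ?thesis"
    then have "AE y in \<nu>. False" using dt(2) by simp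
    then show False using nu.AE_False by simp
  qed
  then have "X \<noteq> {}" using onto by (auto simp: doubly_transitive_def)
  then obtain d where d: "\<And>y. doubly_transitive Y y \<Longrightarrow> finite (fiber \<pi> X y) \<and> card (fiber \<pi> X y) = d"
    using degree_exists[OF assms(1-4)] by blast
  have deg: "degree_code \<pi> X Y = d"
    unfolding degree_code_def using d ex by (intro the_equality) auto
  interpret constant_degree X Y \<pi> \<nu> d "{y. doubly_transitive Y y}"
  proof
    show "factor_code \<pi> X Y" "ergodic_on Y \<nu>" "{y. doubly_transitive Y y} \<in> sets \<nu>"
      by (fact assms(3), fact assms(5), fact dt(1))
    show "AE y in \<nu>. y \<in> {y. doubly_transitive Y y}" using dt(2) by simp
    show "shift y \<in> {y. doubly_transitive Y y} \<longleftrightarrow> y \<in> {y. doubly_transitive Y y}" if "y \<in> Y" for y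
      using doubly_transitive_shift[OF Y that] by simp
  qed (use d in simp_all)
  show ?thesis using degree_sum[OF deg] deg by simp
qed

end
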